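(* Let $\mathscr{E}$ be a topos such that $\mathrm{Ab}(\mathscr{E})$ has a set of cogenerators, $k$ a commutative ring object in $\mathscr{E}$, $A$ a $k$-algebra and $M$ an $A$-bimodule. For $n\ge0$ let $\underline d^n=\sum_{i=0}^{n+1}(-1)^i\underline\partial^i:[A^{\otimes n},M]_k\to[A^{\otimes n+1},M]_k$. Then for all $n\ge 0$, $\underline d^{n+1}\circ\underline d^n=0$.
   Context: $\mathrm{Ab}(\mathscr{E})$ is the category of abelian group objects of $\mathscr{E}$. $k\text{-Mod}$ is the category of $k$-modules in $\mathscr{E}$, which is symmetric monoidal closed under $\otimes_k$ (also written $\otimes$) and the internal hom $[-,-]_k$ (the subobject of the topos internal hom of $k$-linear maps, in the internal language). A $k$-algebra is a monoid object in $k\text{-Mod}$, with multiplication $\mu_A$; an $A$-bimodule is a $k$-module with commuting left and right actions $l:A\otimes_kM\to M$ and $r:M\otimes_kA\to M$. Set $A^{\otimes 0}=k$, so $[A^{\otimes0},M]_k\cong M$. The maps $\underline\partial^i:[A^{\otimes n},M]_k\to[A^{\otimes n+1},M]_k$ are: for $0<i\le n$, $\underline\partial^i=[\delta_i,M]_k$ with $\delta_i=\mathrm{id}_A^{\otimes i-1}\otimes\mu_A\otimes\mathrm{id}_A^{\otimes n-i}$; $\underline\partial^0$ is the adjunct of $A\otimes_k[A^{\otimes n},M]_k\otimes_kA^{\otimes n}\xrightarrow{\mathrm{id}\otimes\mathrm{ev}}A\otimes_kM\xrightarrow{l}M$; $\underline\partial^{n+1}$ is the adjunct of $[A^{\otimes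 n},M]_k\otimes_kA^{\otimes n}\otimes_kA\xrightarrow{\mathrm{ev}\otimes\mathrm{id}}M\otimes_kA\xrightarrow{r}M$. In the internal language, $(\underline\partial^0f)(a_0\otimes\cdots\otimes a_n)=a_0f(a_1\otimes\cdots\otimes a_n)$, $(\underline\partial^if)(a_0\otimes\cdots\otimes a_n)=f(a_0\otimes\cdots\otimes a_{i-1}a_i\otimes\cdots\otimes a_n)$ for $0<i\le n$, and $(\underline\partial^{n+1}f)(a_0\otimes\cdots\otimes a_n)=f(a_0\otimes\cdots\otimes a_{n-1})a_n$. *)

theory Defs
  imports Main
begin

section \<open>Categories\<close>

record ('o, 'a) category_data =
  Obj :: "'o set"
  Arr :: "'a set"
  Dom :: "'a \<Rightarrow> 'o"
  Cod :: "'a \<Rightarrow> 'o"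
  Ide :: "'o \<Rightarrow> 'a"
  Comp :: "'a \<Rightarrow> 'a \<Rightarrow> 'a"  (infixr "\<cdot>\<index>" 70)

definition Hom :: "('o, 'a, 'z) category_data_scheme \<Rightarrow> 'o \<Rightarrow> 'o \<Rightarrow> 'a set" where
  "Hom C X Y = {f \<in> Arr C. Dom C f = X \<and> Cod C f = Y}"

locale category =
  fixes C :: "('o, 'a, 'z) category_data_scheme" (structure)
  assumes dom_obj: "f \<in> Arr C \<Longrightarrow> Dom C f \<in> Obj C"
    and cod_obj: "f \<in> Arr C \<Longrightarrow> Cod C f \<in> Obj C"
    and ide_hom: "X \<in> Obj C \<Longrightarrow> Ide C X \<in> Hom C X X"
    and comp_hom: "f \<in> Hom C X Y \<Longrightarrow> g \<in> Hom C Y Z \<Longrightarrow> g \<cdot> f \<in> Hom C X Z"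
    and comp_ide_right: "f \<in> Hom C X Y \<Longrightarrow> f \<cdot> Ide C X = f"
    and comp_ide_left: "f \<in> Hom C X Y \<Longrightarrow> Ide C Y \<cdot> f = f"
    and comp_assoc: "f \<in> Hom C W X \<Longrightarrow> g \<in> Hom C X Y \<Longrightarrow> h \<in> Hom C Y Z \<Longrightarrow>
      (h \<cdot> g) \<cdot> f = h \<cdot> (g \<cdot> f)"

definition mono :: "('o, 'a, 'z) category_data_scheme \<Rightarrow> 'a \<Rightarrow> bool" where
  "mono C m \<longleftrightarrow> m \<in> Arr C \<and>
    (\<forall>X. \<forall>f \<in> Hom C X (Dom C m). \<forall>g \<in> Hom C X (Dom C m). m \<cdot>\<^bsub>C\<^esub> f = m \<cdot>\<^bsub>C\<^esub> g \<longrightarrow> f = g)"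

definition inv_arr :: "('o, 'a, 'z) category_data_scheme \<Rightarrow> 'a \<Rightarrow> 'a" where
  "inv_arr C f = (THE g. g \<in> Hom C (Cod C f) (Dom C f) \<and>
    g \<cdot>\<^bsub>C\<^esub> f = Ide C (Dom C f) \<and> f \<cdot>\<^bsub>C\<^esub> g = Ide C (Cod C f))"

definition cogenerating :: "('o, 'a, 'z) category_data_scheme \<Rightarrow> 'o set \<Rightarrow> bool" where
  "cogenerating C S \<longleftrightarrow> S \<subseteq> Obj C \<and>
    (\<forall>X Y. \<forall>f \<in> Hom C X Y. \<forall>g \<in> Hom C X Y. f \<noteq> g \<longrightarrow>
      (\<exists>Q \<in> S. \<exists>h \<in> Hom C Y Q. h \<cdot>\<^bsub>C\<^esub> f \<noteq> h \<cdot>\<^bsub>C\<^esub> g))"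

text \<open>In HOL the objects of any category already form a set, so ``a set of cogenerators'' needs
  a size bound to carry information.  The type \<open>'u\<close> plays the role of the universe: a
  small set is one that embeds into \<open>'u\<close>.\<close>

definition has_set_of_cogenerators ::
  "'u itself \<Rightarrow> ('o, 'a, 'z) category_data_scheme \<Rightarrow> bool" where
  "has_set_of_cogenerators (_ :: 'u itself) C \<longleftrightarrow>
    (\<exists>S. cogenerating C S \<and> (\<exists>e :: 'o \<Rightarrow> 'u. inj_on e S))"


section \<open>Toposes\<close>

text \<open>An elementary topos with chosen structure.  \<open>Exp X Y\<close> is the exponential of \<open>Y\<close> by \<open>X\<close>,
  and \<open>Ev X Y\<close> is its evaluation, with the function on the left.  \<open>EqArr f g\<close> is the equalizer
  of \<open>f\<close> and \<open>g\<close>.\<close>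

record ('o, 'a) topos_data = "('o, 'a) category_data" +
  One :: 'o
  Prod :: "'o \<Rightarrow> 'o \<Rightarrow> 'o"
  P1 :: "'o \<Rightarrow> 'o \<Rightarrow> 'a"
  P2 :: "'o \<Rightarrow> 'o \<Rightarrow> 'a"
  EqArr :: "'a \<Rightarrow> 'a \<Rightarrow> 'a"
  Exp :: "'o \<Rightarrow> 'o \<Rightarrow> 'o"
  Ev :: "'o \<Rightarrow> 'o \<Rightarrow> 'a"
  Omega :: 'o
  Tru :: 'a

locale pre_topos = category E for E :: "('o, 'a) topos_data" (structure)
begin

definition bang :: "'o \<Rightarrow> 'a" where
  "bang X = (THE f. f \<in> Hom E X (One E))"

definition pair :: "'a \<Rightarrow> 'a \<Rightarrow> 'a"  ("\<langle>_, _\<rangle>") where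
  "\<langle>f, g\<rangle> = (THE h. h \<in> Hom E (Dom E f) (Prod E (Cod E f) (Cod E g)) \<and>
     P1 E (Cod E f) (Cod E g) \<cdot> h = f \<and> P2 E (Cod E f) (Cod E g) \<cdot> h = g)"

definition pmap :: "'a \<Rightarrow> 'a \<Rightarrow> 'a" where
  "pmap f g = \<langle>f \<cdot> P1 E (Dom E f) (Dom E g), g \<cdot> P2 E (Dom E f) (Dom E g)\<rangle>"

definition curry :: "'o \<Rightarrow> 'o \<Rightarrow> 'o \<Rightarrow> 'a \<Rightarrow> 'a" where
  "curry Z X Y g = (THE h. h \<in> Hom E Z (Exp E X Y) \<and> Ev E X Y \<cdot> pmap h (Ide E X) = g)"

definition factor :: "'a \<Rightarrow> 'a \<Rightarrow> 'a" where
  "factor m g = (THE h. h \<in> Hom E (Dom E g) (Dom E m) \<and> m \<cdot> h = g)"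

end

locale topos = pre_topos E for E :: "('o, 'a) topos_data" (structure) +
  assumes one_obj: "One E \<in> Obj E"
    and one_universal: "X \<in> Obj E \<Longrightarrow> \<exists>!f. f \<in> Hom E X (One E)"
    and prod_obj: "X \<in> Obj E \<Longrightarrow> Y \<in> Obj E \<Longrightarrow> Prod E X Y \<in> Obj E"
    and P1_hom: "X \<in> Obj E \<Longrightarrow> Y \<in> Obj E \<Longrightarrow> P1 E X Y \<in> Hom E (Prod E X Y) X"
    and P2_hom: "X \<in> Obj E \<Longrightarrow> Y \<in> Obj E \<Longrightarrow> P2 E X Y \<in> Hom E (Prod E X Y) Y"
    and prod_universal: "f \<in> Hom E Z X \<Longrightarrow> g \<in> Hom E Z Y \<Longrightarrow>
      \<exists>!h. h \<in> Hom E Z (Prod E X Y) \<and> P1 E X Y \<cdot> h = f \<and> P2 E X Y \<cdot> h = g"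
    and eq_arr: "f \<in> Hom E X Y \<Longrightarrow> g \<in> Hom E X Y \<Longrightarrow>
      EqArr E f g \<in> Arr E \<and> Cod E (EqArr E f g) = X \<and> f \<cdot> EqArr E f g = g \<cdot> EqArr E f g"
    and eq_universal: "f \<in> Hom E X Y \<Longrightarrow> g \<in> Hom E X Y \<Longrightarrow> h \<in> Hom E Z X \<Longrightarrow> f \<cdot> h = g \<cdot> h \<Longrightarrow>
      \<exists>!u. u \<in> Hom E Z (Dom E (EqArr E f g)) \<and> EqArr E f g \<cdot> u = h"
    and exp_obj: "X \<in> Obj E \<Longrightarrow> Y \<in> Obj E \<Longrightarrow> Exp E X Y \<in> Obj E"
    and ev_hom: "X \<in> Obj E \<Longrightarrow> Y \<in> Obj E \<Longrightarrow> Ev E X Y \<in> Hom E (Prod E (Exp E X Y) X) Y"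
    and exp_universal: "Z \<in> Obj E \<Longrightarrow> X \<in> Obj E \<Longrightarrow> g \<in> Hom E (Prod E Z X) Y \<Longrightarrow>
      \<exists>!h. h \<in> Hom E Z (Exp E X Y) \<and> Ev E X Y \<cdot> pmap h (Ide E X) = g"
    and omega_obj: "Omega E \<in> Obj E"
    and true_hom: "Tru E \<in> Hom E (One E) (Omega E)"
    and omega_universal: "mono E m \<Longrightarrow> m \<in> Hom E U X \<Longrightarrow>
      \<exists>!\<chi>. \<chi> \<in> Hom E X (Omega E) \<and> \<chi> \<cdot> m = Tru E \<cdot> bang U \<and>
        (\<forall>Z. \<forall>f \<in> Hom E Z X. \<chi> \<cdot> f = Tru E \<cdot> bang Z \<longrightarrow> (\<exists>!u. u \<in> Hom E Z U \<and> m \<cdot> u = f))"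


section \<open>Abelian group objects, commutative ring objects, modules\<close>

record ('o, 'a) abgrp =
  Car :: 'o
  Add :: 'a
  Zer :: 'a
  Neg :: 'a

record ('o, 'a) ringobj = "('o, 'a) abgrp" +
  Mul :: 'a
  Unt :: 'a

record ('o, 'a) modobj = "('o, 'a) abgrp" +
  Act :: 'a

text \<open>The axioms are stated on generalized elements \<open>X \<rightarrow> Car G\<close>, i.e. they are the Kripke-Joyal
  reading of the usual equational axioms.\<close>

context pre_topos
begin

definition gadd :: "('o, 'a, 'z) abgrp_scheme \<Rightarrow> 'a \<Rightarrow> 'a \<Rightarrow> 'a" where
  "gadd G f g = Add G \<cdot> \<langle>f, g\<rangle>"

definition gzero :: "('o, 'a, 'z) abgrp_scheme \<Rightarrow> 'o \<Rightarrow> 'a" where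
  "gzero G X = Zer G \<cdot> bang X"

definition gneg :: "('o, 'a, 'z) abgrp_scheme \<Rightarrow> 'a \<Rightarrow> 'a" where
  "gneg G f = Neg G \<cdot> f"

definition gmul :: "('o, 'a, 'z) ringobj_scheme \<Rightarrow> 'a \<Rightarrow> 'a \<Rightarrow> 'a" where
  "gmul R c d = Mul R \<cdot> \<langle>c, d\<rangle>"

definition gunit :: "('o, 'a, 'z) ringobj_scheme \<Rightarrow> 'o \<Rightarrow> 'a" where
  "gunit R X = Unt R \<cdot> bang X"

definition gact :: "('o, 'a, 'z) modobj_scheme \<Rightarrow> 'a \<Rightarrow> 'a \<Rightarrow> 'a" where
  "gact M c f = Act M \<cdot> \<langle>c, f\<rangle>"

definition ab_group_object :: "('o, 'a, 'z) abgrp_scheme \<Rightarrow> bool" where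
  "ab_group_object G \<longleftrightarrow>
    Car G \<in> Obj E \<and>
    Add G \<in> Hom E (Prod E (Car G) (Car G)) (Car G) \<and>
    Zer G \<in> Hom E (One E) (Car G) \<and>
    Neg G \<in> Hom E (Car G) (Car G) \<and>
    (\<forall>X \<in> Obj E. \<forall>f \<in> Hom E X (Car G). \<forall>g \<in> Hom E X (Car G). \<forall>h \<in> Hom E X (Car G).
      gadd G (gadd G f g) h = gadd G f (gadd G g h) \<and>
      gadd G f g = gadd G g f \<and>
      gadd G (gzero G X) f = f \<and>
      gadd G (gneg G f) f = gzero G X)"

definition ab_group_hom ::
  "('o, 'a, 'z) abgrp_scheme \<Rightarrow> ('o, 'a, 'w) abgrp_scheme \<Rightarrow> 'a \<Rightarrow> bool" where
  "ab_group_hom G H f \<longleftrightarrow> f \<in> Hom E (Car G) (Car H) \<and> f \<cdot> Add G = Add H \<cdot> pmap f f"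

definition Ab :: "(('o, 'a) abgrp, ('o, 'a) abgrp \<times> 'a \<times> ('o, 'a) abgrp) category_data" where
  "Ab = \<lparr> Obj = {G. ab_group_object G},
          Arr = {(G, f, H). ab_group_object G \<and> ab_group_object H \<and> ab_group_hom G H f},
          Dom = (\<lambda>(G, f, H). G),
          Cod = (\<lambda>(G, f, H). H),
          Ide = (\<lambda>G. (G, Ide E (Car G), G)),
          Comp = (\<lambda>(H, g, K) (G, f, H'). (G, g \<cdot> f, K)) \<rparr>"

definition comm_ring_object :: "('o, 'a, 'z) ringobj_scheme \<Rightarrow> bool" where
  "comm_ring_object R \<longleftrightarrow>
    ab_group_object R \<and>
    Mul R \<in> Hom E (Prod E (Car R) (Car R)) (Car R) \<and>
    Unt R \<in> Hom E (One E) (Car R) \<and>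
    (\<forall>X \<in> Obj E. \<forall>a \<in> Hom E X (Car R). \<forall>b \<in> Hom E X (Car R). \<forall>c \<in> Hom E X (Car R).
      gmul R (gmul R a b) c = gmul R a (gmul R b c) \<and>
      gmul R a b = gmul R b a \<and>
      gmul R (gunit R X) a = a \<and>
      gmul R a (gadd R b c) = gadd R (gmul R a b) (gmul R a c))"

end

locale topos_with_ring = topos E for E :: "('o, 'a) topos_data" (structure) +
  fixes k :: "('o, 'a) ringobj"
  assumes comm_ring: "comm_ring_object k"
begin

definition module :: "('o, 'a) modobj \<Rightarrow> bool" where
  "module M \<longleftrightarrow>
    ab_group_object M \<and>
    Act M \<in> Hom E (Prod E (Car k) (Car M)) (Car M) \<and>
    (\<forall>X \<in> Obj E. \<forall>c \<in> Hom E X (Car k). \<forall>d \<in> Hom E X (Car k).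
      \<forall>f \<in> Hom E X (Car M). \<forall>g \<in> Hom E X (Car M).
      gact M (gmul k c d) f = gact M c (gact M d f) \<and>
      gact M (gunit k X) f = f \<and>
      gact M (gadd k c d) f = gadd M (gact M c f) (gact M d f) \<and>
      gact M c (gadd M f g) = gadd M (gact M c f) (gact M c g))"

definition linear :: "('o, 'a) modobj \<Rightarrow> ('o, 'a) modobj \<Rightarrow> 'a \<Rightarrow> bool" where
  "linear M N f \<longleftrightarrow>
    ab_group_hom M N f \<and> f \<cdot> Act M = Act N \<cdot> pmap (Ide E (Car k)) f"

definition bilinear ::
  "('o, 'a) modobj \<Rightarrow> ('o, 'a) modobj \<Rightarrow> ('o, 'a) modobj \<Rightarrow> 'a \<Rightarrow> bool" where
  "bilinear M N P b \<longleftrightarrow>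
    b \<in> Hom E (Prod E (Car M) (Car N)) (Car P) \<and>
    (\<forall>X \<in> Obj E. \<forall>c \<in> Hom E X (Car k).
      \<forall>m \<in> Hom E X (Car M). \<forall>m' \<in> Hom E X (Car M). \<forall>n \<in> Hom E X (Car N). \<forall>n' \<in> Hom E X (Car N).
      b \<cdot> \<langle>gadd M m m', n\<rangle> = gadd P (b \<cdot> \<langle>m, n\<rangle>) (b \<cdot> \<langle>m', n\<rangle>) \<and>
      b \<cdot> \<langle>m, gadd N n n'\<rangle> = gadd P (b \<cdot> \<langle>m, n\<rangle>) (b \<cdot> \<langle>m, n'\<rangle>) \<and>
      b \<cdot> \<langle>gact M c m, n\<rangle> = gact P c (b \<cdot> \<langle>m, n\<rangle>) \<and>
      b \<cdot> \<langle>m, gact N c n\<rangle> = gact P c (b \<cdot> \<langle>m, n\<rangle>))"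

definition unit_module :: "('o, 'a) modobj" where
  "unit_module = \<lparr> Car = Car k, Add = Add k, Zer = Zer k, Neg = Neg k, Act = Mul k \<rparr>"


subsection \<open>The internal hom of modules\<close>

text \<open>The subobject of the exponential \<open>Exp E (Car M) (Car N)\<close> given in the internal language by
  \<open>{f. (\<forall>m m'. f (m + m') = f m + f m') \<and> (\<forall>c m. f (c m) = c (f m))}\<close>, as the equalizer of the two
  arrows that send \<open>f\<close> to the two sides of these equations; the module structure is pointwise.\<close>

definition hom_lhs :: "('o, 'a) modobj \<Rightarrow> ('o, 'a) modobj \<Rightarrow> 'a" where
  "hom_lhs M N =
    (let V = Car M; W = Car N; X = Exp E V W; VV = Prod E V V; KV = Prod E (Car k) V in
     \<langle> curry X VV W (Ev E V W \<cdot> \<langle>P1 E X VV, Add M \<cdot> P2 E X VV\<rangle>),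
       curry X KV W (Ev E V W \<cdot> \<langle>P1 E X KV, Act M \<cdot> P2 E X KV\<rangle>) \<rangle>)"

definition hom_rhs :: "('o, 'a) modobj \<Rightarrow> ('o, 'a) modobj \<Rightarrow> 'a" where
  "hom_rhs M N =
    (let V = Car M; W = Car N; X = Exp E V W; VV = Prod E V V; KV = Prod E (Car k) V in
     \<langle> curry X VV W (gadd N (Ev E V W \<cdot> \<langle>P1 E X VV, P1 E V V \<cdot> P2 E X VV\<rangle>)
                            (Ev E V W \<cdot> \<langle>P1 E X VV, P2 E V V \<cdot> P2 E X VV\<rangle>)),
       curry X KV W (gact N (P1 E (Car k) V \<cdot> P2 E X KV)
                            (Ev E V W \<cdot> \<langle>P1 E X KV, P2 E (Car k) V \<cdot> P2 E X KV\<rangle>)) \<rangle>)"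

definition ihom_incl :: "('o, 'a) modobj \<Rightarrow> ('o, 'a) modobj \<Rightarrow> 'a" where
  "ihom_incl M N = EqArr E (hom_lhs M N) (hom_rhs M N)"

definition ihom_app :: "('o, 'a) modobj \<Rightarrow> ('o, 'a) modobj \<Rightarrow> 'a \<Rightarrow> 'a \<Rightarrow> 'a" where
  "ihom_app M N f m = Ev E (Car M) (Car N) \<cdot> \<langle>ihom_incl M N \<cdot> f, m\<rangle>"

text \<open>\<open>ihom_curry M N Z g\<close> is the arrow from \<open>Z\<close> to the internal hom corresponding to an arrow
  \<open>g : Z \<times> Car M \<rightarrow> Car N\<close> that is linear in the second variable.\<close>

definition ihom_curry :: "('o, 'a) modobj \<Rightarrow> ('o, 'a) modobj \<Rightarrow> 'o \<Rightarrow> 'a \<Rightarrow> 'a" where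
  "ihom_curry M N Z g = factor (ihom_incl M N) (curry Z (Car M) (Car N) g)"

definition ihom :: "('o, 'a) modobj \<Rightarrow> ('o, 'a) modobj \<Rightarrow> ('o, 'a) modobj" where
  "ihom M N =
    (let V = Car M; H = Dom E (ihom_incl M N); HH = Prod E H H; KH = Prod E (Car k) H in
     \<lparr> Car = H,
       Add = ihom_curry M N HH
         (gadd N (ihom_app M N (P1 E H H \<cdot> P1 E HH V) (P2 E HH V))
                 (ihom_app M N (P2 E H H \<cdot> P1 E HH V) (P2 E HH V))),
       Zer = ihom_curry M N (One E) (gzero N (Prod E (One E) V)),
       Neg = ihom_curry M N H (gneg N (ihom_app M N (P1 E H V) (P2 E H V))),
       Act = ihom_curry M N KH
         (gact N (P1 E (Car k) H \<cdot> P1 E KH V)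
                 (ihom_app M N (P2 E (Car k) H \<cdot> P1 E KH V) (P2 E KH V))) \<rparr>)"

text \<open>\<open>ihom_pre M' M N f\<close> is \<open>[f, N] : [M, N] \<rightarrow> [M', N]\<close> for \<open>f : M' \<rightarrow> M\<close>.\<close>

definition ihom_pre ::
  "('o, 'a) modobj \<Rightarrow> ('o, 'a) modobj \<Rightarrow> ('o, 'a) modobj \<Rightarrow> 'a \<Rightarrow> 'a" where
  "ihom_pre M' M N f =
    (let H = Car (ihom M N); V' = Car M' in
     ihom_curry M' N H (ihom_app M N (P1 E H V') (f \<cdot> P2 E H V')))"

end


section \<open>The tensor product of modules\<close>

text \<open>A chosen tensor product \<open>M \<otimes> N\<close> with its universal bilinear map \<open>\<tau> M N\<close>, for all modules
  \<open>M\<close> and \<open>N\<close>.  Its symmetric monoidal structure is derived from the universal property.\<close>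

locale topos_with_tensor = topos_with_ring E k
  for E :: "('o, 'a) topos_data" (structure) and k :: "('o, 'a) ringobj" +
  fixes tensor :: "('o, 'a) modobj \<Rightarrow> ('o, 'a) modobj \<Rightarrow> ('o, 'a) modobj"  (infixr "\<otimes>" 75)
    and \<tau> :: "('o, 'a) modobj \<Rightarrow> ('o, 'a) modobj \<Rightarrow> 'a"
  assumes tensor_module: "module M \<Longrightarrow> module N \<Longrightarrow> module (M \<otimes> N)"
    and tensor_bilinear: "module M \<Longrightarrow> module N \<Longrightarrow> bilinear M N (M \<otimes> N) (\<tau> M N)"
    and tensor_universal: "module M \<Longrightarrow> module N \<Longrightarrow> module P \<Longrightarrow> bilinear M N P b \<Longrightarrow>
      \<exists>!h. linear (M \<otimes> N) P h \<and> h \<cdot> \<tau> M N = b"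
begin

definition tlift :: "('o, 'a) modobj \<Rightarrow> ('o, 'a) modobj \<Rightarrow> ('o, 'a) modobj \<Rightarrow> 'a \<Rightarrow> 'a" where
  "tlift M N P b = (THE h. linear (M \<otimes> N) P h \<and> h \<cdot> \<tau> M N = b)"

text \<open>\<open>tmap M M' N N' f g\<close> is \<open>f \<otimes> g : M \<otimes> N \<rightarrow> M' \<otimes> N'\<close> for \<open>f : M \<rightarrow> M'\<close> and \<open>g : N \<rightarrow> N'\<close>.\<close>

definition tmap ::
  "('o, 'a) modobj \<Rightarrow> ('o, 'a) modobj \<Rightarrow> ('o, 'a) modobj \<Rightarrow> ('o, 'a) modobj \<Rightarrow> 'a \<Rightarrow> 'a \<Rightarrow> 'a" where
  "tmap M M' N N' f g = tlift M N (M' \<otimes> N') (\<tau> M' N' \<cdot> pmap f g)"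

definition idm :: "('o, 'a) modobj \<Rightarrow> 'a" where
  "idm M = Ide E (Car M)"

definition braid :: "('o, 'a) modobj \<Rightarrow> ('o, 'a) modobj \<Rightarrow> 'a" where
  "braid M N = tlift M N (N \<otimes> M)
    (\<tau> N M \<cdot> \<langle>P2 E (Car M) (Car N), P1 E (Car M) (Car N)\<rangle>)"

definition lunit :: "('o, 'a) modobj \<Rightarrow> 'a" where
  "lunit M = tlift unit_module M M (Act M)"

definition runit :: "('o, 'a) modobj \<Rightarrow> 'a" where
  "runit M = tlift M unit_module M (Act M \<cdot> \<langle>P2 E (Car M) (Car k), P1 E (Car M) (Car k)\<rangle>)"

text \<open>The associator is the linear map \<open>(M \<otimes> N) \<otimes> P \<rightarrow> M \<otimes> (N \<otimes> P)\<close> with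
  \<open>(m \<otimes> n) \<otimes> p \<mapsto> m \<otimes> (n \<otimes> p)\<close>.\<close>

definition assoc :: "('o, 'a) modobj \<Rightarrow> ('o, 'a) modobj \<Rightarrow> ('o, 'a) modobj \<Rightarrow> 'a" where
  "assoc M N P =
    (let U = Car M; V = Car N; W = Car P; UV = Prod E U V in
     THE h. linear ((M \<otimes> N) \<otimes> P) (M \<otimes> (N \<otimes> P)) h \<and>
       h \<cdot> \<tau> (M \<otimes> N) P \<cdot> pmap (\<tau> M N) (Ide E W) =
       \<tau> M (N \<otimes> P) \<cdot> \<langle>P1 E U V \<cdot> P1 E UV W, \<tau> N P \<cdot> \<langle>P2 E U V \<cdot> P1 E UV W, P2 E UV W\<rangle>\<rangle>)"

definition hom_ev :: "('o, 'a) modobj \<Rightarrow> ('o, 'a) modobj \<Rightarrow> 'a" where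
  "hom_ev M N = tlift (ihom M N) M N
    (let H = Car (ihom M N); V = Car M in ihom_app M N (P1 E H V) (P2 E H V))"

text \<open>\<open>adjunct P M N g : P \<rightarrow> [M, N]\<close> is the adjunct of \<open>g : P \<otimes> M \<rightarrow> N\<close>.\<close>

definition adjunct ::
  "('o, 'a) modobj \<Rightarrow> ('o, 'a) modobj \<Rightarrow> ('o, 'a) modobj \<Rightarrow> 'a \<Rightarrow> 'a" where
  "adjunct P M N g = ihom_curry M N (Car P) (g \<cdot> \<tau> P M)"

end


section \<open>Algebras and bimodules\<close>

locale k_algebra = topos_with_tensor E k tensor \<tau>
  for E :: "('o, 'a) topos_data" (structure) and k :: "('o, 'a) ringobj"
    and tensor :: "('o, 'a) modobj \<Rightarrow> ('o, 'a) modobj \<Rightarrow> ('o, 'a) modobj"  (infixr "\<otimes>" 75)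
    and \<tau> :: "('o, 'a) modobj \<Rightarrow> ('o, 'a) modobj \<Rightarrow> 'a" +
  fixes A :: "('o, 'a) modobj" and \<mu> \<eta> :: 'a
  assumes alg_module: "module A"
    and mult_linear: "linear (A \<otimes> A) A \<mu>"
    and unit_linear: "linear unit_module A \<eta>"
    and mult_assoc: "\<mu> \<cdot> tmap (A \<otimes> A) A A A \<mu> (idm A) =
      \<mu> \<cdot> tmap A A (A \<otimes> A) A (idm A) \<mu> \<cdot> assoc A A A"
    and mult_unit_left: "\<mu> \<cdot> tmap unit_module A A A \<eta> (idm A) = lunit A"
    and mult_unit_right: "\<mu> \<cdot> tmap A A unit_module A (idm A) \<eta> = runit A"

locale bimodule = k_algebra E k tensor \<tau> A \<mu> \<eta>
  for E :: "('o, 'a) topos_data" (structure) and k :: "('o, 'a) ringobj"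
    and tensor :: "('o, 'a) modobj \<Rightarrow> ('o, 'a) modobj \<Rightarrow> ('o, 'a) modobj"  (infixr "\<otimes>" 75)
    and \<tau> :: "('o, 'a) modobj \<Rightarrow> ('o, 'a) modobj \<Rightarrow> 'a"
    and A :: "('o, 'a) modobj" and \<mu> \<eta> :: 'a +
  fixes M :: "('o, 'a) modobj" and l r :: 'a
  assumes bimod_module: "module M"
    and left_linear: "linear (A \<otimes> M) M l"
    and right_linear: "linear (M \<otimes> A) M r"
    and left_assoc: "l \<cdot> tmap (A \<otimes> A) A M M \<mu> (idm M) =
      l \<cdot> tmap A A (A \<otimes> M) M (idm A) l \<cdot> assoc A A M"
    and left_unit: "l \<cdot> tmap unit_module A M M \<eta> (idm M) = lunit M"
    and right_assoc: "r \<cdot> tmap (M \<otimes> A) M A A r (idm A) =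
      r \<cdot> tmap M M (A \<otimes> A) A (idm M) \<mu> \<cdot> assoc M A A"
    and right_unit: "r \<cdot> tmap M M unit_module A (idm M) \<eta> = runit M"
    and left_right: "r \<cdot> tmap (A \<otimes> M) M A A l (idm A) =
      l \<cdot> tmap A A (M \<otimes> A) M (idm A) r \<cdot> assoc A M A"


section \<open>The Hochschild cochain objects and their differentials\<close>

context k_algebra
begin

text \<open>Tensor powers are bracketed to the right and end in the unit:
  \<open>A \<otimes> (A \<otimes> (\<dots> \<otimes> (A \<otimes> k)))\<close>.  In particular
  \<open>tpow 1 = A \<otimes> k\<close>, which is canonically isomorphic to \<open>A\<close>.\<close>

primrec tpow :: "nat \<Rightarrow> ('o, 'a) modobj" where
  "tpow 0 = unit_module"
| "tpow (Suc n) = A \<otimes> tpow n"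

text \<open>\<open>face n i : tpow (Suc n) \<rightarrow> tpow n\<close>, for \<open>0 < i \<le> n\<close>, multiplies the factors \<open>i\<close> and \<open>i + 1\<close>
  (counted from 1).  The values outside this range are irrelevant.\<close>

fun face :: "nat \<Rightarrow> nat \<Rightarrow> 'a" where
  "face (Suc n) (Suc 0) =
     tmap (A \<otimes> A) A (tpow n) (tpow n) \<mu> (idm (tpow n)) \<cdot> inv_arr E (assoc A A (tpow n))"
| "face (Suc n) (Suc (Suc i)) =
     tmap A A (tpow (Suc n)) (tpow n) (idm A) (face n (Suc i))"
| "face _ _ = undefined"

text \<open>The canonical isomorphism \<open>shift n : tpow (Suc n) = A \<otimes> tpow n \<rightarrow> tpow n \<otimes> A\<close> that regroups
  the factors without permuting them.\<close>

primrec shift :: "nat \<Rightarrow> 'a" where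
  "shift 0 = inv_arr E (lunit A) \<cdot> runit A"
| "shift (Suc n) = inv_arr E (assoc A (tpow n) A) \<cdot>
     tmap A A (tpow (Suc n)) (tpow n \<otimes> A) (idm A) (shift n)"

end

context bimodule
begin

definition cochain :: "nat \<Rightarrow> ('o, 'a) modobj" where
  "cochain n = ihom (tpow n) M"

text \<open>For \<open>i = 0\<close> and \<open>i = n + 1\<close> the source \<open>cochain n \<otimes> tpow (Suc n)\<close> is first brought into the
  form \<open>A \<otimes> (cochain n \<otimes> tpow n)\<close>, respectively \<open>(cochain n \<otimes> tpow n) \<otimes> A\<close>.\<close>

definition coface :: "nat \<Rightarrow> nat \<Rightarrow> 'a" where
  "coface n i =
    (let H = cochain n; T = tpow n; T' = tpow (Suc n) in
     if i = 0 then
       adjunct H T' M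
         (l \<cdot> tmap A A (H \<otimes> T) M (idm A) (hom_ev T M) \<cdot>
          assoc A H T \<cdot> tmap (H \<otimes> A) (A \<otimes> H) T T (braid H A) (idm T) \<cdot> inv_arr E (assoc H A T))
     else if i \<le> n then
       ihom_pre T' T M (face n i)
     else
       adjunct H T' M
         (r \<cdot> tmap (H \<otimes> T) M A A (hom_ev T M) (idm A) \<cdot>
          inv_arr E (assoc H T A) \<cdot> tmap H H T' (T \<otimes> A) (idm H) (shift n)))"

text \<open>Alternating sums are taken in the abelian group of arrows from \<open>X\<close> to \<open>Car G\<close>.\<close>

primrec alt_sum :: "('o, 'a) modobj \<Rightarrow> 'o \<Rightarrow> (nat \<Rightarrow> 'a) \<Rightarrow> nat \<Rightarrow> 'a" where
  "alt_sum G X f 0 = gzero G X"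
| "alt_sum G X f (Suc m) = gadd G (alt_sum G X f m) (if even m then f m else gneg G (f m))"

definition differential :: "nat \<Rightarrow> 'a" where
  "differential n = alt_sum (cochain (Suc n)) (Car (cochain n)) (coface n) (n + 2)"

end

end

theory Submission
  imports Defs
begin

text \<open>Everything is computed on generalized elements.  A map out of a tensor product is tested on elements
  \<open>m \<otimes> n\<close>, also when it depends on parameters from an arbitrary object; this reduces each cosimplicial identity
  \<open>\<partial>\<^sup>j \<partial>\<^sup>i = \<partial>\<^sup>i \<partial>\<^sup>j\<^sup>-\<^sup>1\<close>, \<open>i < j\<close>, to the formulas for the \<open>\<partial>\<^sup>i\<close> and the
  associativity laws.  Only \<open>\<partial>\<^sup>n\<^sup>+\<^sup>1\<close> is not directly visible on elements \<open>a \<otimes> t\<close>, because the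
  tensor powers are bracketed to the right: it is evaluated through \<open>shift\<close>, whose compatibility with the faces is
  shown by induction.  The identities make the terms of \<open>d d\<close> cancel in pairs.\<close>

section \<open>Generalized elements of products and exponentials\<close>

text \<open>Elements of a tensor product are in general not sums of pure tensors at the same stage,
  and the universal property speaks of one linear map without parameters. But testing on three
  factors freezes one of them, and that factor lives at an arbitrary stage. Hence the detour through
  powers: a family of linear maps indexed by \<open>Z\<close> becomes one linear map into the module
  of all arrows out of \<open>Z\<close>, so cartesian closedness makes the universal property stable
  under change of stage. Families are HOL functions on elements, natural in the stage
  (\<open>nat_op\<close>, \<open>lin_op\<close>), rather than arrows: the linearity of a term then
  follows from its syntax, and by Yoneda the term comes from an arrow, its value at projections. The
  structure maps (\<open>tmap\<close>, \<open>assoc\<close>, \<open>ihom_curry\<close>) unfold to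
  definite descriptions, so each must be constructed from such a term before its values can be read
  off. The recursion of \<open>shift\<close> leaves a reassociation applied to an element that need
  not be a pure tensor. The identities for the last factor are therefore proved by moving faces past
  this reassociation.\<close>

context category
begin

lemma hom_dom: "f \<in> Hom C X Y \<Longrightarrow> Dom C f = X"
  and hom_cod: "f \<in> Hom C X Y \<Longrightarrow> Cod C f = Y"
  by (simp_all add: Hom_def)

lemma hom_objs: "f \<in> Hom C X Y \<Longrightarrow> X \<in> Obj C \<and> Y \<in> Obj C"
  using dom_obj cod_obj by (auto simp: Hom_def)

lemma hom_dom_obj: "f \<in> Hom C X Y \<Longrightarrow> X \<in> Obj C"
  using hom_objs by blast

text \<open>\<open>inv_arr\<close> is a definite description; since any left inverse equals any
  right inverse, exhibiting one two-sided inverse identifies it.\<close>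

lemma inv_arr_eq:
  assumes "f \<in> Hom C X Y" "g \<in> Hom C Y X" "g \<cdot> f = Ide C X" "f \<cdot> g = Ide C Y"
  shows "inv_arr C f = g"
proof -
  have "h = g" if "h \<in> Hom C Y X" "h \<cdot> f = Ide C X" for h
  proof -
    have "h = h \<cdot> (f \<cdot> g)" using that assms comp_ide_right by simp
    also have "\<dots> = (h \<cdot> f) \<cdot> g" using comp_assoc[OF assms(2,1) that(1)] by simp
    finally show ?thesis using that assms comp_ide_left by simp
  qed
  then show ?thesis
    unfolding inv_arr_def hom_dom[OF assms(1)] hom_cod[OF assms(1)]
    using assms by (blast intro!: the_equality)
qed

end

context topos
begin

lemma pair_ex1:
  assumes "f \<in> Hom E Z X" "g \<in> Hom E Z Y"
  shows "\<langle>f, g\<rangle> \<in> Hom E Z (Prod E X Y) \<and> P1 E X Y \<cdot> \<langle>f, g\<rangle> = f \<and> P2 E X Y \<cdot> \<langle>f, g\<rangle> = g"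
  using theI'[OF prod_universal[OF assms]] hom_dom[OF assms(1)] hom_cod[OF assms(1)] hom_cod[OF assms(2)]
  by (simp add: pair_def)

lemma pair_hom [intro]: "f \<in> Hom E Z X \<Longrightarrow> g \<in> Hom E Z Y \<Longrightarrow> \<langle>f, g\<rangle> \<in> Hom E Z (Prod E X Y)"
  and P1_pair: "f \<in> Hom E Z X \<Longrightarrow> g \<in> Hom E Z Y \<Longrightarrow> P1 E X Y \<cdot> \<langle>f, g\<rangle> = f"
  and P2_pair: "f \<in> Hom E Z X \<Longrightarrow> g \<in> Hom E Z Y \<Longrightarrow> P2 E X Y \<cdot> \<langle>f, g\<rangle> = g"
  using pair_ex1 by blast+

lemma prod_eqI:
  assumes "h \<in> Hom E Z (Prod E X Y)" "h' \<in> Hom E Z (Prod E X Y)" "X \<in> Obj E" "Y \<in> Obj E"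
    "P1 E X Y \<cdot> h = P1 E X Y \<cdot> h'" "P2 E X Y \<cdot> h = P2 E X Y \<cdot> h'"
  shows "h = h'"
  using prod_universal[OF comp_hom[OF assms(1) P1_hom[OF assms(3,4)]]
      comp_hom[OF assms(1) P2_hom[OF assms(3,4)]]] assms(1,2,5,6)
  by auto

lemma pair_comp:
  assumes "f \<in> Hom E Z X" "g \<in> Hom E Z Y" "u \<in> Hom E W Z"
  shows "\<langle>f, g\<rangle> \<cdot> u = \<langle>f \<cdot> u, g \<cdot> u\<rangle>"
proof (rule prod_eqI)
  have XY: "X \<in> Obj E" "Y \<in> Obj E" using assms hom_objs by blast+
  then show "X \<in> Obj E" "Y \<in> Obj E" by auto
  have p: "\<langle>f, g\<rangle> \<in> Hom E Z (Prod E X Y)" using assms by blast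
  note c = comp_hom[OF assms(3,1)] comp_hom[OF assms(3,2)]
  show "\<langle>f, g\<rangle> \<cdot> u \<in> Hom E W (Prod E X Y)" "\<langle>f \<cdot> u, g \<cdot> u\<rangle> \<in> Hom E W (Prod E X Y)"
    using comp_hom[OF assms(3) p] pair_hom[OF c] by auto
  show "P1 E X Y \<cdot> \<langle>f, g\<rangle> \<cdot> u = P1 E X Y \<cdot> \<langle>f \<cdot> u, g \<cdot> u\<rangle>"
    using comp_assoc[OF assms(3) p P1_hom[OF XY]] P1_pair[OF assms(1,2)] P1_pair[OF c] by simp
  show "P2 E X Y \<cdot> \<langle>f, g\<rangle> \<cdot> u = P2 E X Y \<cdot> \<langle>f \<cdot> u, g \<cdot> u\<rangle>"
    using comp_assoc[OF assms(3) p P2_hom[OF XY]] P2_pair[OF assms(1,2)] P2_pair[OF c] by simp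
qed

lemma pair_eta:
  assumes "h \<in> Hom E Z (Prod E X Y)" "X \<in> Obj E" "Y \<in> Obj E"
  shows "\<langle>P1 E X Y \<cdot> h, P2 E X Y \<cdot> h\<rangle> = h"
proof -
  note h = comp_hom[OF assms(1) P1_hom[OF assms(2,3)]] comp_hom[OF assms(1) P2_hom[OF assms(2,3)]]
  show ?thesis
    by (rule prod_eqI[OF pair_hom[OF h] assms]) (simp_all add: P1_pair[OF h] P2_pair[OF h])
qed

lemma prod_elem_cases:
  assumes "h \<in> Hom E Z (Prod E X Y)" "X \<in> Obj E" "Y \<in> Obj E"
  obtains x y where "x \<in> Hom E Z X" "y \<in> Hom E Z Y" "h = \<langle>x, y\<rangle>"
  using that[OF comp_hom[OF assms(1) P1_hom[OF assms(2,3)]] comp_hom[OF assms(1) P2_hom[OF assms(2,3)]]]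
    pair_eta[OF assms] by simp

lemma comp_pair:
  assumes "b \<in> Hom E (Prod E X Y) W" "x \<in> Hom E Z X" "y \<in> Hom E Z Y" "u \<in> Hom E U Z"
  shows "(b \<cdot> \<langle>x, y\<rangle>) \<cdot> u = b \<cdot> \<langle>x \<cdot> u, y \<cdot> u\<rangle>"
  using comp_assoc[OF assms(4) pair_hom[OF assms(2,3)] assms(1)] pair_comp[OF assms(2-4)] by simp

text \<open>Yoneda: the identity of \<open>Prod E X Y\<close> is itself a generalized element,
  namely the pair of the projections.\<close>

lemma prod_arr_eqI:
  assumes "f \<in> Hom E (Prod E X Y) W" "g \<in> Hom E (Prod E X Y) W" "X \<in> Obj E" "Y \<in> Obj E"
    and "\<And>Z x y. x \<in> Hom E Z X \<Longrightarrow> y \<in> Hom E Z Y \<Longrightarrow> f \<cdot> \<langle>x, y\<rangle> = g \<cdot> \<langle>x, y\<rangle>"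
  shows "f = g"
proof -
  let ?i = "Ide E (Prod E X Y)"
  have i: "?i \<in> Hom E (Prod E X Y) (Prod E X Y)" using ide_hom prod_obj assms by blast
  have "f \<cdot> ?i = g \<cdot> ?i"
    by (rule prod_elem_cases[OF i assms(3,4)]) (simp add: assms(5))
  then show ?thesis using comp_ide_right[OF assms(1)] comp_ide_right[OF assms(2)] by simp
qed

lemma pmap_pair:
  assumes "f \<in> Hom E X X'" "g \<in> Hom E Y Y'" "x \<in> Hom E Z X" "y \<in> Hom E Z Y"
  shows "pmap f g \<cdot> \<langle>x, y\<rangle> = \<langle>f \<cdot> x, g \<cdot> y\<rangle>"
proof -
  have XY: "X \<in> Obj E" "Y \<in> Obj E" using assms hom_objs by blast+
  note P = P1_hom[OF XY] P2_hom[OF XY]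
  have "pmap f g \<cdot> \<langle>x, y\<rangle> = \<langle>(f \<cdot> P1 E X Y) \<cdot> \<langle>x, y\<rangle>, (g \<cdot> P2 E X Y) \<cdot> \<langle>x, y\<rangle>\<rangle>"
    unfolding pmap_def hom_dom[OF assms(1)] hom_dom[OF assms(2)]
    using pair_comp[OF comp_hom[OF P(1) assms(1)] comp_hom[OF P(2) assms(2)] pair_hom[OF assms(3,4)]] by simp
  then show ?thesis
    using comp_assoc[OF pair_hom[OF assms(3,4)] P(1) assms(1)]
      comp_assoc[OF pair_hom[OF assms(3,4)] P(2) assms(2)]
      P1_pair[OF assms(3,4)] P2_pair[OF assms(3,4)] by simp
qed

lemma pmap_hom:
  assumes "f \<in> Hom E X X'" "g \<in> Hom E Y Y'"
  shows "pmap f g \<in> Hom E (Prod E X Y) (Prod E X' Y')"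
  unfolding pmap_def hom_dom[OF assms(1)] hom_dom[OF assms(2)]
  using pair_hom[OF comp_hom[OF P1_hom assms(1)] comp_hom[OF P2_hom assms(2)]]
    hom_objs[OF assms(1)] hom_objs[OF assms(2)] by blast

lemma curry_ex1:
  assumes "Z \<in> Obj E" "X \<in> Obj E" "g \<in> Hom E (Prod E Z X) Y"
  shows "curry Z X Y g \<in> Hom E Z (Exp E X Y) \<and> Ev E X Y \<cdot> pmap (curry Z X Y g) (Ide E X) = g"
  using theI'[OF exp_universal[OF assms]] by (simp add: curry_def)

lemma curry_hom:
  "X \<in> Obj E \<Longrightarrow> Z \<in> Obj E \<Longrightarrow> g \<in> Hom E (Prod E Z X) Y \<Longrightarrow> curry Z X Y g \<in> Hom E Z (Exp E X Y)"
  using curry_ex1 by blast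

lemma Ev_pmap_pair:
  assumes "h \<in> Hom E Z (Exp E X Y)" "z \<in> Hom E W Z" "x \<in> Hom E W X" "Y \<in> Obj E"
  shows "(Ev E X Y \<cdot> pmap h (Ide E X)) \<cdot> \<langle>z, x\<rangle> = Ev E X Y \<cdot> \<langle>h \<cdot> z, x\<rangle>"
proof -
  have X: "X \<in> Obj E" using assms hom_objs by blast
  show ?thesis
    using comp_assoc[OF pair_hom[OF assms(2,3)] pmap_hom[OF assms(1) ide_hom[OF X]] ev_hom[OF X assms(4)]]
      pmap_pair[OF assms(1) ide_hom[OF X] assms(2,3)] comp_ide_left[OF assms(3)] by simp
qed

lemma Ev_curry:
  assumes "g \<in> Hom E (Prod E Z X) Y" "z \<in> Hom E W Z" "x \<in> Hom E W X"
  shows "Ev E X Y \<cdot> \<langle>curry Z X Y g \<cdot> z, x\<rangle> = g \<cdot> \<langle>z, x\<rangle>"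
proof -
  have o: "X \<in> Obj E" "Z \<in> Obj E" "Y \<in> Obj E" using assms hom_objs by blast+
  show ?thesis
    using Ev_pmap_pair[OF curry_hom[OF o(1,2) assms(1)] assms(2,3) o(3)] curry_ex1[OF o(2,1) assms(1)] by simp
qed

text \<open>Function extensionality in the internal language. The argument \<open>x\<close> may only
  exist at a later stage \<open>W\<close>, hence the restriction along \<open>u\<close>.\<close>

lemma exp_eqI:
  assumes "f \<in> Hom E Z (Exp E X Y)" "g \<in> Hom E Z (Exp E X Y)" "X \<in> Obj E" "Y \<in> Obj E"
    and "\<And>W u x. u \<in> Hom E W Z \<Longrightarrow> x \<in> Hom E W X \<Longrightarrow> Ev E X Y \<cdot> \<langle>f \<cdot> u, x\<rangle> = Ev E X Y \<cdot> \<langle>g \<cdot> u, x\<rangle>"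
  shows "f = g"
proof -
  have Z: "Z \<in> Obj E" using assms hom_objs by blast
  have h: "Ev E X Y \<cdot> pmap h (Ide E X) \<in> Hom E (Prod E Z X) Y" if "h \<in> Hom E Z (Exp E X Y)" for h
    using comp_hom[OF pmap_hom[OF that ide_hom] ev_hom] assms by blast
  have "Ev E X Y \<cdot> pmap f (Ide E X) = Ev E X Y \<cdot> pmap g (Ide E X)"
    using Z assms by (intro prod_arr_eqI[OF h h]) (simp_all add: Ev_pmap_pair)
  then show ?thesis
    using exp_universal[OF Z assms(3) h[OF assms(1)]] assms(1,2) by auto
qed

lemma bang_hom: "X \<in> Obj E \<Longrightarrow> bang X \<in> Hom E X (One E)"
  unfolding bang_def using theI'[OF one_universal] by simp

lemma bang_comp: "u \<in> Hom E Y X \<Longrightarrow> bang X \<cdot> u = bang Y"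
  using one_universal[of Y] bang_hom[of Y] comp_hom[OF _ bang_hom[of X]] hom_objs[of u Y X] by blast

lemma factor_ex1:
  assumes "f \<in> Hom E X Y" "g \<in> Hom E X Y" "h \<in> Hom E Z X" "f \<cdot> h = g \<cdot> h"
  shows "factor (EqArr E f g) h \<in> Hom E Z (Dom E (EqArr E f g)) \<and> EqArr E f g \<cdot> factor (EqArr E f g) h = h"
  using theI'[OF eq_universal[OF assms]] hom_dom[OF assms(3)] by (simp add: factor_def)

lemma eq_hom:
  assumes "f \<in> Hom E X Y" "g \<in> Hom E X Y"
  shows "EqArr E f g \<in> Hom E (Dom E (EqArr E f g)) X"
  using eq_arr[OF assms] by (simp add: Hom_def)

lemma eq_monic:
  assumes fg: "f \<in> Hom E X Y" "g \<in> Hom E X Y"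
    and u: "u \<in> Hom E Z (Dom E (EqArr E f g))" "v \<in> Hom E Z (Dom E (EqArr E f g))"
    and e: "EqArr E f g \<cdot> u = EqArr E f g \<cdot> v"
  shows "u = v"
proof -
  have "f \<cdot> EqArr E f g \<cdot> u = g \<cdot> EqArr E f g \<cdot> u"
    using comp_assoc[OF u(1) eq_hom[OF fg] fg(1)] comp_assoc[OF u(1) eq_hom[OF fg] fg(2)]
      eq_arr[OF fg] by simp
  then show ?thesis
    using eq_universal[OF fg comp_hom[OF u(1) eq_hom[OF fg]]] u e by auto
qed

end

section \<open>Groups and modules on generalized elements\<close>

context topos
begin

abbreviation el :: "'o \<Rightarrow> ('o, 'a, 'z) abgrp_scheme \<Rightarrow> 'a set" where
  "el X G \<equiv> Hom E X (Car G)"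

lemma
  assumes "ab_group_object G"
  shows group_obj: "Car G \<in> Obj E"
    and group_add: "Add G \<in> Hom E (Prod E (Car G) (Car G)) (Car G)"
    and group_zero: "Zer G \<in> Hom E (One E) (Car G)"
    and group_neg: "Neg G \<in> Hom E (Car G) (Car G)"
  using assms unfolding ab_group_object_def by blast+

lemma gadd_el: "ab_group_object G \<Longrightarrow> f \<in> el X G \<Longrightarrow> g \<in> el X G \<Longrightarrow> gadd G f g \<in> el X G"
  unfolding gadd_def by (rule comp_hom[OF pair_hom group_add])

lemma gzero_el: "ab_group_object G \<Longrightarrow> X \<in> Obj E \<Longrightarrow> gzero G X \<in> el X G"
  unfolding gzero_def by (rule comp_hom[OF bang_hom group_zero])

lemma gneg_el: "ab_group_object G \<Longrightarrow> f \<in> el X G \<Longrightarrow> gneg G f \<in> el X G"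
  unfolding gneg_def by (rule comp_hom[OF _ group_neg])

lemma gadd_comp:
  "ab_group_object G \<Longrightarrow> f \<in> el X G \<Longrightarrow> g \<in> el X G \<Longrightarrow> u \<in> Hom E Y X \<Longrightarrow>
    gadd G f g \<cdot> u = gadd G (f \<cdot> u) (g \<cdot> u)"
  unfolding gadd_def by (rule comp_pair[OF group_add])

lemma gzero_comp: "ab_group_object G \<Longrightarrow> u \<in> Hom E Y X \<Longrightarrow> gzero G X \<cdot> u = gzero G Y"
  using comp_assoc[OF _ bang_hom group_zero, of u Y X G] bang_comp[of u Y X] hom_objs[of u Y X]
  by (simp add: gzero_def)

lemma gneg_comp:
  "ab_group_object G \<Longrightarrow> f \<in> el X G \<Longrightarrow> u \<in> Hom E Y X \<Longrightarrow> gneg G f \<cdot> u = gneg G (f \<cdot> u)"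
  unfolding gneg_def by (rule comp_assoc[OF _ _ group_neg])

lemma
  assumes G: "ab_group_object G" and f: "f \<in> el X G"
  shows gadd_commute: "g \<in> el X G \<Longrightarrow> gadd G f g = gadd G g f"
    and gadd_assoc: "g \<in> el X G \<Longrightarrow> h \<in> el X G \<Longrightarrow> gadd G (gadd G f g) h = gadd G f (gadd G g h)"
    and gadd_zero_left: "gadd G (gzero G X) f = f"
    and gadd_neg_left: "gadd G (gneg G f) f = gzero G X"
  using G f hom_objs[OF f] unfolding ab_group_object_def by blast+

lemma
  assumes G: "ab_group_object G" and f: "f \<in> el X G"
  shows gadd_zero_right: "gadd G f (gzero G X) = f"
    and gadd_neg_right: "gadd G f (gneg G f) = gzero G X"
    and gadd_left_commute: "g \<in> el X G \<Longrightarrow> h \<in> el X G \<Longrightarrow> gadd G f (gadd G g h) = gadd G g (gadd G f h)"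
proof -
  have X: "X \<in> Obj E" using hom_objs[OF f] by simp
  show "gadd G f (gzero G X) = f"
    using gadd_commute[OF G f gzero_el[OF G X]] gadd_zero_left[OF G f] by simp
  show "gadd G f (gneg G f) = gzero G X"
    using gadd_commute[OF G f gneg_el[OF G f]] gadd_neg_left[OF G f] by simp
  assume g: "g \<in> el X G" and h: "h \<in> el X G"
  show "gadd G f (gadd G g h) = gadd G g (gadd G f h)"
    using gadd_assoc[OF G f g h] gadd_assoc[OF G g f h] gadd_commute[OF G f g] by simp
qed

lemma gadd_right_cancel:
  assumes G: "ab_group_object G" and x: "x \<in> el X G" "y \<in> el X G" "z \<in> el X G"
    and e: "gadd G x z = gadd G y z"
  shows "x = y"
proof -
  have "x = gadd G (gadd G x z) (gneg G z)"
    using gadd_assoc[OF G x(1,3) gneg_el[OF G x(3)]] gadd_neg_right[OF G x(3)] gadd_zero_right[OF G x(1)]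
    by simp
  moreover have "y = gadd G (gadd G y z) (gneg G z)"
    using gadd_assoc[OF G x(2,3) gneg_el[OF G x(3)]] gadd_neg_right[OF G x(3)] gadd_zero_right[OF G x(2)]
    by simp
  ultimately show ?thesis using e by simp
qed

lemma gneg_unique:
  assumes G: "ab_group_object G" and x: "x \<in> el X G" and y: "y \<in> el X G" and e: "gadd G y x = gzero G X"
  shows "gneg G x = y"
  using gadd_right_cancel[OF G gneg_el[OF G x] y x] gadd_neg_left[OF G x] e by simp

lemma gneg_add:
  assumes G: "ab_group_object G" and x: "x \<in> el X G" and y: "y \<in> el X G"
  shows "gneg G (gadd G x y) = gadd G (gneg G x) (gneg G y)"
proof (rule gneg_unique[OF G gadd_el[OF G x y] gadd_el[OF G gneg_el[OF G x] gneg_el[OF G y]]])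
  note n = gneg_el[OF G x] gneg_el[OF G y]
  have "gadd G (gadd G (gneg G x) (gneg G y)) (gadd G x y) = gadd G (gneg G x) (gadd G x (gadd G (gneg G y) y))"
    using gadd_assoc[OF G n gadd_el[OF G x y]] gadd_left_commute[OF G n(2) x y] by simp
  also have "\<dots> = gzero G X"
    using gadd_neg_left[OF G y] gadd_neg_left[OF G x] gadd_zero_right[OF G x] by simp
  finally show "gadd G (gadd G (gneg G x) (gneg G y)) (gadd G x y) = gzero G X" .
qed

lemma gneg_zero:
  assumes G: "ab_group_object G" and X: "X \<in> Obj E"
  shows "gneg G (gzero G X) = gzero G X"
  using gneg_unique[OF G gzero_el[OF G X] gzero_el[OF G X] gadd_zero_left[OF G gzero_el[OF G X]]] .

end

section \<open>Modules over \<open>k\<close>, linear and bilinear maps\<close>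

context topos_with_ring
begin

lemma ring_group: "ab_group_object k"
  using comm_ring unfolding comm_ring_object_def by blast

lemma module_group: "module M \<Longrightarrow> ab_group_object M"
  unfolding module_def by blast

lemma module_obj: "module M \<Longrightarrow> Car M \<in> Obj E"
  using group_obj module_group by blast

lemma ring_obj: "Car k \<in> Obj E"
  using group_obj ring_group by blast

lemma module_act: "module M \<Longrightarrow> Act M \<in> Hom E (Prod E (Car k) (Car M)) (Car M)"
  unfolding module_def by blast

lemma module_add: "module M \<Longrightarrow> Add M \<in> Hom E (Prod E (Car M) (Car M)) (Car M)"
  using group_add module_group by blast

lemma gact_el: "module M \<Longrightarrow> c \<in> el X k \<Longrightarrow> f \<in> el X M \<Longrightarrow> gact M c f \<in> el X M"
  unfolding gact_def by (rule comp_hom[OF pair_hom module_act])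

lemma gact_comp:
  "module M \<Longrightarrow> c \<in> el X k \<Longrightarrow> f \<in> el X M \<Longrightarrow> u \<in> Hom E Y X \<Longrightarrow>
    gact M c f \<cdot> u = gact M (c \<cdot> u) (f \<cdot> u)"
  unfolding gact_def by (rule comp_pair[OF module_act])

lemma
  assumes M: "module M" and c: "c \<in> el X k" and f: "f \<in> el X M"
  shows gact_mult: "\<And>d. d \<in> el X k \<Longrightarrow> gact M (gmul k c d) f = gact M c (gact M d f)"
    and gact_unit: "gact M (gunit k X) f = f"
    and gact_add_left: "\<And>d. d \<in> el X k \<Longrightarrow> gact M (gadd k c d) f = gadd M (gact M c f) (gact M d f)"
    and gact_add_right: "\<And>g. g \<in> el X M \<Longrightarrow> gact M c (gadd M f g) = gadd M (gact M c f) (gact M c g)"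
proof -
  note m = M[unfolded module_def, THEN conjunct2, THEN conjunct2, rule_format,
      OF hom_dom_obj[OF f] c _ f]
  show "gact M (gunit k X) f = f" using m[OF c f] by blast
  show "gact M (gmul k c d) f = gact M c (gact M d f)" "gact M (gadd k c d) f = gadd M (gact M c f) (gact M d f)"
    if "d \<in> el X k" for d using m[OF that f] by blast+
  show "gact M c (gadd M f g) = gadd M (gact M c f) (gact M c g)" if "g \<in> el X M" for g
    using m[OF c that] by blast
qed

lemma gact_zero:
  assumes M: "module M" and c: "c \<in> el X k"
  shows "gact M c (gzero M X) = gzero M X"
proof -
  note G = module_group[OF M] and z = gzero_el[OF module_group[OF M] hom_dom_obj[OF c]]
  note cz = gact_el[OF M c z]
  have "gadd M (gact M c (gzero M X)) (gact M c (gzero M X)) = gadd M (gzero M X) (gact M c (gzero M X))"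
    using gact_add_right[OF M c z z] gadd_zero_left[OF G z] gadd_zero_left[OF G cz] by simp
  then show ?thesis using gadd_right_cancel[OF G cz z cz] by simp
qed

lemma gact_neg:
  assumes M: "module M" and c: "c \<in> el X k" and x: "x \<in> el X M"
  shows "gact M c (gneg M x) = gneg M (gact M c x)"
proof -
  note G = module_group[OF M] and n = gneg_el[OF module_group[OF M] x]
  have "gadd M (gact M c (gneg M x)) (gact M c x) = gzero M X"
    using gact_add_right[OF M c n x] gadd_neg_left[OF G x] gact_zero[OF M c] by simp
  then show ?thesis using gneg_unique[OF G gact_el[OF M c x] gact_el[OF M c n]] by simp
qed

lemma ring_mul: "Mul k \<in> Hom E (Prod E (Car k) (Car k)) (Car k)"
  and ring_unit: "Unt k \<in> Hom E (One E) (Car k)"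
  using comm_ring unfolding comm_ring_object_def by blast+

lemma gmul_el: "c \<in> el X k \<Longrightarrow> d \<in> el X k \<Longrightarrow> gmul k c d \<in> el X k"
  unfolding gmul_def by (rule comp_hom[OF pair_hom ring_mul])

lemma gunit_el: "X \<in> Obj E \<Longrightarrow> gunit k X \<in> el X k"
  unfolding gunit_def by (rule comp_hom[OF bang_hom ring_unit])

lemma gunit_comp: "u \<in> Hom E Y X \<Longrightarrow> gunit k X \<cdot> u = gunit k Y"
  using comp_assoc[OF _ bang_hom ring_unit, of u Y X] bang_comp[of u Y X] hom_objs[of u Y X]
  by (simp add: gunit_def)

lemma gmul_commute: "c \<in> el X k \<Longrightarrow> d \<in> el X k \<Longrightarrow> gmul k c d = gmul k d c"
  using comm_ring hom_objs[of c X] unfolding comm_ring_object_def by blast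

lemma module_unit_module: "module unit_module"
proof -
  have ops: "gadd unit_module = gadd k" "gzero unit_module = gzero k" "gneg unit_module = gneg k"
    "gact unit_module = gmul k" "Car unit_module = Car k"
    by (auto simp: gadd_def gzero_def gneg_def gact_def gmul_def unit_module_def fun_eq_iff)
  have fields: "Add unit_module = Add k" "Zer unit_module = Zer k" "Neg unit_module = Neg k" "Act unit_module = Mul k"
    by (auto simp: unit_module_def)
  have G: "ab_group_object unit_module"
    using ring_group unfolding ab_group_object_def ops fields by blast
  have R: "gmul k (gmul k a b) c = gmul k a (gmul k b c)" "gmul k a b = gmul k b a" "gmul k (gunit k X) a = a"
    "gmul k a (gadd k b c) = gadd k (gmul k a b) (gmul k a c)"
    if "a \<in> el X k" "b \<in> el X k" "c \<in> el X k" for X a b c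
    using comm_ring hom_objs[OF that(1)] that unfolding comm_ring_object_def by blast+
  have D: "gmul k (gadd k a b) c = gadd k (gmul k a c) (gmul k b c)"
    if "a \<in> el X k" "b \<in> el X k" "c \<in> el X k" for X a b c
    using R(4)[OF that(3,1,2)] R(2)[OF that(3,1,1)] R(2)[OF that(3,2,2)]
      R(2)[OF that(3) gadd_el[OF ring_group that(1,2)] that(3)] by simp
  show ?thesis
    unfolding module_def ops fields using G ring_mul R(1,3,4) D by simp
qed

lemma gact_unit_module: "gact unit_module = gmul k"
  by (auto simp: gact_def gmul_def unit_module_def fun_eq_iff)

lemma Car_unit_module: "Car unit_module = Car k"
  by (simp add: unit_module_def)

lemma linear_hom: "linear M N f \<Longrightarrow> f \<in> Hom E (Car M) (Car N)"
  unfolding linear_def ab_group_hom_def by blast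

lemma linear_el: "linear M N f \<Longrightarrow> x \<in> el X M \<Longrightarrow> f \<cdot> x \<in> el X N"
  by (rule comp_hom[OF _ linear_hom])

lemma linear_add:
  assumes "module M" "linear M N f" "x \<in> el X M" "y \<in> el X M" "module N"
  shows "f \<cdot> gadd M x y = gadd N (f \<cdot> x) (f \<cdot> y)"
proof -
  note f = linear_hom[OF assms(2)]
  have "f \<cdot> gadd M x y = (f \<cdot> Add M) \<cdot> \<langle>x, y\<rangle>"
    unfolding gadd_def using comp_assoc[OF pair_hom[OF assms(3,4)] module_add[OF assms(1)] f] by simp
  also have "\<dots> = (Add N \<cdot> pmap f f) \<cdot> \<langle>x, y\<rangle>"
    using assms(2) unfolding linear_def ab_group_hom_def by simp
  also have "\<dots> = Add N \<cdot> pmap f f \<cdot> \<langle>x, y\<rangle>"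
    using comp_assoc[OF pair_hom[OF assms(3,4)] pmap_hom[OF f f] module_add[OF assms(5)]] by simp
  finally show ?thesis
    unfolding gadd_def by (simp add: pmap_pair[OF f f assms(3,4)])
qed

lemma linear_act:
  assumes "module M" "linear M N f" "c \<in> el X k" "x \<in> el X M" "module N"
  shows "f \<cdot> gact M c x = gact N c (f \<cdot> x)"
proof -
  note f = linear_hom[OF assms(2)]
  have i: "Ide E (Car k) \<in> Hom E (Car k) (Car k)" using ide_hom ring_obj by blast
  have "f \<cdot> gact M c x = (f \<cdot> Act M) \<cdot> \<langle>c, x\<rangle>"
    unfolding gact_def using comp_assoc[OF pair_hom[OF assms(3,4)] module_act[OF assms(1)] f] by simp
  also have "\<dots> = (Act N \<cdot> pmap (Ide E (Car k)) f) \<cdot> \<langle>c, x\<rangle>"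
    using assms(2) unfolding linear_def by simp
  also have "\<dots> = Act N \<cdot> pmap (Ide E (Car k)) f \<cdot> \<langle>c, x\<rangle>"
    using comp_assoc[OF pair_hom[OF assms(3,4)] pmap_hom[OF i f] module_act[OF assms(5)]] by simp
  finally show ?thesis
    unfolding gact_def by (simp add: pmap_pair[OF i f assms(3,4)] comp_ide_left[OF assms(3)])
qed

text \<open>\<open>linear\<close> consists of two equations between arrows out of products; on
  generalized pairs they become the usual equations.\<close>

lemma linearI:
  assumes M: "module M" and N: "module N" and f: "f \<in> Hom E (Car M) (Car N)"
    and add: "\<And>X x y. x \<in> el X M \<Longrightarrow> y \<in> el X M \<Longrightarrow> f \<cdot> gadd M x y = gadd N (f \<cdot> x) (f \<cdot> y)"
    and act: "\<And>X c x. c \<in> el X k \<Longrightarrow> x \<in> el X M \<Longrightarrow> f \<cdot> gact M c x = gact N c (f \<cdot> x)"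
  shows "linear M N f"
proof -
  have i: "Ide E (Car k) \<in> Hom E (Car k) (Car k)" using ide_hom ring_obj by blast
  note objs = module_obj[OF M] ring_obj
  note homs = comp_hom[OF module_add[OF M] f] comp_hom[OF pmap_hom[OF f f] module_add[OF N]]
    comp_hom[OF module_act[OF M] f] comp_hom[OF pmap_hom[OF i f] module_act[OF N]]
  have "f \<cdot> Add M = Add N \<cdot> pmap f f"
  proof (rule prod_arr_eqI[OF homs(1,2) objs(1,1)])
    fix Z x y assume xy: "x \<in> el Z M" "y \<in> el Z M"
    show "(f \<cdot> Add M) \<cdot> \<langle>x, y\<rangle> = (Add N \<cdot> pmap f f) \<cdot> \<langle>x, y\<rangle>"
      using add[OF xy] comp_assoc[OF pair_hom[OF xy] module_add[OF M] f]
        comp_assoc[OF pair_hom[OF xy] pmap_hom[OF f f] module_add[OF N]] pmap_pair[OF f f xy]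
      by (simp add: gadd_def)
  qed
  moreover have "f \<cdot> Act M = Act N \<cdot> pmap (Ide E (Car k)) f"
  proof (rule prod_arr_eqI[OF homs(3,4) objs(2,1)])
    fix Z c x assume xy: "c \<in> el Z k" "x \<in> el Z M"
    show "(f \<cdot> Act M) \<cdot> \<langle>c, x\<rangle> = (Act N \<cdot> pmap (Ide E (Car k)) f) \<cdot> \<langle>c, x\<rangle>"
      using act[OF xy] comp_assoc[OF pair_hom[OF xy] module_act[OF M] f]
        comp_assoc[OF pair_hom[OF xy] pmap_hom[OF i f] module_act[OF N]] pmap_pair[OF i f xy] comp_ide_left[OF xy(1)]
      by (simp add: gact_def)
  qed
  ultimately show ?thesis unfolding linear_def ab_group_hom_def using f by blast
qed

lemma linear_id: "module M \<Longrightarrow> linear M M (Ide E (Car M))"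
  by (rule linearI) (auto simp: comp_ide_left gadd_el gact_el module_group ide_hom module_obj
      intro!: comp_ide_left gadd_el gact_el)

lemma linear_comp_el:
  "linear M N f \<Longrightarrow> linear N P g \<Longrightarrow> x \<in> el X M \<Longrightarrow> (g \<cdot> f) \<cdot> x = g \<cdot> f \<cdot> x"
  by (rule comp_assoc[OF _ linear_hom linear_hom])

lemma linear_comp:
  assumes "module M" "module N" "module P" "linear M N f" "linear N P g"
  shows "linear M P (g \<cdot> f)"
proof (rule linearI[OF assms(1,3) comp_hom[OF linear_hom linear_hom, OF assms(4,5)]])
  fix X c x y assume x: "x \<in> el X M"
  note M = gadd_el[OF module_group[OF assms(1)], where X = X] gact_el[OF assms(1), where X = X]
  note f = linear_el[OF assms(4), where X = X] linear_add[OF assms(1,4) _ _ assms(2), where X = X]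
    linear_act[OF assms(1,4) _ _ assms(2), where X = X]
  note g = linear_add[OF assms(2,5) _ _ assms(3), where X = X] linear_act[OF assms(2,5) _ _ assms(3), where X = X]
  show "y \<in> el X M \<Longrightarrow> (g \<cdot> f) \<cdot> gadd M x y = gadd P ((g \<cdot> f) \<cdot> x) ((g \<cdot> f) \<cdot> y)"
    using x by (simp add: linear_comp_el[OF assms(4,5), where X = X] M f g)
  show "c \<in> el X k \<Longrightarrow> (g \<cdot> f) \<cdot> gact M c x = gact P c ((g \<cdot> f) \<cdot> x)"
    using x by (simp add: linear_comp_el[OF assms(4,5), where X = X] M f g)
qed

lemma linear_zero:
  assumes "module M" "module N" "linear M N f" "X \<in> Obj E"
  shows "f \<cdot> gzero M X = gzero N X"
proof -
  have z: "gzero M X \<in> el X M" using gzero_el module_group assms by blast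
  have fz: "f \<cdot> gzero M X \<in> el X N" using linear_el[OF assms(3) z] .
  have "gadd N (f \<cdot> gzero M X) (f \<cdot> gzero M X) = gadd N (gzero N X) (f \<cdot> gzero M X)"
    using linear_add[OF assms(1,3) z z assms(2)] gadd_zero_left[OF module_group[OF assms(1)] z]
      gadd_zero_left[OF module_group[OF assms(2)] fz] by simp
  then show ?thesis
    using gadd_right_cancel[OF module_group[OF assms(2)] fz gzero_el[OF module_group[OF assms(2)] assms(4)] fz]
    by simp
qed

lemma linear_neg:
  assumes "module M" "module N" "linear M N f" "x \<in> el X M"
  shows "f \<cdot> gneg M x = gneg N (f \<cdot> x)"
proof -
  note GM = module_group[OF assms(1)] and GN = module_group[OF assms(2)]
  have n: "gneg M x \<in> el X M" using gneg_el[OF GM assms(4)] .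
  note fx = linear_el[OF assms(3,4)]
  have "gadd N (f \<cdot> gneg M x) (f \<cdot> x) = gadd N (gneg N (f \<cdot> x)) (f \<cdot> x)"
    using linear_add[OF assms(1,3) n assms(4) assms(2)] gadd_neg_left[OF GM assms(4)]
      gadd_neg_left[OF GN fx] linear_zero[OF assms(1-3)] hom_objs[OF assms(4)] by simp
  then show ?thesis
    using gadd_right_cancel[OF GN linear_el[OF assms(3) n] gneg_el[OF GN fx] fx] by simp
qed

lemma bilinear_hom: "bilinear M N P b \<Longrightarrow> b \<in> Hom E (Prod E (Car M) (Car N)) (Car P)"
  unfolding bilinear_def by blast

lemma bilinear_el: "bilinear M N P b \<Longrightarrow> m \<in> el X M \<Longrightarrow> n \<in> el X N \<Longrightarrow> b \<cdot> \<langle>m, n\<rangle> \<in> el X P"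
  by (rule comp_hom[OF pair_hom bilinear_hom])

lemma bilinear_comp:
  "bilinear M N P b \<Longrightarrow> m \<in> el X M \<Longrightarrow> n \<in> el X N \<Longrightarrow> u \<in> Hom E Y X \<Longrightarrow>
    (b \<cdot> \<langle>m, n\<rangle>) \<cdot> u = b \<cdot> \<langle>m \<cdot> u, n \<cdot> u\<rangle>"
  by (rule comp_pair[OF bilinear_hom])

lemma
  assumes b: "bilinear M N P b" and m: "m \<in> el X M" and n: "n \<in> el X N"
  shows bilinear_add_left: "\<And>m'. m' \<in> el X M \<Longrightarrow> b \<cdot> \<langle>gadd M m m', n\<rangle> = gadd P (b \<cdot> \<langle>m, n\<rangle>) (b \<cdot> \<langle>m', n\<rangle>)"
    and bilinear_add_right: "\<And>n'. n' \<in> el X N \<Longrightarrow> b \<cdot> \<langle>m, gadd N n n'\<rangle> = gadd P (b \<cdot> \<langle>m, n\<rangle>) (b \<cdot> \<langle>m, n'\<rangle>)"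
    and bilinear_act_left: "\<And>c. c \<in> el X k \<Longrightarrow> b \<cdot> \<langle>gact M c m, n\<rangle> = gact P c (b \<cdot> \<langle>m, n\<rangle>)"
    and bilinear_act_right: "\<And>c. c \<in> el X k \<Longrightarrow> b \<cdot> \<langle>m, gact N c n\<rangle> = gact P c (b \<cdot> \<langle>m, n\<rangle>)"
proof -
  note e = b[unfolded bilinear_def, THEN conjunct2, rule_format, OF hom_dom_obj[OF m]]
  note one = gunit_el[OF hom_dom_obj[OF m]]
  show "b \<cdot> \<langle>gadd M m m', n\<rangle> = gadd P (b \<cdot> \<langle>m, n\<rangle>) (b \<cdot> \<langle>m', n\<rangle>)" if "m' \<in> el X M" for m'
    using e[OF one m that n n] by blast
  show "b \<cdot> \<langle>m, gadd N n n'\<rangle> = gadd P (b \<cdot> \<langle>m, n\<rangle>) (b \<cdot> \<langle>m, n'\<rangle>)" if "n' \<in> el X N" for n'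
    using e[OF one m m n that] by blast
  show "b \<cdot> \<langle>gact M c m, n\<rangle> = gact P c (b \<cdot> \<langle>m, n\<rangle>)" "b \<cdot> \<langle>m, gact N c n\<rangle> = gact P c (b \<cdot> \<langle>m, n\<rangle>)"
    if "c \<in> el X k" for c using e[OF that m m n n] by blast+
qed

text \<open>Here \<open>e\<close> is an evaluation. It carries each operation of \<open>H\<close> to
  the one of \<open>N\<close>, and \<open>separates\<close> makes equality in \<open>H\<close> a
  question of values, so the axioms of \<open>N\<close> transfer. Values at the stage
  \<open>X\<close> alone do not determine an element, therefore \<open>separates\<close> compares
  them after every restriction \<open>u\<close>.\<close>

lemma module_pointwise:
  assumes N: "module N" and H: "Car H \<in> Obj E" and V: "V \<in> Obj E"
    and add_hom: "Add H \<in> Hom E (Prod E (Car H) (Car H)) (Car H)"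
    and zero_hom: "Zer H \<in> Hom E (One E) (Car H)"
    and neg_hom: "Neg H \<in> Hom E (Car H) (Car H)"
    and act_hom: "Act H \<in> Hom E (Prod E (Car k) (Car H)) (Car H)"
    and e_el: "\<And>X f v. f \<in> el X H \<Longrightarrow> v \<in> Hom E X V \<Longrightarrow> e f v \<in> el X N"
    and separates: "\<And>X f g. f \<in> el X H \<Longrightarrow> g \<in> el X H \<Longrightarrow>
      (\<And>Y u v. u \<in> Hom E Y X \<Longrightarrow> v \<in> Hom E Y V \<Longrightarrow> e (f \<cdot> u) v = e (g \<cdot> u) v) \<Longrightarrow> f = g"
    and e_add: "\<And>X f g v. f \<in> el X H \<Longrightarrow> g \<in> el X H \<Longrightarrow> v \<in> Hom E X V \<Longrightarrow>
      e (gadd H f g) v = gadd N (e f v) (e g v)"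
    and e_zero: "\<And>X v. v \<in> Hom E X V \<Longrightarrow> e (gzero H X) v = gzero N X"
    and e_neg: "\<And>X f v. f \<in> el X H \<Longrightarrow> v \<in> Hom E X V \<Longrightarrow> e (gneg H f) v = gneg N (e f v)"
    and e_act: "\<And>X c f v. c \<in> el X k \<Longrightarrow> f \<in> el X H \<Longrightarrow> v \<in> Hom E X V \<Longrightarrow>
      e (gact H c f) v = gact N c (e f v)"
  shows "module H"
proof -
  note GN = module_group[OF N]
  \<comment> \<open>\<open>gadd_el\<close> and its companions presuppose a group object, which is
    what is being proved; their counterparts for \<open>H\<close> follow from the types of the
    structure maps alone.\<close>
  have add_el: "gadd H f g \<in> el X H" if "f \<in> el X H" "g \<in> el X H" for X f g
    unfolding gadd_def using comp_hom[OF pair_hom[OF that] add_hom] .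
  have neg_el: "gneg H f \<in> el X H" if "f \<in> el X H" for X f
    unfolding gneg_def using comp_hom[OF that neg_hom] .
  have zero_el: "gzero H X \<in> el X H" if "X \<in> Obj E" for X
    unfolding gzero_def using comp_hom[OF bang_hom[OF that] zero_hom] .
  have act_el: "gact H c f \<in> el X H" if "c \<in> el X k" "f \<in> el X H" for X c f
    unfolding gact_def using comp_hom[OF pair_hom[OF that] act_hom] .
  have add_comp: "gadd H f g \<cdot> u = gadd H (f \<cdot> u) (g \<cdot> u)"
    if "f \<in> el X H" "g \<in> el X H" "u \<in> Hom E Y X" for X Y f g u
    unfolding gadd_def using comp_pair[OF add_hom that] .
  have neg_comp: "gneg H f \<cdot> u = gneg H (f \<cdot> u)" if "f \<in> el X H" "u \<in> Hom E Y X" for X Y f u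
    unfolding gneg_def using comp_assoc[OF that(2,1) neg_hom] .
  have zero_comp: "gzero H X \<cdot> u = gzero H Y" if "u \<in> Hom E Y X" for X Y u
    unfolding gzero_def using comp_assoc[OF that bang_hom zero_hom] bang_comp[OF that] hom_objs[OF that] by simp
  have act_comp: "gact H c f \<cdot> u = gact H (c \<cdot> u) (f \<cdot> u)"
    if "c \<in> el X k" "f \<in> el X H" "u \<in> Hom E Y X" for X Y c f u
    unfolding gact_def using comp_pair[OF act_hom that] .
  have mul_comp: "gmul k a b \<cdot> u = gmul k (a \<cdot> u) (b \<cdot> u)"
    if "a \<in> el X k" "b \<in> el X k" "u \<in> Hom E Y X" for X Y a b u
    unfolding gmul_def using comp_pair[OF ring_mul that] .
  have eqI: "f = g"
    if fg: "f \<in> el X H" "g \<in> el X H"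
      and "\<And>Y u v. Y \<in> Obj E \<Longrightarrow> u \<in> Hom E Y X \<Longrightarrow> v \<in> Hom E Y V \<Longrightarrow> e (f \<cdot> u) v = e (g \<cdot> u) v" for X f g
    using that hom_objs by (intro separates[OF fg]) blast
  have "ab_group_object H"
    unfolding ab_group_object_def
  proof (intro conjI ballI H add_hom zero_hom neg_hom)
    fix X f g h assume X: "X \<in> Obj E" and f: "f \<in> el X H" and g: "g \<in> el X H" and h: "h \<in> el X H"
    note [simp] = X f g h add_el[of _ X] neg_el[of _ X] zero_el[of X] act_el[of _ X]
    {
      \<comment> \<open>After restriction along \<open>u\<close> and evaluation at \<open>v\<close>,
        each axiom for \<open>H\<close> is an axiom for \<open>N\<close> at the stage
        \<open>Y\<close>.\<close>
      fix Y u v assume Y: "Y \<in> Obj E" and u: "u \<in> Hom E Y X" and v: "v \<in> Hom E Y V"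
      note [simp] = Y v comp_hom[OF u f] comp_hom[OF u g] comp_hom[OF u h] add_el[of _ Y] neg_el[of _ Y] zero_el[of Y] act_el[of _ Y]
        add_comp[OF _ _ u] neg_comp[OF _ u] zero_comp[OF u]
        e_el[of _ Y] e_add[of _ Y] e_neg[of _ Y] e_zero[of _ Y]
      have "e (gadd H (gadd H f g) h \<cdot> u) v = e (gadd H f (gadd H g h) \<cdot> u) v"
        by (simp add: gadd_assoc[OF GN, where X = Y])
      moreover have "e (gadd H f g \<cdot> u) v = e (gadd H g f \<cdot> u) v"
        by (simp add: gadd_commute[OF GN, where X = Y])
      moreover have "e (gadd H (gzero H X) f \<cdot> u) v = e (f \<cdot> u) v"
        by (simp add: gadd_zero_left[OF GN, where X = Y])
      moreover have "e (gadd H (gneg H f) f \<cdot> u) v = e (gzero H X \<cdot> u) v"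
        by (simp add: gadd_neg_left[OF GN, where X = Y])
      moreover note calculation
    }
    note e = this
    show "gadd H (gadd H f g) h = gadd H f (gadd H g h)" by (rule eqI[of _ X]) (simp_all add: e)
    show "gadd H f g = gadd H g f" by (rule eqI[of _ X]) (simp_all add: e)
    show "gadd H (gzero H X) f = f" by (rule eqI[of _ X]) (simp_all add: e)
    show "gadd H (gneg H f) f = gzero H X" by (rule eqI[of _ X]) (simp_all add: e)
  qed
  moreover have "gact H (gmul k c d) f = gact H c (gact H d f) \<and> gact H (gunit k X) f = f \<and>
      gact H (gadd k c d) f = gadd H (gact H c f) (gact H d f) \<and>
      gact H c (gadd H f g) = gadd H (gact H c f) (gact H c g)"
    if X: "X \<in> Obj E" and c: "c \<in> el X k" and d: "d \<in> el X k" and f: "f \<in> el X H" and g: "g \<in> el X H"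
    for X c d f g
  proof -
    note [simp] = X c d f g add_el[of _ X] neg_el[of _ X] zero_el[of X] act_el[of _ X] gmul_el[where X = X] gunit_el gadd_el[OF ring_group, where X = X]
    {
      fix Y u v assume Y: "Y \<in> Obj E" and u: "u \<in> Hom E Y X" and v: "v \<in> Hom E Y V"
      note [simp] = Y v comp_hom[OF u f] comp_hom[OF u g] comp_hom[OF u c] comp_hom[OF u d] add_el[of _ Y] neg_el[of _ Y] zero_el[of Y] act_el[of _ Y]
        add_comp[OF _ _ u] act_comp[OF _ _ u] mul_comp[OF _ _ u] gunit_comp[OF u] gadd_comp[OF ring_group _ _ u]
        e_el[of _ Y] e_add[of _ Y] e_act[of _ Y] gmul_el[where X = Y]
        gadd_el[OF ring_group, where X = Y]
      have "e (gact H (gmul k c d) f \<cdot> u) v = e (gact H c (gact H d f) \<cdot> u) v"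
        by (simp add: gact_mult[OF N, where X = Y])
      moreover have "e (gact H (gunit k X) f \<cdot> u) v = e (f \<cdot> u) v"
        using gact_unit[OF N gunit_el[OF Y] e_el[OF comp_hom[OF u f] v]] by simp
      moreover have "e (gact H (gadd k c d) f \<cdot> u) v = e (gadd H (gact H c f) (gact H d f) \<cdot> u) v"
        by (simp add: gact_add_left[OF N, where X = Y])
      moreover have "e (gact H c (gadd H f g) \<cdot> u) v = e (gadd H (gact H c f) (gact H c g) \<cdot> u) v"
        by (simp add: gact_add_right[OF N, where X = Y])
      moreover note calculation
    }
    note e = this
    show ?thesis
      by (intro conjI; rule eqI[of _ X]) (simp_all add: e)
  qed
  ultimately show ?thesis
    unfolding module_def using act_hom by blast
qed

end

section \<open>Modules of functions and the internal hom\<close>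

context topos
begin

lemma pair_eq_iff:
  assumes "f \<in> Hom E Z X" "g \<in> Hom E Z Y" "f' \<in> Hom E Z X" "g' \<in> Hom E Z Y"
  shows "\<langle>f, g\<rangle> = \<langle>f', g'\<rangle> \<longleftrightarrow> f = f' \<and> g = g'"
  using P1_pair[OF assms(1,2)] P1_pair[OF assms(3,4)] P2_pair[OF assms(1,2)] P2_pair[OF assms(3,4)] by metis

lemma Ev_el:
  "f \<in> Hom E Z (Exp E X Y) \<Longrightarrow> x \<in> Hom E Z X \<Longrightarrow> Y \<in> Obj E \<Longrightarrow> Ev E X Y \<cdot> \<langle>f, x\<rangle> \<in> Hom E Z Y"
  using comp_hom[OF pair_hom ev_hom] hom_objs[of x Z X] by blast

lemma Ev_comp:
  "f \<in> Hom E Z (Exp E X Y) \<Longrightarrow> x \<in> Hom E Z X \<Longrightarrow> u \<in> Hom E W Z \<Longrightarrow> Y \<in> Obj E \<Longrightarrow>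
    (Ev E X Y \<cdot> \<langle>f, x\<rangle>) \<cdot> u = Ev E X Y \<cdot> \<langle>f \<cdot> u, x \<cdot> u\<rangle>"
  using comp_pair[OF ev_hom] hom_objs[of x Z X] by blast

lemma comp_P1_pair: "f \<in> Hom E X W \<Longrightarrow> x \<in> Hom E Z X \<Longrightarrow> y \<in> Hom E Z Y \<Longrightarrow> (f \<cdot> P1 E X Y) \<cdot> \<langle>x, y\<rangle> = f \<cdot> x"
  using comp_assoc[OF pair_hom P1_hom] P1_pair hom_objs[of x Z X] hom_objs[of y Z Y] by metis

lemma comp_P2_pair: "f \<in> Hom E Y W \<Longrightarrow> x \<in> Hom E Z X \<Longrightarrow> y \<in> Hom E Z Y \<Longrightarrow> (f \<cdot> P2 E X Y) \<cdot> \<langle>x, y\<rangle> = f \<cdot> y"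
  using comp_assoc[OF pair_hom P2_hom] P2_pair hom_objs[of x Z X] hom_objs[of y Z Y] by metis

end

section \<open>Pointwise module structures and powers\<close>

context topos_with_ring
begin

text \<open>Abstracts the record built in \<open>ihom\<close>: \<open>e\<close> stands for
  evaluation and \<open>L\<close> for transposition. One proof then serves both the power by an
  object, made of all functions, and the internal hom, made of the linear ones.\<close>

definition pointwise_module ::
  "'o \<Rightarrow> 'o \<Rightarrow> ('o, 'a) modobj \<Rightarrow> ('a \<Rightarrow> 'a \<Rightarrow> 'a) \<Rightarrow> ('o \<Rightarrow> 'a \<Rightarrow> 'a) \<Rightarrow> ('o, 'a) modobj" where
  "pointwise_module H V N e L =
    (let HH = Prod E H H; KH = Prod E (Car k) H in
     \<lparr> Car = H,
       Add = L HH (gadd N (e (P1 E H H \<cdot> P1 E HH V) (P2 E HH V)) (e (P2 E H H \<cdot> P1 E HH V) (P2 E HH V))),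
       Zer = L (One E) (gzero N (Prod E (One E) V)),
       Neg = L H (gneg N (e (P1 E H V) (P2 E H V))),
       Act = L KH (gact N (P1 E (Car k) H \<cdot> P1 E KH V) (e (P2 E (Car k) H \<cdot> P1 E KH V) (P2 E KH V))) \<rparr>)"

context
  fixes H V N e
  assumes N: "module N" and H: "H \<in> Obj E" and V: "V \<in> Obj E"
    and e_el: "\<And>X f v. f \<in> Hom E X H \<Longrightarrow> v \<in> Hom E X V \<Longrightarrow> e f v \<in> el X N"
    and e_comp: "\<And>X Y f v u. f \<in> Hom E X H \<Longrightarrow> v \<in> Hom E X V \<Longrightarrow> u \<in> Hom E Y X \<Longrightarrow>
      e f v \<cdot> u = e (f \<cdot> u) (v \<cdot> u)"
begin

lemma
  defines "HH \<equiv> Prod E H H" and "KH \<equiv> Prod E (Car k) H"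
  defines "a \<equiv> gadd N (e (P1 E H H \<cdot> P1 E HH V) (P2 E HH V)) (e (P2 E H H \<cdot> P1 E HH V) (P2 E HH V))"
    and "z \<equiv> gzero N (Prod E (One E) V)"
    and "n \<equiv> gneg N (e (P1 E H V) (P2 E H V))"
    and "s \<equiv> gact N (P1 E (Car k) H \<cdot> P1 E KH V) (e (P2 E (Car k) H \<cdot> P1 E KH V) (P2 E KH V))"
  shows pointwise_add: "a \<in> el (Prod E HH V) N"
      "\<And>X f g v. f \<in> Hom E X H \<Longrightarrow> g \<in> Hom E X H \<Longrightarrow> v \<in> Hom E X V \<Longrightarrow>
        a \<cdot> \<langle>\<langle>f, g\<rangle>, v\<rangle> = gadd N (e f v) (e g v)"
    and pointwise_zero: "z \<in> el (Prod E (One E) V) N"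
      "\<And>X t v. t \<in> Hom E X (One E) \<Longrightarrow> v \<in> Hom E X V \<Longrightarrow> z \<cdot> \<langle>t, v\<rangle> = gzero N X"
    and pointwise_neg: "n \<in> el (Prod E H V) N"
      "\<And>X f v. f \<in> Hom E X H \<Longrightarrow> v \<in> Hom E X V \<Longrightarrow> n \<cdot> \<langle>f, v\<rangle> = gneg N (e f v)"
    and pointwise_act: "s \<in> el (Prod E KH V) N"
      "\<And>X c f v. c \<in> el X k \<Longrightarrow> f \<in> Hom E X H \<Longrightarrow> v \<in> Hom E X V \<Longrightarrow>
        s \<cdot> \<langle>\<langle>c, f\<rangle>, v\<rangle> = gact N c (e f v)"
proof -
  note GN = module_group[OF N] and K = ring_obj
  have HH: "HH \<in> Obj E" and KH: "KH \<in> Obj E" unfolding HH_def KH_def using prod_obj H K by auto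
  note p = P1_hom[OF H H, folded HH_def] P2_hom[OF H H, folded HH_def]
    P1_hom[OF K H, folded KH_def] P2_hom[OF K H, folded KH_def]
  note q = P1_hom[OF HH V] P2_hom[OF HH V] P1_hom[OF KH V] P2_hom[OF KH V] P1_hom[OF H V] P2_hom[OF H V]
  note pq = comp_hom[OF q(1) p(1)] comp_hom[OF q(1) p(2)] comp_hom[OF q(3) p(3)] comp_hom[OF q(3) p(4)]
  note es = e_el[OF pq(1) q(2)] e_el[OF pq(2) q(2)] e_el[OF pq(4) q(4)] e_el[OF q(5,6)]
  show a: "a \<in> el (Prod E HH V) N" unfolding a_def using gadd_el[OF GN es(1,2)] .
  show z: "z \<in> el (Prod E (One E) V) N" unfolding z_def using gzero_el[OF GN prod_obj[OF one_obj V]] .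
  show n: "n \<in> el (Prod E H V) N" unfolding n_def using gneg_el[OF GN es(4)] .
  show s: "s \<in> el (Prod E KH V) N" unfolding s_def using gact_el[OF N pq(3) es(3)] .
  fix X c f g t v assume v: "v \<in> Hom E X V"
  show "z \<cdot> \<langle>t, v\<rangle> = gzero N X" if "t \<in> Hom E X (One E)"
    unfolding z_def using gzero_comp[OF GN pair_hom[OF that v]] .
  assume f: "f \<in> Hom E X H"
  show "n \<cdot> \<langle>f, v\<rangle> = gneg N (e f v)"
    unfolding n_def using gneg_comp[OF GN es(4) pair_hom[OF f v]] e_comp[OF q(5,6) pair_hom[OF f v]]
      P1_pair[OF f v] P2_pair[OF f v] by simp
  show "a \<cdot> \<langle>\<langle>f, g\<rangle>, v\<rangle> = gadd N (e f v) (e g v)" if g: "g \<in> Hom E X H"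
  proof -
    note fg = pair_hom[OF f g, folded HH_def] and w = pair_hom[OF pair_hom[OF f g, folded HH_def] v]
    show ?thesis unfolding a_def
      using gadd_comp[OF GN es(1,2) w] e_comp[OF pq(1) q(2) w] e_comp[OF pq(2) q(2) w]
        comp_P1_pair[OF p(1) fg v] comp_P1_pair[OF p(2) fg v] P2_pair[OF fg v]
        P1_pair[OF f g] P2_pair[OF f g] by simp
  qed
  show "s \<cdot> \<langle>\<langle>c, f\<rangle>, v\<rangle> = gact N c (e f v)" if c: "c \<in> el X k"
  proof -
    note cf = pair_hom[OF c f, folded KH_def] and w = pair_hom[OF pair_hom[OF c f, folded KH_def] v]
    show ?thesis unfolding s_def
      using gact_comp[OF N pq(3) es(3) w] e_comp[OF pq(4) q(4) w]
        comp_P1_pair[OF p(3) cf v] comp_P1_pair[OF p(4) cf v] P2_pair[OF cf v]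
        P1_pair[OF c f] P2_pair[OF c f] by simp
  qed
qed

text \<open>\<open>ok Z g\<close> is the condition under which \<open>g\<close> may be transposed:
  no condition for powers, linearity in the last variable for the internal hom. The closure
  hypotheses describe \<open>g\<close> only by its values, which is all that is required to verify
  such a linearity.\<close>

lemma pointwise_module:
  fixes L ok
  assumes separates: "\<And>X f g. f \<in> Hom E X H \<Longrightarrow> g \<in> Hom E X H \<Longrightarrow>
      (\<And>Y u v. u \<in> Hom E Y X \<Longrightarrow> v \<in> Hom E Y V \<Longrightarrow> e (f \<cdot> u) v = e (g \<cdot> u) v) \<Longrightarrow> f = g"
    and L_hom: "\<And>Z g. Z \<in> Obj E \<Longrightarrow> g \<in> el (Prod E Z V) N \<Longrightarrow> ok Z g \<Longrightarrow> L Z g \<in> Hom E Z H"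
    and L_eval: "\<And>Z g X z v. g \<in> el (Prod E Z V) N \<Longrightarrow> ok Z g \<Longrightarrow> z \<in> Hom E X Z \<Longrightarrow> v \<in> Hom E X V \<Longrightarrow>
      e (L Z g \<cdot> z) v = g \<cdot> \<langle>z, v\<rangle>"
    and ok_add: "\<And>g. (\<And>X f f' v. f \<in> Hom E X H \<Longrightarrow> f' \<in> Hom E X H \<Longrightarrow> v \<in> Hom E X V \<Longrightarrow>
      g \<cdot> \<langle>\<langle>f, f'\<rangle>, v\<rangle> = gadd N (e f v) (e f' v)) \<Longrightarrow> ok (Prod E H H) g"
    and ok_zero: "\<And>g. (\<And>X t v. t \<in> Hom E X (One E) \<Longrightarrow> v \<in> Hom E X V \<Longrightarrow>
      g \<cdot> \<langle>t, v\<rangle> = gzero N X) \<Longrightarrow> ok (One E) g"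
    and ok_neg: "\<And>g. (\<And>X f v. f \<in> Hom E X H \<Longrightarrow> v \<in> Hom E X V \<Longrightarrow>
      g \<cdot> \<langle>f, v\<rangle> = gneg N (e f v)) \<Longrightarrow> ok H g"
    and ok_act: "\<And>g. (\<And>X c f v. c \<in> el X k \<Longrightarrow> f \<in> Hom E X H \<Longrightarrow> v \<in> Hom E X V \<Longrightarrow>
      g \<cdot> \<langle>\<langle>c, f\<rangle>, v\<rangle> = gact N c (e f v)) \<Longrightarrow> ok (Prod E (Car k) H) g"
  defines "G \<equiv> pointwise_module H V N e L"
  shows "module G"
    and "\<And>X f g v. f \<in> Hom E X H \<Longrightarrow> g \<in> Hom E X H \<Longrightarrow> v \<in> Hom E X V \<Longrightarrow>
      e (gadd G f g) v = gadd N (e f v) (e g v)"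
    and "\<And>X c f v. c \<in> el X k \<Longrightarrow> f \<in> Hom E X H \<Longrightarrow> v \<in> Hom E X V \<Longrightarrow>
      e (gact G c f) v = gact N c (e f v)"
proof -
  have Car: "Car G = H" by (simp add: G_def pointwise_module_def Let_def)
  note add = pointwise_add and zero = pointwise_zero
    and neg = pointwise_neg and act = pointwise_act
  note add_ok = add(1) ok_add[OF add(2)] and zero_ok = zero(1) ok_zero[OF zero(2)]
    and neg_ok = neg(1) ok_neg[OF neg(2)] and act_ok = act(1) ok_act[OF act(2)]
  note K = ring_obj
  note homs = L_hom[OF prod_obj[OF H H] add_ok] L_hom[OF one_obj zero_ok] L_hom[OF H neg_ok]
    L_hom[OF prod_obj[OF K H] act_ok]
  show E_add: "e (gadd G f g) v = gadd N (e f v) (e g v)"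
    if "f \<in> Hom E X H" "g \<in> Hom E X H" "v \<in> Hom E X V" for X f g v
    unfolding gadd_def[of G] using L_eval[OF add_ok pair_hom[OF that(1,2)] that(3)] add(2)[OF that]
    by (simp add: G_def pointwise_module_def Let_def)
  show E_act: "e (gact G c f) v = gact N c (e f v)"
    if "c \<in> el X k" "f \<in> Hom E X H" "v \<in> Hom E X V" for X c f v
    unfolding gact_def[of G] using L_eval[OF act_ok pair_hom[OF that(1,2)] that(3)] act(2)[OF that]
    by (simp add: G_def pointwise_module_def Let_def)
  have E_neg: "e (gneg G f) v = gneg N (e f v)"
    if "f \<in> Hom E X H" "v \<in> Hom E X V" for X f v
    unfolding gneg_def[of G] using L_eval[OF neg_ok that] neg(2)[OF that]
    by (simp add: G_def pointwise_module_def Let_def)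
  have E_zero: "e (gzero G X) v = gzero N X" if "v \<in> Hom E X V" for X v
    unfolding gzero_def[of G] using L_eval[OF zero_ok bang_hom that] zero(2)[OF bang_hom that] hom_objs[OF that]
    by (simp add: G_def pointwise_module_def Let_def)
  show "module G"
  proof (rule module_pointwise[OF N, of G V e])
    show "Car G \<in> Obj E" using H Car by simp
    show "V \<in> Obj E" by fact
    show "Add G \<in> Hom E (Prod E (Car G) (Car G)) (Car G)" "Zer G \<in> Hom E (One E) (Car G)"
      "Neg G \<in> Hom E (Car G) (Car G)" "Act G \<in> Hom E (Prod E (Car k) (Car G)) (Car G)"
      unfolding Car using homs by (simp_all add: G_def pointwise_module_def Let_def)
  qed (use e_el separates E_add E_zero E_neg E_act in \<open>auto simp only: Car\<close>)
qed

end

text \<open>The Kripke-Joyal reading of an equation between transposes. It translates the two arrows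
  whose equalizer is the internal hom into the formula that they encode.\<close>

lemma curry_comp_eq_iff:
  assumes g: "g \<in> Hom E (Prod E Z (Prod E X Y)) U" and g': "g' \<in> Hom E (Prod E Z (Prod E X Y)) U"
    and f: "f \<in> Hom E T Z" and X: "X \<in> Obj E" and Y: "Y \<in> Obj E"
  shows "curry Z (Prod E X Y) U g \<cdot> f = curry Z (Prod E X Y) U g' \<cdot> f \<longleftrightarrow>
    (\<forall>S. \<forall>u \<in> Hom E S T. \<forall>x \<in> Hom E S X. \<forall>y \<in> Hom E S Y. g \<cdot> \<langle>f \<cdot> u, \<langle>x, y\<rangle>\<rangle> = g' \<cdot> \<langle>f \<cdot> u, \<langle>x, y\<rangle>\<rangle>)"
    (is "?l \<longleftrightarrow> ?r")
proof -
  note o = prod_obj[OF X Y]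
  have Z: "Z \<in> Obj E" and U: "U \<in> Obj E" using hom_objs f g by blast+
  note h = curry_hom[OF o Z g] curry_hom[OF o Z g']
  have eval: "Ev E (Prod E X Y) U \<cdot> \<langle>(curry Z (Prod E X Y) U q \<cdot> f) \<cdot> u, w\<rangle> = q \<cdot> \<langle>f \<cdot> u, w\<rangle>"
    if "q \<in> Hom E (Prod E Z (Prod E X Y)) U" "u \<in> Hom E S T" "w \<in> Hom E S (Prod E X Y)" for q S u w
    using Ev_curry[OF that(1) comp_hom[OF that(2) f] that(3)] comp_assoc[OF that(2) f curry_hom[OF o Z that(1)]]
    by simp
  show ?thesis
  proof
    assume ?l
    then show ?r using eval[OF g _ pair_hom] eval[OF g' _ pair_hom] by metis
  next
    assume r: ?r
    show ?l
    proof (rule exp_eqI[OF comp_hom[OF f h(1)] comp_hom[OF f h(2)] o U])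
      fix S u w assume u: "u \<in> Hom E S T" and w: "w \<in> Hom E S (Prod E X Y)"
      show "Ev E (Prod E X Y) U \<cdot> \<langle>(curry Z (Prod E X Y) U g \<cdot> f) \<cdot> u, w\<rangle> =
          Ev E (Prod E X Y) U \<cdot> \<langle>(curry Z (Prod E X Y) U g' \<cdot> f) \<cdot> u, w\<rangle>"
        unfolding eval[OF g u w] eval[OF g' u w]
        by (rule prod_elem_cases[OF w X Y]) (simp add: r[rule_format, OF u])
    qed
  qed
qed

text \<open>The power of \<open>N\<close> by a bare object \<open>Z\<close>, with no linearity in
  \<open>Z\<close>. It absorbs parameters: a \<open>Z\<close>-indexed family of linear maps into
  \<open>N\<close> is one linear map into this module.\<close>

definition exp_module :: "'o \<Rightarrow> ('o, 'a) modobj \<Rightarrow> ('o, 'a) modobj" where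
  "exp_module Z N = pointwise_module (Exp E Z (Car N)) Z N (\<lambda>f v. Ev E Z (Car N) \<cdot> \<langle>f, v\<rangle>)
     (\<lambda>Y. curry Y Z (Car N))"

lemma Car_exp_module: "Car (exp_module Z N) = Exp E Z (Car N)"
  by (simp add: exp_module_def pointwise_module_def Let_def)

lemma
  assumes N: "module N" and Z: "Z \<in> Obj E"
  shows module_exp_module: "module (exp_module Z N)"
    and exp_module_add: "\<And>X f g v. f \<in> Hom E X (Exp E Z (Car N)) \<Longrightarrow> g \<in> Hom E X (Exp E Z (Car N)) \<Longrightarrow> v \<in> Hom E X Z \<Longrightarrow>
      Ev E Z (Car N) \<cdot> \<langle>gadd (exp_module Z N) f g, v\<rangle> =
      gadd N (Ev E Z (Car N) \<cdot> \<langle>f, v\<rangle>) (Ev E Z (Car N) \<cdot> \<langle>g, v\<rangle>)"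
    and exp_module_act: "\<And>X c f v. c \<in> el X k \<Longrightarrow> f \<in> Hom E X (Exp E Z (Car N)) \<Longrightarrow> v \<in> Hom E X Z \<Longrightarrow>
      Ev E Z (Car N) \<cdot> \<langle>gact (exp_module Z N) c f, v\<rangle> = gact N c (Ev E Z (Car N) \<cdot> \<langle>f, v\<rangle>)"
proof -
  note W = module_obj[OF N]
  note * = Ev_el[OF _ _ W] Ev_comp[OF _ _ _ W] exp_eqI[OF _ _ Z W] curry_hom[OF Z] Ev_curry
  \<comment> \<open>Every arrow out of a product has a transpose, so the side condition
    \<open>ok\<close> is taken to be trivial.\<close>
  show "module (exp_module Z N)" unfolding exp_module_def
    by (rule pointwise_module(1)[where ok = "\<lambda>_ _. True", OF N exp_obj[OF Z W] Z]) (rule * TrueI; assumption)+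
  show "Ev E Z (Car N) \<cdot> \<langle>gadd (exp_module Z N) f g, v\<rangle> =
      gadd N (Ev E Z (Car N) \<cdot> \<langle>f, v\<rangle>) (Ev E Z (Car N) \<cdot> \<langle>g, v\<rangle>)"
    if "f \<in> Hom E X (Exp E Z (Car N))" "g \<in> Hom E X (Exp E Z (Car N))" "v \<in> Hom E X Z" for X f g v
    unfolding exp_module_def
    by (rule pointwise_module(2)[where ok = "\<lambda>_ _. True", OF N exp_obj[OF Z W] Z _ _ _ _ _ _ _ _ _ that])
      (rule * TrueI; assumption)+
  show "Ev E Z (Car N) \<cdot> \<langle>gact (exp_module Z N) c f, v\<rangle> = gact N c (Ev E Z (Car N) \<cdot> \<langle>f, v\<rangle>)"
    if "c \<in> el X k" "f \<in> Hom E X (Exp E Z (Car N))" "v \<in> Hom E X Z" for X c f v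
    unfolding exp_module_def
    by (rule pointwise_module(3)[where ok = "\<lambda>_ _. True", OF N exp_obj[OF Z W] Z _ _ _ _ _ _ _ _ _ that])
      (rule * TrueI; assumption)+
qed

text \<open>The condition on \<open>g\<close> under which its transpose lands in the internal hom.
  Since \<open>z\<close> ranges over elements at all stages, no separate restriction map is
  quantified.\<close>

definition linear_snd :: "('o, 'a) modobj \<Rightarrow> ('o, 'a) modobj \<Rightarrow> 'o \<Rightarrow> 'a \<Rightarrow> bool" where
  "linear_snd M N Z g \<longleftrightarrow> (\<forall>X. \<forall>z \<in> Hom E X Z. \<forall>m \<in> el X M.
     (\<forall>m' \<in> el X M. g \<cdot> \<langle>z, gadd M m m'\<rangle> = gadd N (g \<cdot> \<langle>z, m\<rangle>) (g \<cdot> \<langle>z, m'\<rangle>)) \<and>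
     (\<forall>c \<in> el X k. g \<cdot> \<langle>z, gact M c m\<rangle> = gact N c (g \<cdot> \<langle>z, m\<rangle>)))"

section \<open>The internal hom as an equalizer\<close>

context
  fixes M N assumes M: "module M" and N: "module N"
begin

private abbreviation (input) "V \<equiv> Car M"
private abbreviation (input) "W \<equiv> Car N"
private abbreviation (input) "VW \<equiv> Exp E V W"
private abbreviation (input) "VV \<equiv> Prod E V V"
private abbreviation (input) "KV \<equiv> Prod E (Car k) V"
private abbreviation (input) "ev \<equiv> Ev E V W"

private lemma V: "V \<in> Obj E" and W: "W \<in> Obj E" and VW: "VW \<in> Obj E" and VV: "VV \<in> Obj E" and KV: "KV \<in> Obj E"
  using module_obj[OF M] module_obj[OF N] exp_obj prod_obj ring_obj by blast+

lemma
  defines "a \<equiv> ev \<cdot> \<langle>P1 E VW VV, Add M \<cdot> P2 E VW VV\<rangle>"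
    and "s \<equiv> ev \<cdot> \<langle>P1 E VW KV, Act M \<cdot> P2 E VW KV\<rangle>"
    and "a' \<equiv> gadd N (ev \<cdot> \<langle>P1 E VW VV, P1 E V V \<cdot> P2 E VW VV\<rangle>) (ev \<cdot> \<langle>P1 E VW VV, P2 E V V \<cdot> P2 E VW VV\<rangle>)"
    and "s' \<equiv> gact N (P1 E (Car k) V \<cdot> P2 E VW KV) (ev \<cdot> \<langle>P1 E VW KV, P2 E (Car k) V \<cdot> P2 E VW KV\<rangle>)"
  shows ihom_arrs: "a \<in> Hom E (Prod E VW VV) W" "s \<in> Hom E (Prod E VW KV) W"
      "a' \<in> Hom E (Prod E VW VV) W" "s' \<in> Hom E (Prod E VW KV) W"
    and ihom_arrs_eval:
      "\<And>X f m m'. f \<in> Hom E X VW \<Longrightarrow> m \<in> el X M \<Longrightarrow> m' \<in> el X M \<Longrightarrow> a \<cdot> \<langle>f, \<langle>m, m'\<rangle>\<rangle> = ev \<cdot> \<langle>f, gadd M m m'\<rangle>"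
      "\<And>X f m m'. f \<in> Hom E X VW \<Longrightarrow> m \<in> el X M \<Longrightarrow> m' \<in> el X M \<Longrightarrow>
         a' \<cdot> \<langle>f, \<langle>m, m'\<rangle>\<rangle> = gadd N (ev \<cdot> \<langle>f, m\<rangle>) (ev \<cdot> \<langle>f, m'\<rangle>)"
      "\<And>X f c m. f \<in> Hom E X VW \<Longrightarrow> c \<in> el X k \<Longrightarrow> m \<in> el X M \<Longrightarrow> s \<cdot> \<langle>f, \<langle>c, m\<rangle>\<rangle> = ev \<cdot> \<langle>f, gact M c m\<rangle>"
      "\<And>X f c m. f \<in> Hom E X VW \<Longrightarrow> c \<in> el X k \<Longrightarrow> m \<in> el X M \<Longrightarrow>
         s' \<cdot> \<langle>f, \<langle>c, m\<rangle>\<rangle> = gact N c (ev \<cdot> \<langle>f, m\<rangle>)"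
proof -
  note K = ring_obj
  note P = P1_hom[OF VW VV] P1_hom[OF VW KV] P2_hom[OF VW VV] P2_hom[OF VW KV]
  note Q = P1_hom[OF V V] P2_hom[OF V V] P1_hom[OF K V] P2_hom[OF K V]
  note A = module_add[OF M] module_act[OF M]
  note c = comp_hom[OF P(3) A(1)] comp_hom[OF P(4) A(2)] comp_hom[OF P(3) Q(1)] comp_hom[OF P(3) Q(2)]
    comp_hom[OF P(4) Q(3)] comp_hom[OF P(4) Q(4)]
  note es = Ev_el[OF P(1) c(1) W] Ev_el[OF P(2) c(2) W] Ev_el[OF P(1) c(3) W] Ev_el[OF P(1) c(4) W] Ev_el[OF P(2) c(6) W]
  show "a \<in> Hom E (Prod E VW VV) W" "s \<in> Hom E (Prod E VW KV) W"
      "a' \<in> Hom E (Prod E VW VV) W" "s' \<in> Hom E (Prod E VW KV) W"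
    unfolding a_def s_def a'_def s'_def
    using es gadd_el[OF module_group[OF N] es(3,4)] gact_el[OF N c(5) es(5)] by auto
  fix X f b m m' assume f: "f \<in> Hom E X VW" and m: "m \<in> el X M"
  {
    assume m': "m' \<in> el X M"
    note mm = pair_hom[OF m m']
    note w = pair_hom[OF f mm]
    note sel = P1_pair[OF f mm] comp_P2_pair[OF A(1) f mm] comp_P2_pair[OF Q(1) f mm] comp_P2_pair[OF Q(2) f mm]
      P1_pair[OF m m'] P2_pair[OF m m']
    show "a \<cdot> \<langle>f, \<langle>m, m'\<rangle>\<rangle> = ev \<cdot> \<langle>f, gadd M m m'\<rangle>"
      unfolding a_def using Ev_comp[OF P(1) c(1) w W] sel by (simp add: gadd_def)
    show "a' \<cdot> \<langle>f, \<langle>m, m'\<rangle>\<rangle> = gadd N (ev \<cdot> \<langle>f, m\<rangle>) (ev \<cdot> \<langle>f, m'\<rangle>)"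
      unfolding a'_def using gadd_comp[OF module_group[OF N] es(3,4) w] Ev_comp[OF P(1) c(3) w W]
        Ev_comp[OF P(1) c(4) w W] sel by simp
  }
  {
    assume b: "b \<in> el X k"
    note mm = pair_hom[OF b m]
    note w = pair_hom[OF f mm]
    note sel = P1_pair[OF f mm] comp_P2_pair[OF A(2) f mm] comp_P2_pair[OF Q(3) f mm] comp_P2_pair[OF Q(4) f mm]
      P1_pair[OF b m] P2_pair[OF b m]
    show "s \<cdot> \<langle>f, \<langle>b, m\<rangle>\<rangle> = ev \<cdot> \<langle>f, gact M b m\<rangle>"
      unfolding s_def using Ev_comp[OF P(2) c(2) w W] sel by (simp add: gact_def)
    show "s' \<cdot> \<langle>f, \<langle>b, m\<rangle>\<rangle> = gact N b (ev \<cdot> \<langle>f, m\<rangle>)"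
      unfolding s'_def using gact_comp[OF N c(5) es(5) w] Ev_comp[OF P(2) c(6) w W] sel by simp
  }
qed

lemma hom_sides: "hom_lhs M N \<in> Hom E VW (Prod E (Exp E VV W) (Exp E KV W))"
    "hom_rhs M N \<in> Hom E VW (Prod E (Exp E VV W) (Exp E KV W))"
  unfolding hom_lhs_def hom_rhs_def Let_def
  by (intro pair_hom curry_hom VV KV VW ihom_arrs)+

text \<open>Decodes the equalizer defining \<open>ihom\<close>: the equation of pairs splits into
  its components, and each of these is an equation of transposes, handled by
  \<open>curry_comp_eq_iff\<close>.\<close>

lemma hom_sides_eq_iff:
  assumes f: "f \<in> Hom E T VW"
  shows "hom_lhs M N \<cdot> f = hom_rhs M N \<cdot> f \<longleftrightarrow> (\<forall>X. \<forall>u \<in> Hom E X T. \<forall>m \<in> el X M.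
     (\<forall>m' \<in> el X M. ev \<cdot> \<langle>f \<cdot> u, gadd M m m'\<rangle> = gadd N (ev \<cdot> \<langle>f \<cdot> u, m\<rangle>) (ev \<cdot> \<langle>f \<cdot> u, m'\<rangle>)) \<and>
     (\<forall>c \<in> el X k. ev \<cdot> \<langle>f \<cdot> u, gact M c m\<rangle> = gact N c (ev \<cdot> \<langle>f \<cdot> u, m\<rangle>)))" (is "_ \<longleftrightarrow> ?r")
proof -
  note A = ihom_arrs
  note h = curry_hom[OF VV VW A(1)] curry_hom[OF KV VW A(2)] curry_hom[OF VV VW A(3)] curry_hom[OF KV VW A(4)]
  note hf = h[THEN comp_hom[OF f]]
  show ?thesis
    unfolding hom_lhs_def hom_rhs_def Let_def pair_comp[OF h(1,2) f] pair_comp[OF h(3,4) f]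
      pair_eq_iff[OF hf] curry_comp_eq_iff[OF A(1,3) f V V] curry_comp_eq_iff[OF A(2,4) f ring_obj V]
    using ihom_arrs_eval[OF comp_hom[OF _ f]] by auto
qed

lemma Car_ihom: "Car (ihom M N) = Dom E (ihom_incl M N)"
  by (simp add: ihom_def Let_def)

lemma ihom_incl_hom: "ihom_incl M N \<in> Hom E (Car (ihom M N)) VW"
  unfolding Car_ihom ihom_incl_def by (rule eq_hom[OF hom_sides])

lemma ihom_app_el: "f \<in> el X (ihom M N) \<Longrightarrow> m \<in> el X M \<Longrightarrow> ihom_app M N f m \<in> el X N"
  unfolding ihom_app_def by (rule Ev_el[OF comp_hom[OF _ ihom_incl_hom] _ W])

lemma ihom_app_comp:
  "f \<in> el X (ihom M N) \<Longrightarrow> m \<in> el X M \<Longrightarrow> u \<in> Hom E Y X \<Longrightarrow>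
    ihom_app M N f m \<cdot> u = ihom_app M N (f \<cdot> u) (m \<cdot> u)"
  unfolding ihom_app_def
  using Ev_comp[OF comp_hom[OF _ ihom_incl_hom] _ _ W] comp_assoc[OF _ _ ihom_incl_hom] by metis

lemma
  assumes f: "f \<in> el X (ihom M N)" and m: "m \<in> el X M"
  shows ihom_app_add_right: "\<And>m'. m' \<in> el X M \<Longrightarrow>
      ihom_app M N f (gadd M m m') = gadd N (ihom_app M N f m) (ihom_app M N f m')"
    and ihom_app_act_right: "\<And>c. c \<in> el X k \<Longrightarrow> ihom_app M N f (gact M c m) = gact N c (ihom_app M N f m)"
proof -
  have "hom_lhs M N \<cdot> ihom_incl M N = hom_rhs M N \<cdot> ihom_incl M N"
    using eq_arr[OF hom_sides] unfolding ihom_incl_def by blast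
  note * = this[unfolded hom_sides_eq_iff[OF ihom_incl_hom], rule_format, OF f m]
  show "ihom_app M N f (gadd M m m') = gadd N (ihom_app M N f m) (ihom_app M N f m')" if "m' \<in> el X M" for m'
    using * that unfolding ihom_app_def by blast
  show "ihom_app M N f (gact M c m) = gact N c (ihom_app M N f m)" if "c \<in> el X k" for c
    using * that unfolding ihom_app_def by blast
qed

text \<open>\<open>ihom_incl\<close> is an equalizer and hence monic, so extensionality descends
  from the exponential.\<close>

lemma ihom_eqI:
  assumes f: "f \<in> el X (ihom M N)" and g: "g \<in> el X (ihom M N)"
    and eq: "\<And>Y u m. u \<in> Hom E Y X \<Longrightarrow> m \<in> el Y M \<Longrightarrow> ihom_app M N (f \<cdot> u) m = ihom_app M N (g \<cdot> u) m"
  shows "f = g"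
proof -
  note i = ihom_incl_hom
  have "ihom_incl M N \<cdot> f = ihom_incl M N \<cdot> g"
    using eq comp_assoc[OF _ f i] comp_assoc[OF _ g i] unfolding ihom_app_def
    by (intro exp_eqI[OF comp_hom[OF f i] comp_hom[OF g i] V W]) simp
  then show ?thesis
    using eq_monic[OF hom_sides f[unfolded Car_ihom ihom_incl_def] g[unfolded Car_ihom ihom_incl_def]]
    unfolding ihom_incl_def by blast
qed

text \<open>By \<open>hom_sides_eq_iff\<close>, \<open>linear_snd\<close> makes
  \<open>curry Z V W g\<close> equalize the two arrows defining \<open>ihom\<close>, so it factors
  through \<open>ihom_incl\<close>.\<close>

lemma
  assumes Z: "Z \<in> Obj E" and g: "g \<in> Hom E (Prod E Z V) W" and lin: "linear_snd M N Z g"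
  shows ihom_curry_hom: "ihom_curry M N Z g \<in> el Z (ihom M N)"
    and ihom_curry_app: "\<And>X z m. z \<in> Hom E X Z \<Longrightarrow> m \<in> el X M \<Longrightarrow>
      ihom_app M N (ihom_curry M N Z g \<cdot> z) m = g \<cdot> \<langle>z, m\<rangle>"
proof -
  note c = curry_hom[OF V Z g]
  have "hom_lhs M N \<cdot> curry Z V W g = hom_rhs M N \<cdot> curry Z V W g"
    unfolding hom_sides_eq_iff[OF c]
    using lin Ev_curry[OF g] gadd_el[OF module_group[OF M]] gact_el[OF M] unfolding linear_snd_def by simp
  note * = factor_ex1[OF hom_sides c this, folded ihom_incl_def, folded Car_ihom, folded ihom_curry_def]
  show "ihom_curry M N Z g \<in> el Z (ihom M N)" using * by blast
  fix X z m assume z: "z \<in> Hom E X Z" and m: "m \<in> el X M"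
  show "ihom_app M N (ihom_curry M N Z g \<cdot> z) m = g \<cdot> \<langle>z, m\<rangle>"
    unfolding ihom_app_def
    using comp_assoc[OF z *[THEN conjunct1] ihom_incl_hom] * Ev_curry[OF g z m] by simp
qed

lemma ihom_pointwise:
  "ihom M N = pointwise_module (Car (ihom M N)) V N (ihom_app M N) (ihom_curry M N)"
  unfolding Car_ihom unfolding ihom_def pointwise_module_def Let_def by simp

text \<open>Instance of \<open>pointwise_module\<close> with \<open>linear_snd M N\<close> as side
  condition. What has to be checked is that sums, zero, negatives and scalar multiples of linear
  maps are linear again.\<close>

lemma
  shows module_ihom: "module (ihom M N)"
    and ihom_app_add_left: "\<And>X f g m. f \<in> el X (ihom M N) \<Longrightarrow> g \<in> el X (ihom M N) \<Longrightarrow> m \<in> el X M \<Longrightarrow>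
      ihom_app M N (gadd (ihom M N) f g) m = gadd N (ihom_app M N f m) (ihom_app M N g m)"
    and ihom_app_act_left: "\<And>X c f m. c \<in> el X k \<Longrightarrow> f \<in> el X (ihom M N) \<Longrightarrow> m \<in> el X M \<Longrightarrow>
      ihom_app M N (gact (ihom M N) c f) m = gact N c (ihom_app M N f m)"
proof -
  let ?H = "Car (ihom M N)"
  let ?linear = "\<lambda>g X z m. (\<forall>m'\<in>el X M. g \<cdot> \<langle>z, gadd M m m'\<rangle> = gadd N (g \<cdot> \<langle>z, m\<rangle>) (g \<cdot> \<langle>z, m'\<rangle>)) \<and>
      (\<forall>c\<in>el X k. g \<cdot> \<langle>z, gact M c m\<rangle> = gact N c (g \<cdot> \<langle>z, m\<rangle>))"
  note H = hom_dom_obj[OF ihom_incl_hom]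
  note GM = module_group[OF M] and GN = module_group[OF N]
  note right = ihom_app_add_right ihom_app_act_right ihom_app_el
  have add: "linear_snd M N (Prod E ?H ?H) g"
    if g: "\<And>X f f' v. f \<in> Hom E X ?H \<Longrightarrow> f' \<in> Hom E X ?H \<Longrightarrow> v \<in> el X M \<Longrightarrow>
      g \<cdot> \<langle>\<langle>f, f'\<rangle>, v\<rangle> = gadd N (ihom_app M N f v) (ihom_app M N f' v)" for g
    unfolding linear_snd_def
  proof (intro allI ballI)
    fix X z m assume z: "z \<in> Hom E X (Prod E ?H ?H)" and m: "m \<in> el X M"
    obtain f f' where f: "f \<in> Hom E X ?H" "f' \<in> Hom E X ?H" "z = \<langle>f, f'\<rangle>"
      using prod_elem_cases[OF z H H] .
    show "?linear g X z m"
      using f m g[OF f(1,2)] gadd_el[OF GM m] gact_el[OF M _ m] right[where X = X]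
        gadd_el[OF GN, where X = X] gadd_assoc[OF GN, where X = X] gadd_left_commute[OF GN, where X = X]
        gact_add_right[OF N, where X = X] by simp
  qed
  have zero: "linear_snd M N (One E) g"
    if g: "\<And>X t v. t \<in> Hom E X (One E) \<Longrightarrow> v \<in> el X M \<Longrightarrow> g \<cdot> \<langle>t, v\<rangle> = gzero N X" for g
    unfolding linear_snd_def
  proof (intro allI ballI)
    fix X z m assume z: "z \<in> Hom E X (One E)" and m: "m \<in> el X M"
    note zN = gzero_el[OF GN hom_dom_obj[OF z]]
    show "?linear g X z m"
      using m g[OF z] gadd_el[OF GM m] gact_el[OF M _ m] gact_zero[OF N, where X = X] gadd_zero_left[OF GN zN] by simp
  qed
  have neg: "linear_snd M N ?H g"
    if g: "\<And>X f v. f \<in> Hom E X ?H \<Longrightarrow> v \<in> el X M \<Longrightarrow> g \<cdot> \<langle>f, v\<rangle> = gneg N (ihom_app M N f v)" for g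
    unfolding linear_snd_def
  proof (intro allI ballI)
    fix X f m assume f: "f \<in> Hom E X ?H" and m: "m \<in> el X M"
    show "?linear g X f m"
      using f m g[OF f] gadd_el[OF GM m] gact_el[OF M _ m] right[where X = X]
        gneg_add[OF GN, where X = X] gact_neg[OF N, where X = X] by simp
  qed
  have act: "linear_snd M N (Prod E (Car k) ?H) g"
    if g: "\<And>X c f v. c \<in> el X k \<Longrightarrow> f \<in> Hom E X ?H \<Longrightarrow> v \<in> el X M \<Longrightarrow>
      g \<cdot> \<langle>\<langle>c, f\<rangle>, v\<rangle> = gact N c (ihom_app M N f v)" for g
    unfolding linear_snd_def
  proof (intro allI ballI)
    fix X z m assume z: "z \<in> Hom E X (Prod E (Car k) ?H)" and m: "m \<in> el X M"
    obtain c f where f: "c \<in> el X k" "f \<in> Hom E X ?H" "z = \<langle>c, f\<rangle>"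
      using prod_elem_cases[OF z ring_obj H] .
    \<comment> \<open>Commutativity of \<open>k\<close> is what makes a scalar multiple of a linear
      map compatible with scalars.\<close>
    have comm: "gact N c (gact N d x) = gact N d (gact N c x)" if "d \<in> el X k" "x \<in> el X N" for d x
      using gact_mult[OF N f(1) that(2,1)] gact_mult[OF N that f(1)] gmul_commute[OF f(1) that(1)] by simp
    show "?linear g X z m"
      using f m g[OF f(1,2)] gadd_el[OF GM m] gact_el[OF M _ m] right[where X = X] comm
        gact_add_right[OF N, where X = X] by simp
  qed
  note * = ihom_app_el ihom_app_comp ihom_eqI ihom_curry_hom
  have eval: "ihom_app M N (ihom_curry M N Z g \<cdot> z) m = g \<cdot> \<langle>z, m\<rangle>"
    if "g \<in> el (Prod E Z V) N" "linear_snd M N Z g" "z \<in> Hom E X Z" "m \<in> el X M" for Z g X z m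
    using ihom_curry_app[OF _ that] hom_objs[OF that(3)] by blast
  show "module (ihom M N)"
    by (subst ihom_pointwise, rule pointwise_module(1)[where ok = "linear_snd M N", OF N H V])
      (rule * eval add zero neg act; assumption)+
  show "ihom_app M N (gadd (ihom M N) f g) m = gadd N (ihom_app M N f m) (ihom_app M N g m)"
    if "f \<in> el X (ihom M N)" "g \<in> el X (ihom M N)" "m \<in> el X M" for X f g m
    by (subst ihom_pointwise, rule pointwise_module(2)[where ok = "linear_snd M N", OF N H V _ _ _ _ _ _ _ _ _ that])
      (rule * eval add zero neg act; assumption)+
  show "ihom_app M N (gact (ihom M N) c f) m = gact N c (ihom_app M N f m)"
    if "c \<in> el X k" "f \<in> el X (ihom M N)" "m \<in> el X M" for X c f m
    by (subst ihom_pointwise, rule pointwise_module(3)[where ok = "linear_snd M N", OF N H V _ _ _ _ _ _ _ _ _ that])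
      (rule * eval add zero neg act; assumption)+
qed

end
end

section \<open>Linear maps with parameters\<close>

context topos_with_ring
begin

text \<open>By Yoneda the same thing as an arrow from \<open>Z\<close> to \<open>Car P\<close>. The
  form as a function on elements accepts terms directly.\<close>

definition nat_op :: "'o \<Rightarrow> ('o, 'a) modobj \<Rightarrow> ('a \<Rightarrow> 'a) \<Rightarrow> bool" where
  "nat_op Z P K \<longleftrightarrow> (\<forall>Y. \<forall>u \<in> Hom E Y Z. K u \<in> el Y P \<and> (\<forall>W. \<forall>v \<in> Hom E W Y. K u \<cdot> v = K (u \<cdot> v)))"

text \<open>By Yoneda the same thing as an arrow from \<open>Prod E Z (Car S)\<close> to
  \<open>Car P\<close> that is linear in the second variable. All parameters of a term are packed
  into the one variable \<open>u\<close>, so that rules need to treat only one parameter.\<close>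

definition lin_op :: "'o \<Rightarrow> ('o, 'a) modobj \<Rightarrow> ('o, 'a) modobj \<Rightarrow> ('a \<Rightarrow> 'a \<Rightarrow> 'a) \<Rightarrow> bool" where
  "lin_op Z S P F \<longleftrightarrow> (\<forall>Y. \<forall>u \<in> Hom E Y Z. \<forall>s \<in> el Y S. F u s \<in> el Y P \<and>
     (\<forall>W. \<forall>v \<in> Hom E W Y. F u s \<cdot> v = F (u \<cdot> v) (s \<cdot> v)) \<and>
     (\<forall>s' \<in> el Y S. F u (gadd S s s') = gadd P (F u s) (F u s')) \<and>
     (\<forall>c \<in> el Y k. F u (gact S c s) = gact P c (F u s)))"

lemma
  assumes "nat_op Z P K" "u \<in> Hom E Y Z"
  shows nat_op_el: "K u \<in> el Y P"
    and nat_op_comp: "\<And>W v. v \<in> Hom E W Y \<Longrightarrow> K u \<cdot> v = K (u \<cdot> v)"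
  using assms unfolding nat_op_def by blast+

lemma lin_opD:
  assumes "lin_op Z S P F" "u \<in> Hom E Y Z" "s \<in> el Y S"
  shows lin_op_el: "F u s \<in> el Y P"
    and lin_op_comp: "\<And>W v. v \<in> Hom E W Y \<Longrightarrow> F u s \<cdot> v = F (u \<cdot> v) (s \<cdot> v)"
    and lin_op_add: "\<And>s'. s' \<in> el Y S \<Longrightarrow> F u (gadd S s s') = gadd P (F u s) (F u s')"
    and lin_op_act: "\<And>c. c \<in> el Y k \<Longrightarrow> F u (gact S c s) = gact P c (F u s)"
  using assms unfolding lin_op_def by blast+

lemma nat_op_id: "nat_op (Car M) M (\<lambda>u. u)"
  unfolding nat_op_def by simp

lemma nat_op_arr: "f \<in> Hom E Z (Car M) \<Longrightarrow> nat_op Z M (\<lambda>u. f \<cdot> u)"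
  unfolding nat_op_def using comp_hom[of _ _ Z f "Car M"] comp_assoc[of _ _ _ _ Z f "Car M"] by simp

lemma nat_op_P1: "module M \<Longrightarrow> module N \<Longrightarrow> nat_op (Prod E (Car M) (Car N)) M (\<lambda>u. P1 E (Car M) (Car N) \<cdot> u)"
  and nat_op_P2: "module M \<Longrightarrow> module N \<Longrightarrow> nat_op (Prod E (Car M) (Car N)) N (\<lambda>u. P2 E (Car M) (Car N) \<cdot> u)"
  by (rule nat_op_arr[OF P1_hom[OF module_obj module_obj]] nat_op_arr[OF P2_hom[OF module_obj module_obj]]; assumption)+

lemma nat_op_linear:
  assumes "linear M N f" "nat_op Z M K"
  shows "nat_op Z N (\<lambda>u. f \<cdot> K u)"
  unfolding nat_op_def
  using linear_el[OF assms(1) nat_op_el[OF assms(2)]] comp_assoc[OF _ nat_op_el[OF assms(2)] linear_hom[OF assms(1)]]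
    nat_op_comp[OF assms(2)] by simp

lemma nat_op_bilinear:
  assumes "bilinear M N P b" "nat_op Z M K" "nat_op Z N L"
  shows "nat_op Z P (\<lambda>u. b \<cdot> \<langle>K u, L u\<rangle>)"
  unfolding nat_op_def
  using bilinear_el[OF assms(1) nat_op_el[OF assms(2)] nat_op_el[OF assms(3)]]
    bilinear_comp[OF assms(1) nat_op_el[OF assms(2)] nat_op_el[OF assms(3)]]
    nat_op_comp[OF assms(2)] nat_op_comp[OF assms(3)] by simp

lemma nat_op_ihom_app:
  assumes "module M" "module N" "nat_op Z (ihom M N) K" "nat_op Z M L"
  shows "nat_op Z N (\<lambda>u. ihom_app M N (K u) (L u))"
  unfolding nat_op_def
  using ihom_app_el[OF assms(1,2) nat_op_el[OF assms(3)] nat_op_el[OF assms(4)]]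
    ihom_app_comp[OF assms(1,2) nat_op_el[OF assms(3)] nat_op_el[OF assms(4)]]
    nat_op_comp[OF assms(3)] nat_op_comp[OF assms(4)] by simp

lemma lin_op_id: "lin_op Z S S (\<lambda>u s. s)"
  unfolding lin_op_def by simp

lemma lin_op_linear:
  assumes f: "linear M N f" and M: "module M" and N: "module N" and F: "lin_op Z S M F"
  shows "lin_op Z S N (\<lambda>u s. f \<cdot> F u s)"
  unfolding lin_op_def
proof (intro allI ballI conjI)
  fix Y u s assume u: "u \<in> Hom E Y Z" and s: "s \<in> el Y S"
  note el = lin_op_el[OF F u] and * = lin_opD[OF F u s]
  show "f \<cdot> F u s \<in> el Y N" using linear_el[OF f *(1)] .
  show "(f \<cdot> F u s) \<cdot> v = f \<cdot> F (u \<cdot> v) (s \<cdot> v)" if "v \<in> Hom E W Y" for W v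
    using comp_assoc[OF that *(1) linear_hom[OF f]] *(2)[OF that] by simp
  show "f \<cdot> F u (gadd S s s') = gadd N (f \<cdot> F u s) (f \<cdot> F u s')" if "s' \<in> el Y S" for s'
    using *(3)[OF that] linear_add[OF M f *(1) el[OF that] N] by simp
  show "f \<cdot> F u (gact S c s) = gact N c (f \<cdot> F u s)" if "c \<in> el Y k" for c
    using *(4)[OF that] linear_act[OF M f that *(1) N] by simp
qed

lemma lin_op_bilinear_right:
  assumes b: "bilinear M N P b" and K: "nat_op Z M K" and F: "lin_op Z S N F"
  shows "lin_op Z S P (\<lambda>u s. b \<cdot> \<langle>K u, F u s\<rangle>)"
  unfolding lin_op_def
proof (intro allI ballI conjI)
  fix Y u s assume u: "u \<in> Hom E Y Z" and s: "s \<in> el Y S"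
  note el = lin_op_el[OF F u] and * = lin_opD[OF F u s] and Ku = nat_op_el[OF K u]
  show "b \<cdot> \<langle>K u, F u s\<rangle> \<in> el Y P" using bilinear_el[OF b Ku *(1)] .
  show "(b \<cdot> \<langle>K u, F u s\<rangle>) \<cdot> v = b \<cdot> \<langle>K (u \<cdot> v), F (u \<cdot> v) (s \<cdot> v)\<rangle>" if "v \<in> Hom E W Y" for W v
    using bilinear_comp[OF b Ku *(1) that] *(2)[OF that] nat_op_comp[OF K u that] by simp
  show "b \<cdot> \<langle>K u, F u (gadd S s s')\<rangle> = gadd P (b \<cdot> \<langle>K u, F u s\<rangle>) (b \<cdot> \<langle>K u, F u s'\<rangle>)" if "s' \<in> el Y S" for s'
    using *(3)[OF that] bilinear_add_right[OF b Ku *(1) el[OF that]] by simp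
  show "b \<cdot> \<langle>K u, F u (gact S c s)\<rangle> = gact P c (b \<cdot> \<langle>K u, F u s\<rangle>)" if "c \<in> el Y k" for c
    using *(4)[OF that] bilinear_act_right[OF b Ku *(1) that] by simp
qed

lemma lin_op_bilinear_left:
  assumes b: "bilinear M N P b" and K: "nat_op Z N K" and F: "lin_op Z S M F"
  shows "lin_op Z S P (\<lambda>u s. b \<cdot> \<langle>F u s, K u\<rangle>)"
  unfolding lin_op_def
proof (intro allI ballI conjI)
  fix Y u s assume u: "u \<in> Hom E Y Z" and s: "s \<in> el Y S"
  note el = lin_op_el[OF F u] and * = lin_opD[OF F u s] and Ku = nat_op_el[OF K u]
  show "b \<cdot> \<langle>F u s, K u\<rangle> \<in> el Y P" using bilinear_el[OF b *(1) Ku] .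
  show "(b \<cdot> \<langle>F u s, K u\<rangle>) \<cdot> v = b \<cdot> \<langle>F (u \<cdot> v) (s \<cdot> v), K (u \<cdot> v)\<rangle>" if "v \<in> Hom E W Y" for W v
    using bilinear_comp[OF b *(1) Ku that] *(2)[OF that] nat_op_comp[OF K u that] by simp
  show "b \<cdot> \<langle>F u (gadd S s s'), K u\<rangle> = gadd P (b \<cdot> \<langle>F u s, K u\<rangle>) (b \<cdot> \<langle>F u s', K u\<rangle>)" if "s' \<in> el Y S" for s'
    using *(3)[OF that] bilinear_add_left[OF b *(1) Ku el[OF that]] by simp
  show "b \<cdot> \<langle>F u (gact S c s), K u\<rangle> = gact P c (b \<cdot> \<langle>F u s, K u\<rangle>)" if "c \<in> el Y k" for c
    using *(4)[OF that] bilinear_act_left[OF b *(1) Ku that] by simp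
qed

text \<open>Passage from terms back to arrows: a binary operation given on elements, natural and
  linear in each variable with the other as parameter, is represented by a bilinear arrow.\<close>

lemma bilinear_op:
  assumes M: "module M" and N: "module N" and P: "module P"
    and F: "lin_op (Car M) N P B" and G: "lin_op (Car N) M P (\<lambda>y x. B x y)"
  obtains b where "bilinear M N P b" "\<And>X x y. x \<in> el X M \<Longrightarrow> y \<in> el X N \<Longrightarrow> b \<cdot> \<langle>x, y\<rangle> = B x y"
proof -
  let ?P1 = "P1 E (Car M) (Car N)" and ?P2 = "P2 E (Car M) (Car N)"
  note p = P1_hom[OF module_obj[OF M] module_obj[OF N]] P2_hom[OF module_obj[OF M] module_obj[OF N]]
  \<comment> \<open>The value at the generic pair; naturality recovers \<open>B\<close> at all pairs
    from it.\<close>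
  define b where "b = B ?P1 ?P2"
  have b: "b \<in> Hom E (Prod E (Car M) (Car N)) (Car P)" unfolding b_def using lin_op_el[OF F p] .
  have eval: "b \<cdot> \<langle>x, y\<rangle> = B x y" if "x \<in> el X M" "y \<in> el X N" for X x y
    unfolding b_def using lin_op_comp[OF F p pair_hom[OF that]] P1_pair[OF that] P2_pair[OF that] by simp
  have "bilinear M N P b"
    unfolding bilinear_def
  proof (intro conjI b ballI)
    fix X c m m' n n'
    assume c: "c \<in> el X k" and m: "m \<in> el X M" "m' \<in> el X M" and n: "n \<in> el X N" "n' \<in> el X N"
    show "b \<cdot> \<langle>gadd M m m', n\<rangle> = gadd P (b \<cdot> \<langle>m, n\<rangle>) (b \<cdot> \<langle>m', n\<rangle>)"
      using lin_op_add[OF G n(1) m] eval[OF gadd_el[OF module_group[OF M] m] n(1)] eval[OF m(1) n(1)] eval[OF m(2) n(1)]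
      by simp
    show "b \<cdot> \<langle>m, gadd N n n'\<rangle> = gadd P (b \<cdot> \<langle>m, n\<rangle>) (b \<cdot> \<langle>m, n'\<rangle>)"
      using lin_op_add[OF F m(1) n] eval[OF m(1) gadd_el[OF module_group[OF N] n]] eval[OF m(1) n(1)] eval[OF m(1) n(2)]
      by simp
    show "b \<cdot> \<langle>gact M c m, n\<rangle> = gact P c (b \<cdot> \<langle>m, n\<rangle>)"
      using lin_op_act[OF G n(1) m(1) c] eval[OF gact_el[OF M c m(1)] n(1)] eval[OF m(1) n(1)] by simp
    show "b \<cdot> \<langle>m, gact N c n\<rangle> = gact P c (b \<cdot> \<langle>m, n\<rangle>)"
      using lin_op_act[OF F m(1) n(1) c] eval[OF m(1) gact_el[OF N c n(1)]] eval[OF m(1) n(1)] by simp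
  qed
  then show thesis using that eval by blast
qed

text \<open>Represents application by a bilinear arrow, so that the rules for bilinear arrows also
  cover terms containing \<open>ihom_app\<close>.\<close>

lemma bilinear_ihom_app:
  assumes M: "module M" and N: "module N"
  obtains b where "bilinear (ihom M N) M N b"
    "\<And>X f m. f \<in> el X (ihom M N) \<Longrightarrow> m \<in> el X M \<Longrightarrow> b \<cdot> \<langle>f, m\<rangle> = ihom_app M N f m"
proof (rule bilinear_op[OF module_ihom[OF M N] M N, of "ihom_app M N"])
  note e = ihom_app_el[OF M N] ihom_app_comp[OF M N]
  show "lin_op (Car (ihom M N)) M N (ihom_app M N)"
    unfolding lin_op_def using e ihom_app_add_right[OF M N] ihom_app_act_right[OF M N] by simp
  show "lin_op (Car M) (ihom M N) N (\<lambda>m f. ihom_app M N f m)"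
    unfolding lin_op_def using e ihom_app_add_left[OF M N] ihom_app_act_left[OF M N] by simp
qed (rule that; assumption)

lemma lin_op_cong:
  assumes "lin_op Z S P F" "\<And>Y u s. u \<in> Hom E Y Z \<Longrightarrow> s \<in> el Y S \<Longrightarrow> F u s = G u s" "module S"
  shows "lin_op Z S P G"
  unfolding lin_op_def
proof (intro allI ballI conjI)
  fix Y u s assume u: "u \<in> Hom E Y Z" and s: "s \<in> el Y S"
  note * = lin_opD[OF assms(1) u s] and eq = assms(2)[OF u]
  show "G u s \<in> el Y P" using * eq[OF s] by simp
  show "G u s \<cdot> v = G (u \<cdot> v) (s \<cdot> v)" if "v \<in> Hom E W Y" for W v
    using *(2)[OF that] eq[OF s] assms(2)[OF comp_hom[OF that u] comp_hom[OF that s]] by simp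
  show "G u (gadd S s s') = gadd P (G u s) (G u s')" if "s' \<in> el Y S" for s'
    using *(3)[OF that] eq[OF s] eq[OF that] eq[OF gadd_el[OF module_group[OF assms(3)] s that]] by simp
  show "G u (gact S c s) = gact P c (G u s)" if "c \<in> el Y k" for c
    using *(4)[OF that] eq[OF s] eq[OF gact_el[OF assms(3) that s]] by simp
qed

lemma lin_op_ihom_app_right:
  assumes M: "module M" and N: "module N" and S: "module S" and K: "nat_op Z (ihom M N) K" and F: "lin_op Z S M F"
  shows "lin_op Z S N (\<lambda>u s. ihom_app M N (K u) (F u s))"
proof (rule bilinear_ihom_app[OF M N])
  fix b assume b: "bilinear (ihom M N) M N b"
    "\<And>X f m. f \<in> el X (ihom M N) \<Longrightarrow> m \<in> el X M \<Longrightarrow> b \<cdot> \<langle>f, m\<rangle> = ihom_app M N f m"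
  show ?thesis
    by (rule lin_op_cong[OF lin_op_bilinear_right[OF b(1) K F] _ S])
      (rule b(2)[OF nat_op_el[OF K] lin_op_el[OF F]])
qed

lemma lin_op_ihom_app_left:
  assumes M: "module M" and N: "module N" and S: "module S" and K: "nat_op Z M K" and F: "lin_op Z S (ihom M N) F"
  shows "lin_op Z S N (\<lambda>u s. ihom_app M N (F u s) (K u))"
proof (rule bilinear_ihom_app[OF M N])
  fix b assume b: "bilinear (ihom M N) M N b"
    "\<And>X f m. f \<in> el X (ihom M N) \<Longrightarrow> m \<in> el X M \<Longrightarrow> b \<cdot> \<langle>f, m\<rangle> = ihom_app M N f m"
  show ?thesis
    by (rule lin_op_cong[OF lin_op_bilinear_left[OF b(1) K F] _ S])
      (rule b(2)[OF lin_op_el[OF F] nat_op_el[OF K]])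
qed

text \<open>Lambda abstraction: the value of \<open>F\<close> at the generic element of
  \<open>Prod E Z (Car M)\<close> is transposed.\<close>

lemma ihom_lambda:
  assumes M: "module M" and N: "module N" and Z: "Z \<in> Obj E" and F: "lin_op Z M N F"
  obtains h where "h \<in> el Z (ihom M N)"
    "\<And>X u m. u \<in> Hom E X Z \<Longrightarrow> m \<in> el X M \<Longrightarrow> ihom_app M N (h \<cdot> u) m = F u m"
proof -
  note p = P1_hom[OF Z module_obj[OF M]] P2_hom[OF Z module_obj[OF M]]
  let ?g = "F (P1 E Z (Car M)) (P2 E Z (Car M))"
  have g: "?g \<in> Hom E (Prod E Z (Car M)) (Car N)" using lin_op_el[OF F p] .
  have eval: "?g \<cdot> \<langle>u, m\<rangle> = F u m" if "u \<in> Hom E X Z" "m \<in> el X M" for X u m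
    using lin_op_comp[OF F p pair_hom[OF that]] P1_pair[OF that] P2_pair[OF that] by simp
  have "linear_snd M N Z ?g"
    unfolding linear_snd_def
    using eval gadd_el[OF module_group[OF M]] gact_el[OF M] lin_op_add[OF F] lin_op_act[OF F] by simp
  note * = ihom_curry_hom[OF M N Z g this] ihom_curry_app[OF M N Z g this]
  then show thesis using that eval by simp
qed

end

section \<open>Existence and uniqueness of maps out of a tensor product\<close>

context topos_with_tensor
begin

abbreviation te :: "('o, 'a) modobj \<Rightarrow> ('o, 'a) modobj \<Rightarrow> 'a \<Rightarrow> 'a \<Rightarrow> 'a" where
  "te M N m n \<equiv> \<tau> M N \<cdot> \<langle>m, n\<rangle>"

lemma te_el: "module M \<Longrightarrow> module N \<Longrightarrow> m \<in> el X M \<Longrightarrow> n \<in> el X N \<Longrightarrow> te M N m n \<in> el X (M \<otimes> N)"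
  by (rule bilinear_el[OF tensor_bilinear])

lemma te_comp:
  "module M \<Longrightarrow> module N \<Longrightarrow> m \<in> el X M \<Longrightarrow> n \<in> el X N \<Longrightarrow> u \<in> Hom E Y X \<Longrightarrow>
    te M N m n \<cdot> u = te M N (m \<cdot> u) (n \<cdot> u)"
  by (rule bilinear_comp[OF tensor_bilinear])

lemma tau_hom: "module M \<Longrightarrow> module N \<Longrightarrow> \<tau> M N \<in> Hom E (Prod E (Car M) (Car N)) (Car (M \<otimes> N))"
  using bilinear_hom tensor_bilinear by blast

lemma linear_comp_bilinear:
  assumes M: "module M" and N: "module N" and P: "module P" and Q: "module Q"
    and b: "bilinear M N P b" and h: "linear P Q h"
  shows "bilinear M N Q (h \<cdot> b)"
proof (rule bilinear_op[OF M N Q])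
  show "lin_op (Car M) N Q (\<lambda>x y. h \<cdot> b \<cdot> \<langle>x, y\<rangle>)"
    by (rule lin_op_linear[OF h P Q lin_op_bilinear_right[OF b nat_op_id lin_op_id]])
  show "lin_op (Car N) M Q (\<lambda>y x. h \<cdot> b \<cdot> \<langle>x, y\<rangle>)"
    by (rule lin_op_linear[OF h P Q lin_op_bilinear_left[OF b nat_op_id lin_op_id]])
  fix b' assume b': "bilinear M N Q b'"
    and eval: "\<And>X x y. x \<in> el X M \<Longrightarrow> y \<in> el X N \<Longrightarrow> b' \<cdot> \<langle>x, y\<rangle> = h \<cdot> b \<cdot> \<langle>x, y\<rangle>"
  have "b' = h \<cdot> b"
    by (rule prod_arr_eqI[OF bilinear_hom[OF b'] comp_hom[OF bilinear_hom[OF b] linear_hom[OF h]]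
          module_obj[OF M] module_obj[OF N]])
      (simp add: eval comp_assoc[OF pair_hom bilinear_hom[OF b] linear_hom[OF h]])
  then show ?thesis using b' by simp
qed

lemma tensor_lift:
  assumes M: "module M" and N: "module N" and P: "module P"
    and F: "lin_op (Car M) N P B" and G: "lin_op (Car N) M P (\<lambda>y x. B x y)"
  obtains h where "linear (M \<otimes> N) P h" "\<And>X x y. x \<in> el X M \<Longrightarrow> y \<in> el X N \<Longrightarrow> h \<cdot> te M N x y = B x y"
proof (rule bilinear_op[OF M N P F G])
  fix b assume b: "bilinear M N P b" and eval: "\<And>X x y. x \<in> el X M \<Longrightarrow> y \<in> el X N \<Longrightarrow> b \<cdot> \<langle>x, y\<rangle> = B x y"
  obtain h where h: "linear (M \<otimes> N) P h" "h \<cdot> \<tau> M N = b"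
    using tensor_universal[OF M N P b] by blast
  have "h \<cdot> te M N x y = B x y" if "x \<in> el X M" "y \<in> el X N" for X x y
    using comp_assoc[OF pair_hom[OF that] tau_hom[OF M N] linear_hom[OF h(1)]] h(2) eval[OF that] by simp
  then show thesis using that h(1) by blast
qed

text \<open>Uniqueness in the universal property, with
  \<open>f \<cdot> \<tau> M N = g \<cdot> \<tau> M N\<close> read on pairs. It compares arrows, not
  values at elements of a later stage; the version with parameters is derived from it.\<close>

lemma linear_tensor_eqI:
  assumes M: "module M" and N: "module N" and P: "module P"
    and f: "linear (M \<otimes> N) P f" and g: "linear (M \<otimes> N) P g"
    and eq: "\<And>X x y. x \<in> el X M \<Longrightarrow> y \<in> el X N \<Longrightarrow> f \<cdot> te M N x y = g \<cdot> te M N x y"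
  shows "f = g"
proof -
  note t = tau_hom[OF M N] and T = tensor_module[OF M N]
  have "f \<cdot> \<tau> M N = g \<cdot> \<tau> M N"
    by (rule prod_arr_eqI[OF comp_hom[OF t linear_hom[OF f]] comp_hom[OF t linear_hom[OF g]] module_obj[OF M] module_obj[OF N]])
      (simp add: eq comp_assoc[OF pair_hom t linear_hom[OF f]] comp_assoc[OF pair_hom t linear_hom[OF g]])
  then show ?thesis
    using tensor_universal[OF M N P linear_comp_bilinear[OF M N T P tensor_bilinear[OF M N] f]] f g by auto
qed

lemma tlift_eqI:
  assumes M: "module M" and N: "module N" and P: "module P"
    and h: "linear (M \<otimes> N) P h" and b: "b \<in> Hom E (Prod E (Car M) (Car N)) (Car P)"
    and eq: "\<And>X x y. x \<in> el X M \<Longrightarrow> y \<in> el X N \<Longrightarrow> h \<cdot> te M N x y = b \<cdot> \<langle>x, y\<rangle>"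
  shows "tlift M N P b = h"
  unfolding tlift_def
proof (rule the_equality)
  note t = tau_hom[OF M N]
  show h': "linear (M \<otimes> N) P h \<and> h \<cdot> \<tau> M N = b"
    using prod_arr_eqI[OF comp_hom[OF t linear_hom[OF h]] b module_obj[OF M] module_obj[OF N]] h eq
      comp_assoc[OF pair_hom t linear_hom[OF h]] by simp
  show "h' = h" if "linear (M \<otimes> N) P h' \<and> h' \<cdot> \<tau> M N = b" for h'
  proof (rule linear_tensor_eqI[OF M N P _ h])
    show "linear (M \<otimes> N) P h'" using that by blast
    fix X x y assume "x \<in> el X M" "y \<in> el X N"
    then show "h' \<cdot> te M N x y = h \<cdot> te M N x y"
      using that h' comp_assoc[OF pair_hom t linear_hom[OF that[THEN conjunct1]], of x X y]
        comp_assoc[OF pair_hom t linear_hom[OF h], of x X y] by simp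
  qed
qed

text \<open>Maps that are linear in \<open>M \<otimes> N\<close> and depend on a parameter in an arbitrary object \<open>Z\<close> transpose to
  linear maps into the power \<open>P\<^sup>Z\<close>, so the universal property, which has no parameter, applies.\<close>

lemma tensor_op_eqI:
  assumes M: "module M" and N: "module N" and P: "module P"
    and F: "lin_op Z (M \<otimes> N) P F" and G: "lin_op Z (M \<otimes> N) P G"
    and eq: "\<And>X v x y. v \<in> Hom E X Z \<Longrightarrow> x \<in> el X M \<Longrightarrow> y \<in> el X N \<Longrightarrow> F v (te M N x y) = G v (te M N x y)"
    and u: "u \<in> Hom E Y Z" and s: "s \<in> el Y (M \<otimes> N)"
  shows "F u s = G u s"
proof -
  let ?S = "M \<otimes> N" and ?PZ = "exp_module Z P" and ?ev = "Ev E Z (Car P)"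
  note S = tensor_module[OF M N]
  have Z: "Z \<in> Obj E" using hom_objs[OF u] by blast
  note So = module_obj[OF S] and Po = module_obj[OF P]
  note X = module_exp_module[OF P Z]
  \<comment> \<open>\<open>H\<close> expects its parameter first, but the arrow to be transposed has
    \<open>Car ?S\<close> as first factor; hence the order of the projections.\<close>
  define tr where "tr H = curry (Car ?S) Z (Car P) (H (P2 E (Car ?S) Z) (P1 E (Car ?S) Z))" for H :: "'a \<Rightarrow> 'a \<Rightarrow> 'a"
  have tr: "linear ?S ?PZ (tr H)"
    and tr_eval: "\<And>X s v. s \<in> el X ?S \<Longrightarrow> v \<in> Hom E X Z \<Longrightarrow> ?ev \<cdot> \<langle>tr H \<cdot> s, v\<rangle> = H v s"
    if H: "lin_op Z ?S P H" for H
  proof -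
    note p = P2_hom[OF So Z] P1_hom[OF So Z]
    note g = lin_op_el[OF H p]
    have t: "tr H \<in> Hom E (Car ?S) (Exp E Z (Car P))" unfolding tr_def using curry_hom[OF Z So g] .
    show eval: "?ev \<cdot> \<langle>tr H \<cdot> s, v\<rangle> = H v s" if "s \<in> el X ?S" "v \<in> Hom E X Z" for X s v
      unfolding tr_def using Ev_curry[OF g that] lin_op_comp[OF H p pair_hom[OF that]] P1_pair[OF that] P2_pair[OF that]
      by simp
    show "linear ?S ?PZ (tr H)"
    proof (rule linearI[OF S X])
      show "tr H \<in> Hom E (Car ?S) (Car ?PZ)" using t by (simp add: Car_exp_module)
      fix X x y assume x: "x \<in> el X ?S" and y: "y \<in> el X ?S"
      note xy = gadd_el[OF module_group[OF S] x y] and tx = comp_hom[OF x t] comp_hom[OF y t]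
      show "tr H \<cdot> gadd ?S x y = gadd ?PZ (tr H \<cdot> x) (tr H \<cdot> y)"
      proof (rule exp_eqI[OF comp_hom[OF xy t] _ Z Po])
        note tx' = tx[folded Car_exp_module]
        show "gadd ?PZ (tr H \<cdot> x) (tr H \<cdot> y) \<in> Hom E X (Exp E Z (Car P))"
          using gadd_el[OF module_group[OF X] tx'] by (simp add: Car_exp_module)
        fix W u v assume u: "u \<in> Hom E W X" and v: "v \<in> Hom E W Z"
        note xu = comp_hom[OF u x] comp_hom[OF u y]
        show "?ev \<cdot> \<langle>(tr H \<cdot> gadd ?S x y) \<cdot> u, v\<rangle> =
            ?ev \<cdot> \<langle>gadd ?PZ (tr H \<cdot> x) (tr H \<cdot> y) \<cdot> u, v\<rangle>"
          using comp_assoc[OF u xy t] comp_assoc[OF u x t] comp_assoc[OF u y t]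
            gadd_comp[OF module_group[OF S] x y u] gadd_comp[OF module_group[OF X] tx' u]
            exp_module_add[OF P Z comp_hom[OF xu(1) t] comp_hom[OF xu(2) t] v]
            eval[OF xu(1) v] eval[OF xu(2) v] eval[OF gadd_el[OF module_group[OF S] xu] v] lin_op_add[OF H v xu]
          by simp
      qed
    next
      fix X c x assume c: "c \<in> el X k" and x: "x \<in> el X ?S"
      note xy = gact_el[OF S c x] and tx = comp_hom[OF x t]
      show "tr H \<cdot> gact ?S c x = gact ?PZ c (tr H \<cdot> x)"
      proof (rule exp_eqI[OF comp_hom[OF xy t] _ Z Po])
        note tx' = tx[folded Car_exp_module]
        show "gact ?PZ c (tr H \<cdot> x) \<in> Hom E X (Exp E Z (Car P))"
          using gact_el[OF X c tx'] by (simp add: Car_exp_module)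
        fix W u v assume u: "u \<in> Hom E W X" and v: "v \<in> Hom E W Z"
        note xu = comp_hom[OF u c] comp_hom[OF u x]
        show "?ev \<cdot> \<langle>(tr H \<cdot> gact ?S c x) \<cdot> u, v\<rangle> =
            ?ev \<cdot> \<langle>gact ?PZ c (tr H \<cdot> x) \<cdot> u, v\<rangle>"
          using comp_assoc[OF u xy t] comp_assoc[OF u x t]
            gact_comp[OF S c x u] gact_comp[OF X c tx' u]
            exp_module_act[OF P Z xu(1) comp_hom[OF xu(2) t] v]
            eval[OF xu(2) v] eval[OF gact_el[OF S xu] v] lin_op_act[OF H v xu(2,1)]
          by simp
      qed
    qed
  qed
  have "tr F = tr G"
  proof (rule linear_tensor_eqI[OF M N X tr[OF F] tr[OF G]])
    fix X x y assume x: "x \<in> el X M" and y: "y \<in> el X N"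
    note t = linear_hom[OF tr[OF F], unfolded Car_exp_module] linear_hom[OF tr[OF G], unfolded Car_exp_module]
    note e = te_el[OF M N x y]
    show "tr F \<cdot> te M N x y = tr G \<cdot> te M N x y"
    proof (rule exp_eqI[OF comp_hom[OF e t(1)] comp_hom[OF e t(2)] Z Po])
      fix W u v assume u: "u \<in> Hom E W X" and v: "v \<in> Hom E W Z"
      note xu = comp_hom[OF u x] comp_hom[OF u y]
      show "?ev \<cdot> \<langle>(tr F \<cdot> te M N x y) \<cdot> u, v\<rangle> = ?ev \<cdot> \<langle>(tr G \<cdot> te M N x y) \<cdot> u, v\<rangle>"
        using comp_assoc[OF u e t(1)] comp_assoc[OF u e t(2)] te_comp[OF M N x y u]
          tr_eval[OF F te_el[OF M N xu] v] tr_eval[OF G te_el[OF M N xu] v] eq[OF v xu] by simp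
    qed
  qed
  then show ?thesis using tr_eval[OF F s u] tr_eval[OF G s u] by simp
qed

end

section \<open>The monoidal structure on elements\<close>

context topos_with_ring
begin

text \<open>Operations in the internal hom are pointwise, so linearity of an
  \<open>ihom\<close>-valued term may be checked after applying it to a further variable, which
  joins the parameters as a factor \<open>Car M\<close>. Naturality of \<open>F\<close> itself is a
  separate hypothesis, because it is used to restrict \<open>F\<close> before applying it.\<close>

lemma lin_op_ihomI:
  assumes M: "module M" and N: "module N" and S: "module S"
    and el: "\<And>Y u s. u \<in> Hom E Y Z \<Longrightarrow> s \<in> el Y S \<Longrightarrow> F u s \<in> el Y (ihom M N)"
    and nat: "\<And>Y u s W v. u \<in> Hom E Y Z \<Longrightarrow> s \<in> el Y S \<Longrightarrow> v \<in> Hom E W Y \<Longrightarrow> F u s \<cdot> v = F (u \<cdot> v) (s \<cdot> v)"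
    and app: "lin_op (Prod E Z (Car M)) S N (\<lambda>w s. ihom_app M N (F (P1 E Z (Car M) \<cdot> w) s) (P2 E Z (Car M) \<cdot> w))"
  shows "lin_op Z S (ihom M N) F"
  unfolding lin_op_def
proof (intro allI ballI conjI)
  note I = module_ihom[OF M N]
  fix Y u s assume u: "u \<in> Hom E Y Z" and s: "s \<in> el Y S"
  note e = el[OF u s]
  show "F u s \<in> el Y (ihom M N)" by fact
  show "F u s \<cdot> v = F (u \<cdot> v) (s \<cdot> v)" if "v \<in> Hom E W Y" for W v using nat[OF u s that] .
  show "F u (gadd S s s') = gadd (ihom M N) (F u s) (F u s')" if s': "s' \<in> el Y S" for s'
  proof (rule ihom_eqI[OF M N])
    note ss = gadd_el[OF module_group[OF S] s s'] and e' = el[OF u s']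
    show "F u (gadd S s s') \<in> el Y (ihom M N)" using el[OF u ss] .
    show "gadd (ihom M N) (F u s) (F u s') \<in> el Y (ihom M N)" using gadd_el[OF module_group[OF I] e e'] .
    fix W v m assume v: "v \<in> Hom E W Y" and m: "m \<in> el W M"
    note uv = comp_hom[OF v u] comp_hom[OF v s] comp_hom[OF v s']
    show "ihom_app M N (F u (gadd S s s') \<cdot> v) m = ihom_app M N (gadd (ihom M N) (F u s) (F u s') \<cdot> v) m"
      using nat[OF u ss v] nat[OF u s v] nat[OF u s' v] gadd_comp[OF module_group[OF S] s s' v]
        gadd_comp[OF module_group[OF I] e e' v] ihom_app_add_left[OF M N el[OF uv(1,2)] el[OF uv(1,3)] m]
        lin_op_add[OF app pair_hom[OF uv(1) m] uv(2,3)] P1_pair[OF uv(1) m] P2_pair[OF uv(1) m] by simp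
  qed
  show "F u (gact S c s) = gact (ihom M N) c (F u s)" if c: "c \<in> el Y k" for c
  proof (rule ihom_eqI[OF M N])
    note ss = gact_el[OF S c s]
    show "F u (gact S c s) \<in> el Y (ihom M N)" using el[OF u ss] .
    show "gact (ihom M N) c (F u s) \<in> el Y (ihom M N)" using gact_el[OF I c e] .
    fix W v m assume v: "v \<in> Hom E W Y" and m: "m \<in> el W M"
    note uv = comp_hom[OF v u] comp_hom[OF v s] comp_hom[OF v c]
    show "ihom_app M N (F u (gact S c s) \<cdot> v) m = ihom_app M N (gact (ihom M N) c (F u s) \<cdot> v) m"
      using nat[OF u ss v] nat[OF u s v] gact_comp[OF S c s v]
        gact_comp[OF I c e v] ihom_app_act_left[OF M N uv(3) el[OF uv(1,2)] m]
        lin_op_act[OF app pair_hom[OF uv(1) m] uv(2,3)] P1_pair[OF uv(1) m] P2_pair[OF uv(1) m] by simp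
  qed
qed

end

context topos_with_tensor
begin

lemma nat_op_te: "module M \<Longrightarrow> module N \<Longrightarrow> nat_op Z M K \<Longrightarrow> nat_op Z N L \<Longrightarrow> nat_op Z (M \<otimes> N) (\<lambda>u. te M N (K u) (L u))"
  by (rule nat_op_bilinear[OF tensor_bilinear])

lemma lin_op_te_right:
  "module M \<Longrightarrow> module N \<Longrightarrow> nat_op Z M K \<Longrightarrow> lin_op Z S N F \<Longrightarrow> lin_op Z S (M \<otimes> N) (\<lambda>u s. te M N (K u) (F u s))"
  by (rule lin_op_bilinear_right[OF tensor_bilinear])

lemma lin_op_te_left:
  "module M \<Longrightarrow> module N \<Longrightarrow> nat_op Z N K \<Longrightarrow> lin_op Z S M F \<Longrightarrow> lin_op Z S (M \<otimes> N) (\<lambda>u s. te M N (F u s) (K u))"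
  by (rule lin_op_bilinear_left[OF tensor_bilinear])

text \<open>These rules follow the syntax of a term, so repeated application derives its naturality
  and its linearity in one variable. \<open>nat_op_arr\<close> turns a fixed element into a
  parameter.\<close>

lemmas op_rules = nat_op_te lin_op_te_right lin_op_te_left lin_op_id nat_op_id nat_op_P1 nat_op_P2 nat_op_ihom_app
  lin_op_ihom_app_left lin_op_ihom_app_right nat_op_arr nat_op_linear lin_op_linear
  tensor_module module_unit_module module_ihom

text \<open>A map with the values \<open>B\<close> is first constructed; uniqueness then shows that
  it is the one selected by the definite description \<open>tlift\<close>. The braiding, the
  unitors, \<open>tmap\<close> and \<open>hom_ev\<close> all get their values this way.\<close>

lemma tlift_op:
  assumes M: "module M" and N: "module N" and P: "module P"
    and F: "lin_op (Car M) N P B" and G: "lin_op (Car N) M P (\<lambda>y x. B x y)"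
    and b: "b \<in> Hom E (Prod E (Car M) (Car N)) (Car P)"
    and eq: "\<forall>X. \<forall>x \<in> el X M. \<forall>y \<in> el X N. b \<cdot> \<langle>x, y\<rangle> = B x y"
  shows "linear (M \<otimes> N) P (tlift M N P b)"
    and "\<And>X x y. x \<in> el X M \<Longrightarrow> y \<in> el X N \<Longrightarrow> tlift M N P b \<cdot> te M N x y = B x y"
proof -
  obtain h where h: "linear (M \<otimes> N) P h" "\<And>X x y. x \<in> el X M \<Longrightarrow> y \<in> el X N \<Longrightarrow> h \<cdot> te M N x y = B x y"
    by (rule tensor_lift[OF M N P F G]) (rule that; assumption)
  have "tlift M N P b = h" by (rule tlift_eqI[OF M N P h(1) b]) (simp add: h(2) eq)
  then show "linear (M \<otimes> N) P (tlift M N P b)"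
    "\<And>X x y. x \<in> el X M \<Longrightarrow> y \<in> el X N \<Longrightarrow> tlift M N P b \<cdot> te M N x y = B x y"
    using h by simp_all
qed

lemma swap_pair:
  assumes "b \<in> Hom E (Prod E Y X) W" "x \<in> Hom E Z X" "y \<in> Hom E Z Y"
  shows "(b \<cdot> \<langle>P2 E X Y, P1 E X Y\<rangle>) \<cdot> \<langle>x, y\<rangle> = b \<cdot> \<langle>y, x\<rangle>"
  using comp_pair[OF assms(1) P2_hom P1_hom pair_hom[OF assms(2,3)]] P1_pair[OF assms(2,3)] P2_pair[OF assms(2,3)]
    hom_objs[OF assms(2)] hom_objs[OF assms(3)] by simp

lemma swap_hom:
  "b \<in> Hom E (Prod E Y X) W \<Longrightarrow> X \<in> Obj E \<Longrightarrow> Y \<in> Obj E \<Longrightarrow> b \<cdot> \<langle>P2 E X Y, P1 E X Y\<rangle> \<in> Hom E (Prod E X Y) W"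
  using comp_hom[OF pair_hom[OF P2_hom P1_hom]] by blast

section \<open>Braiding, tensor of maps, unitors and associator on pure tensors\<close>

lemma
  assumes M: "module M" and N: "module N"
  shows linear_braid: "linear (M \<otimes> N) (N \<otimes> M) (braid M N)"
    and braid_te: "\<And>X x y. x \<in> el X M \<Longrightarrow> y \<in> el X N \<Longrightarrow> braid M N \<cdot> te M N x y = te N M y x"
proof -
  have F: "lin_op (Car M) N (N \<otimes> M) (\<lambda>x y. te N M y x)" "lin_op (Car N) M (N \<otimes> M) (\<lambda>y x. te N M y x)"
    by (rule op_rules M N)+
  have eq: "\<forall>X. \<forall>x \<in> el X M. \<forall>y \<in> el X N.
      (\<tau> N M \<cdot> \<langle>P2 E (Car M) (Car N), P1 E (Car M) (Car N)\<rangle>) \<cdot> \<langle>x, y\<rangle> = te N M y x"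
    using swap_pair[OF tau_hom[OF N M]] by blast
  note * = tlift_op[where B = "\<lambda>x y. te N M y x", OF M N tensor_module[OF N M] F
      swap_hom[OF tau_hom[OF N M] module_obj[OF M] module_obj[OF N]] eq, folded braid_def]
  show "linear (M \<otimes> N) (N \<otimes> M) (braid M N)"
    "\<And>X x y. x \<in> el X M \<Longrightarrow> y \<in> el X N \<Longrightarrow> braid M N \<cdot> te M N x y = te N M y x"
    using * by blast+
qed

lemma
  assumes M: "module M" "module M'" and N: "module N" "module N'" and f: "linear M M' f" and g: "linear N N' g"
  shows linear_tmap: "linear (M \<otimes> N) (M' \<otimes> N') (tmap M M' N N' f g)"
    and tmap_te: "\<And>X x y. x \<in> el X M \<Longrightarrow> y \<in> el X N \<Longrightarrow> tmap M M' N N' f g \<cdot> te M N x y = te M' N' (f \<cdot> x) (g \<cdot> y)"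
proof -
  let ?B = "\<lambda>x y. te M' N' (f \<cdot> x) (g \<cdot> y)"
  have F: "lin_op (Car M) N (M' \<otimes> N') ?B" "lin_op (Car N) M (M' \<otimes> N') (\<lambda>y x. ?B x y)"
    by (rule op_rules M N f g linear_hom[OF f] linear_hom[OF g])+
  note p = pmap_hom[OF linear_hom[OF f] linear_hom[OF g]]
  have eq: "\<forall>X. \<forall>x \<in> el X M. \<forall>y \<in> el X N. (\<tau> M' N' \<cdot> pmap f g) \<cdot> \<langle>x, y\<rangle> = ?B x y"
    using comp_assoc[OF pair_hom p tau_hom[OF M(2) N(2)]] pmap_pair[OF linear_hom[OF f] linear_hom[OF g]]
    by simp
  note * = tlift_op[where B = ?B, OF M(1) N(1) tensor_module[OF M(2) N(2)] F
      comp_hom[OF p tau_hom[OF M(2) N(2)]] eq, folded tmap_def]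
  show "linear (M \<otimes> N) (M' \<otimes> N') (tmap M M' N N' f g)"
    "\<And>X x y. x \<in> el X M \<Longrightarrow> y \<in> el X N \<Longrightarrow> tmap M M' N N' f g \<cdot> te M N x y = ?B x y"
    using * by blast+
qed

lemma linear_idm: "module M \<Longrightarrow> linear M M (idm M)"
  unfolding idm_def by (rule linear_id)

lemma idm_el: "x \<in> el X M \<Longrightarrow> idm M \<cdot> x = x"
  unfolding idm_def by (rule comp_ide_left)

text \<open>A scalar leaves the first argument by associativity of the action, and the second one
  after commuting it with the scalar already there.\<close>

lemma bilinear_Act:
  assumes M: "module M"
  shows "bilinear unit_module M M (Act M)"
proof -
  have G: "gadd unit_module = gadd k" by (auto simp: gadd_def unit_module_def fun_eq_iff)
  have comm: "gact M c (gact M d f) = gact M d (gact M c f)"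
    if "c \<in> el X k" "d \<in> el X k" "f \<in> el X M" for X c d f
    using gact_mult[OF M that(1,3,2)] gact_mult[OF M that(2,3,1)] gmul_commute[OF that(1,2)] by simp
  show ?thesis
    unfolding bilinear_def Car_unit_module G gact_unit_module
    using module_act[OF M] gact_add_left[OF M] gact_add_right[OF M] gact_mult[OF M] comm
    by (simp add: gact_def)
qed

lemma
  assumes M: "module M"
  shows linear_lunit: "linear (unit_module \<otimes> M) M (lunit M)"
    and lunit_te: "\<And>X c x. c \<in> el X k \<Longrightarrow> x \<in> el X M \<Longrightarrow> lunit M \<cdot> te unit_module M c x = gact M c x"
    and linear_runit: "linear (M \<otimes> unit_module) M (runit M)"
    and runit_te: "\<And>X c x. c \<in> el X k \<Longrightarrow> x \<in> el X M \<Longrightarrow> runit M \<cdot> te M unit_module x c = gact M c x"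
proof -
  note b = bilinear_Act[OF M] and U = module_unit_module
  have F: "lin_op (Car unit_module) M M (\<lambda>c x. Act M \<cdot> \<langle>c, x\<rangle>)" "lin_op (Car M) unit_module M (\<lambda>x c. Act M \<cdot> \<langle>c, x\<rangle>)"
    by (rule lin_op_bilinear_right[OF b nat_op_id lin_op_id] lin_op_bilinear_left[OF b nat_op_id lin_op_id])+
  have leq: "\<forall>X. \<forall>c \<in> el X unit_module. \<forall>x \<in> el X M. Act M \<cdot> \<langle>c, x\<rangle> = Act M \<cdot> \<langle>c, x\<rangle>" by blast
  note l = tlift_op[where B = "\<lambda>c x. Act M \<cdot> \<langle>c, x\<rangle>", OF U M M F bilinear_hom[OF b] leq,
      folded lunit_def, unfolded Car_unit_module, folded gact_def]
  have req: "\<forall>X. \<forall>x \<in> el X M. \<forall>c \<in> el X unit_module.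
      (Act M \<cdot> \<langle>P2 E (Car M) (Car unit_module), P1 E (Car M) (Car unit_module)\<rangle>) \<cdot> \<langle>x, c\<rangle> = Act M \<cdot> \<langle>c, x\<rangle>"
    using swap_pair[OF bilinear_hom[OF b]] by blast
  note r = tlift_op[where B = "\<lambda>x c. Act M \<cdot> \<langle>c, x\<rangle>", OF M U M F(2,1)
      swap_hom[OF bilinear_hom[OF b] module_obj[OF M] module_obj[OF U]] req,
      unfolded Car_unit_module, folded runit_def, folded gact_def]
  show "linear (unit_module \<otimes> M) M (lunit M)" "linear (M \<otimes> unit_module) M (runit M)" using l(1) r(1) by blast+
  fix X c x assume "c \<in> el X k" "x \<in> el X M"
  then show "lunit M \<cdot> te unit_module M c x = gact M c x" "runit M \<cdot> te M unit_module x c = gact M c x"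
    using l(2) r(2) by blast+
qed

lemma
  assumes M: "module M"
  shows linear_inv_lunit: "linear M (unit_module \<otimes> M) (inv_arr E (lunit M))"
    and inv_lunit_el: "\<And>X x. x \<in> el X M \<Longrightarrow> inv_arr E (lunit M) \<cdot> x = te unit_module M (gunit k X) x"
proof -
  note U = module_unit_module and UM = tensor_module[OF module_unit_module M]
  \<comment> \<open>The candidate inverse \<open>x \<mapsto> 1 \<otimes> x\<close>, written at the
    generic element of \<open>M\<close>.\<close>
  let ?g = "te unit_module M (gunit k (Car M)) (Ide E (Car M))"
  have one: "gunit k X \<in> el X unit_module" if "X \<in> Obj E" for X
    using gunit_el[OF that] by (simp add: Car_unit_module)
  have i: "Ide E (Car M) \<in> el (Car M) M" using ide_hom module_obj[OF M] by blast
  have g: "?g \<cdot> x = te unit_module M (gunit k X) x" if "x \<in> el X M" for X x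
    using te_comp[OF U M one[OF module_obj[OF M]] i that] gunit_comp[OF that] comp_ide_left[OF that] by simp
  have gl: "linear M (unit_module \<otimes> M) ?g"
  proof (rule linearI[OF M UM])
    show "?g \<in> el (Car M) (unit_module \<otimes> M)" using te_el[OF U M one[OF module_obj[OF M]] i] .
    fix X x assume x: "x \<in> el X M"
    note o = one[OF hom_dom_obj[OF x]]
    show "?g \<cdot> gadd M x y = gadd (unit_module \<otimes> M) (?g \<cdot> x) (?g \<cdot> y)" if "y \<in> el X M" for y
      using g[OF x] g[OF that] g[OF gadd_el[OF module_group[OF M] x that]]
        bilinear_add_right[OF tensor_bilinear[OF U M] o x that] by simp
    show "?g \<cdot> gact M c x = gact (unit_module \<otimes> M) c (?g \<cdot> x)" if "c \<in> el X k" for c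
      using g[OF x] g[OF gact_el[OF M that x]] bilinear_act_right[OF tensor_bilinear[OF U M] o x that] by simp
  qed
  note l = linear_lunit[OF M] lunit_te[OF M]
  have "lunit M \<cdot> ?g = Ide E (Car M)"
    using l(2)[OF gunit_el[OF module_obj[OF M]] i] gact_unit[OF M gunit_el[OF module_obj[OF M]] i] by simp
  moreover have "?g \<cdot> lunit M = Ide E (Car (unit_module \<otimes> M))"
  proof (rule linear_tensor_eqI[OF U M UM linear_comp[OF UM M UM l(1) gl] linear_id[OF UM]])
    fix X c x assume c: "c \<in> el X unit_module" and x: "x \<in> el X M"
    note X = hom_dom_obj[OF x]
    have ck: "c \<in> el X k" using c by (simp add: Car_unit_module)
    have "(?g \<cdot> lunit M) \<cdot> te unit_module M c x = te unit_module M (gunit k X) (gact M c x)"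
      using linear_comp_el[OF l(1) gl te_el[OF U M c x]] l(2)[OF ck x] g[OF gact_el[OF M ck x]] by simp
    \<comment> \<open>The scalar crosses the tensor sign: both \<open>1 \<otimes> c x\<close> and
      \<open>c 1 \<otimes> x\<close> equal \<open>c (1 \<otimes> x)\<close>.\<close>
    also have "\<dots> = te unit_module M (gact unit_module c (gunit k X)) x"
      using bilinear_act_right[OF tensor_bilinear[OF U M] one[OF X] x ck]
        bilinear_act_left[OF tensor_bilinear[OF U M] one[OF X] x ck] by simp
    also have "gact unit_module c (gunit k X) = c"
      using gmul_commute[OF ck gunit_el[OF X]] gact_unit[OF U gunit_el[OF X] c] by (simp add: gact_unit_module)
    finally show "(?g \<cdot> lunit M) \<cdot> te unit_module M c x = Ide E (Car (unit_module \<otimes> M)) \<cdot> te unit_module M c x"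
      using comp_ide_left[OF te_el[OF U M c x]] by simp
  qed
  ultimately have "inv_arr E (lunit M) = ?g"
    using inv_arr_eq[OF linear_hom[OF l(1)] linear_hom[OF gl]] by blast
  then show "linear M (unit_module \<otimes> M) (inv_arr E (lunit M))"
    "\<And>X x. x \<in> el X M \<Longrightarrow> inv_arr E (lunit M) \<cdot> x = te unit_module M (gunit k X) x"
    using gl g by simp_all
qed

text \<open>The universal property treats two factors only. Transposing the third one gives a
  bilinear map from \<open>M\<close> and \<open>N\<close> to \<open>[P, Q]\<close>; it lifts to
  \<open>M \<otimes> N\<close> and is then applied to the third factor again. In each hypothesis the
  two variables held fixed form one parameter in a product.\<close>

lemma tensor_lift3:
  assumes M: "module M" and N: "module N" and P: "module P" and Q: "module Q"
    and F1: "lin_op (Prod E (Car M) (Car N)) P Q (\<lambda>w p. B (P1 E (Car M) (Car N) \<cdot> w) (P2 E (Car M) (Car N) \<cdot> w) p)"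
    and F2: "lin_op (Prod E (Car M) (Car P)) N Q (\<lambda>w n. B (P1 E (Car M) (Car P) \<cdot> w) n (P2 E (Car M) (Car P) \<cdot> w))"
    and F3: "lin_op (Prod E (Car N) (Car P)) M Q (\<lambda>w m. B m (P1 E (Car N) (Car P) \<cdot> w) (P2 E (Car N) (Car P) \<cdot> w))"
  obtains h where "linear ((M \<otimes> N) \<otimes> P) Q h"
    "\<And>X m n p. m \<in> el X M \<Longrightarrow> n \<in> el X N \<Longrightarrow> p \<in> el X P \<Longrightarrow> h \<cdot> te (M \<otimes> N) P (te M N m n) p = B m n p"
proof -
  note I = module_ihom[OF P Q] and MN = tensor_module[OF M N]
  note Mo = module_obj[OF M] and No = module_obj[OF N] and Po = module_obj[OF P]
  obtain c where c: "c \<in> el (Prod E (Car M) (Car N)) (ihom P Q)"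
    and "\<And>X u m. u \<in> Hom E X (Prod E (Car M) (Car N)) \<Longrightarrow> m \<in> el X P \<Longrightarrow>
      ihom_app P Q (c \<cdot> u) m = B (P1 E (Car M) (Car N) \<cdot> u) (P2 E (Car M) (Car N) \<cdot> u) m"
    using ihom_lambda[OF P Q prod_obj[OF Mo No] F1] by blast
  then have capp: "ihom_app P Q (c \<cdot> \<langle>m, n\<rangle>) p = B m n p"
    if "m \<in> el X M" "n \<in> el X N" "p \<in> el X P" for X m n p
    using pair_hom[OF that(1,2)] that(3) P1_pair[OF that(1,2)] P2_pair[OF that(1,2)] by simp
  have el: "c \<cdot> \<langle>m, n\<rangle> \<in> el X (ihom P Q)" "v \<in> Hom E W X \<Longrightarrow> (c \<cdot> \<langle>m, n\<rangle>) \<cdot> v = c \<cdot> \<langle>m \<cdot> v, n \<cdot> v\<rangle>"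
    if "m \<in> el X M" "n \<in> el X N" for X m n v W
    using comp_hom[OF pair_hom[OF that] c] comp_pair[OF c that] by blast+
  \<comment> \<open>Tested by application to an element of \<open>P\<close>, where the claim becomes
    \<open>F2\<close>.\<close>
  have "lin_op (Car M) N (ihom P Q) (\<lambda>m n. c \<cdot> \<langle>m, n\<rangle>)"
    by (rule lin_op_ihomI[OF P Q N], (rule el; assumption)+, rule lin_op_cong[OF F2 _ N])
      (rule capp[symmetric]; (assumption | rule comp_hom P1_hom P2_hom Mo Po)+)
  moreover have "lin_op (Car N) M (ihom P Q) (\<lambda>n m. c \<cdot> \<langle>m, n\<rangle>)"
    by (rule lin_op_ihomI[OF P Q M], (rule el; assumption)+, rule lin_op_cong[OF F3 _ M])
      (rule capp[symmetric]; (assumption | rule comp_hom P1_hom P2_hom No Po)+)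
  ultimately obtain d where d: "linear (M \<otimes> N) (ihom P Q) d"
    and dapp: "\<And>X m n. m \<in> el X M \<Longrightarrow> n \<in> el X N \<Longrightarrow> d \<cdot> te M N m n = c \<cdot> \<langle>m, n\<rangle>"
    using tensor_lift[OF M N I] by blast
  have "lin_op (Car (M \<otimes> N)) P Q (\<lambda>t p. ihom_app P Q (d \<cdot> t) p)"
    "lin_op (Car P) (M \<otimes> N) Q (\<lambda>p t. ihom_app P Q (d \<cdot> t) p)"
    by (rule op_rules M N P Q linear_hom[OF d] d)+
  then obtain h where h: "linear ((M \<otimes> N) \<otimes> P) Q h"
    and "\<And>X t p. t \<in> el X (M \<otimes> N) \<Longrightarrow> p \<in> el X P \<Longrightarrow> h \<cdot> te (M \<otimes> N) P t p = ihom_app P Q (d \<cdot> t) p"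
    using tensor_lift[OF MN P Q] by blast
  then have "h \<cdot> te (M \<otimes> N) P (te M N m n) p = B m n p" if "m \<in> el X M" "n \<in> el X N" "p \<in> el X P" for X m n p
    using te_el[OF M N that(1,2)] dapp[OF that(1,2)] capp[OF that] that(3) by simp
  then show thesis using that h by blast
qed

lemma linear_tensor_eqI3:
  assumes M: "module M" and N: "module N" and P: "module P" and Q: "module Q"
    and f: "linear ((M \<otimes> N) \<otimes> P) Q f" and g: "linear ((M \<otimes> N) \<otimes> P) Q g"
    and eq: "\<And>X m n p. m \<in> el X M \<Longrightarrow> n \<in> el X N \<Longrightarrow> p \<in> el X P \<Longrightarrow>
      f \<cdot> te (M \<otimes> N) P (te M N m n) p = g \<cdot> te (M \<otimes> N) P (te M N m n) p"
  shows "f = g"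
proof (rule linear_tensor_eqI[OF tensor_module[OF M N] P Q f g])
  fix X t p assume t: "t \<in> el X (M \<otimes> N)" and p: "p \<in> el X P"
  \<comment> \<open>\<open>p\<close> is frozen as a parameter over its own stage \<open>X\<close>;
    taking \<open>Ide E X\<close> as the value of the parameter gives back the original
    elements.\<close>
  have op: "lin_op X (M \<otimes> N) Q (\<lambda>u t. h \<cdot> te (M \<otimes> N) P t (p \<cdot> u))" if "linear ((M \<otimes> N) \<otimes> P) Q h" for h
    by (rule op_rules that M N P Q p)+
  have "f \<cdot> te (M \<otimes> N) P t (p \<cdot> Ide E X) = g \<cdot> te (M \<otimes> N) P t (p \<cdot> Ide E X)"
    by (rule tensor_op_eqI[OF M N Q op[OF f] op[OF g] _ ide_hom[OF hom_dom_obj[OF p]] t])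
      (rule eq[OF _ _ comp_hom[OF _ p]])
  then show "f \<cdot> te (M \<otimes> N) P t p = g \<cdot> te (M \<otimes> N) P t p" using comp_ide_right[OF p] by simp
qed

lemma linear_tensor_eqI3':
  assumes M: "module M" and N: "module N" and P: "module P" and Q: "module Q"
    and f: "linear (M \<otimes> (N \<otimes> P)) Q f" and g: "linear (M \<otimes> (N \<otimes> P)) Q g"
    and eq: "\<And>X m n p. m \<in> el X M \<Longrightarrow> n \<in> el X N \<Longrightarrow> p \<in> el X P \<Longrightarrow>
      f \<cdot> te M (N \<otimes> P) m (te N P n p) = g \<cdot> te M (N \<otimes> P) m (te N P n p)"
  shows "f = g"
proof (rule linear_tensor_eqI[OF M tensor_module[OF N P] Q f g])
  fix X m t assume m: "m \<in> el X M" and t: "t \<in> el X (N \<otimes> P)"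
  have op: "lin_op X (N \<otimes> P) Q (\<lambda>u t. h \<cdot> te M (N \<otimes> P) (m \<cdot> u) t)" if "linear (M \<otimes> (N \<otimes> P)) Q h" for h
    by (rule op_rules that M N P Q m)+
  have "f \<cdot> te M (N \<otimes> P) (m \<cdot> Ide E X) t = g \<cdot> te M (N \<otimes> P) (m \<cdot> Ide E X) t"
    by (rule tensor_op_eqI[OF N P Q op[OF f] op[OF g] _ ide_hom[OF hom_dom_obj[OF m]] t])
      (rule eq[OF comp_hom[OF _ m]])
  then show "f \<cdot> te M (N \<otimes> P) m t = g \<cdot> te M (N \<otimes> P) m t" using comp_ide_right[OF m] by simp
qed

lemma assoc_ex:
  assumes M: "module M" and N: "module N" and P: "module P"
  obtains h where "linear ((M \<otimes> N) \<otimes> P) (M \<otimes> (N \<otimes> P)) h"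
    "\<And>X m n p. m \<in> el X M \<Longrightarrow> n \<in> el X N \<Longrightarrow> p \<in> el X P \<Longrightarrow>
      h \<cdot> te (M \<otimes> N) P (te M N m n) p = te M (N \<otimes> P) m (te N P n p)"
  by (rule tensor_lift3[OF M N P, of "M \<otimes> (N \<otimes> P)" "\<lambda>m n p. te M (N \<otimes> P) m (te N P n p)"])
    ((rule that; assumption) | assumption | rule op_rules M N P)+

text \<open>\<open>tensor_lift3\<close> only lifts out of triples bracketed to the left. The
  braiding turns \<open>M \<otimes> (N \<otimes> P)\<close> into
  \<open>(N \<otimes> P) \<otimes> M\<close>, which has this form.\<close>

lemma assoc_inv_ex:
  assumes M: "module M" and N: "module N" and P: "module P"
  obtains h where "linear (M \<otimes> (N \<otimes> P)) ((M \<otimes> N) \<otimes> P) h"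
    "\<And>X m n p. m \<in> el X M \<Longrightarrow> n \<in> el X N \<Longrightarrow> p \<in> el X P \<Longrightarrow>
      h \<cdot> te M (N \<otimes> P) m (te N P n p) = te (M \<otimes> N) P (te M N m n) p"
proof -
  note NP = tensor_module[OF N P]
  obtain h where h: "linear ((N \<otimes> P) \<otimes> M) ((M \<otimes> N) \<otimes> P) h"
    and app: "\<And>X n p m. n \<in> el X N \<Longrightarrow> p \<in> el X P \<Longrightarrow> m \<in> el X M \<Longrightarrow>
      h \<cdot> te (N \<otimes> P) M (te N P n p) m = te (M \<otimes> N) P (te M N m n) p"
    by (rule tensor_lift3[OF N P M, of "(M \<otimes> N) \<otimes> P" "\<lambda>n p m. te (M \<otimes> N) P (te M N m n) p"])
      ((rule that; assumption) | assumption | rule op_rules M N P)+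
  note b = linear_braid[OF M NP] braid_te[OF M NP]
  have "linear (M \<otimes> (N \<otimes> P)) ((M \<otimes> N) \<otimes> P) (h \<cdot> braid M (N \<otimes> P))"
    by (rule linear_comp[OF _ _ _ b(1) h]; (rule tensor_module M N P)+)
  moreover have "(h \<cdot> braid M (N \<otimes> P)) \<cdot> te M (N \<otimes> P) m (te N P n p) = te (M \<otimes> N) P (te M N m n) p"
    if "m \<in> el X M" "n \<in> el X N" "p \<in> el X P" for X m n p
    using linear_comp_el[OF b(1) h te_el[OF M NP that(1) te_el[OF N P that(2,3)]]]
      b(2)[OF that(1) te_el[OF N P that(2,3)]] app[OF that(2,3,1)] by simp
  ultimately show thesis using that by blast
qed

text \<open>\<open>assoc\<close> and \<open>inv_arr\<close> are definite descriptions. They are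
  pinned down by maps \<open>h\<close> and \<open>g\<close> with the desired values on triple
  tensors, and both composites are identities because they fix such tensors.\<close>

lemma
  assumes M: "module M" and N: "module N" and P: "module P"
  shows linear_assoc: "linear ((M \<otimes> N) \<otimes> P) (M \<otimes> (N \<otimes> P)) (assoc M N P)"
    and assoc_te: "\<And>X m n p. m \<in> el X M \<Longrightarrow> n \<in> el X N \<Longrightarrow> p \<in> el X P \<Longrightarrow>
      assoc M N P \<cdot> te (M \<otimes> N) P (te M N m n) p = te M (N \<otimes> P) m (te N P n p)"
    and linear_inv_assoc: "linear (M \<otimes> (N \<otimes> P)) ((M \<otimes> N) \<otimes> P) (inv_arr E (assoc M N P))"
    and inv_assoc_te: "\<And>X m n p. m \<in> el X M \<Longrightarrow> n \<in> el X N \<Longrightarrow> p \<in> el X P \<Longrightarrow>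
      inv_arr E (assoc M N P) \<cdot> te M (N \<otimes> P) m (te N P n p) = te (M \<otimes> N) P (te M N m n) p"
proof -
  let ?U = "Car M" and ?V = "Car N" and ?W = "Car P"
  let ?UV = "Prod E ?U ?V"
  note MN = tensor_module[OF M N] and NP = tensor_module[OF N P]
  note L = tensor_module[OF MN P] and R = tensor_module[OF M NP]
  note o = module_obj[OF M] module_obj[OF N] module_obj[OF P]
  note UV = prod_obj[OF o(1,2)]
  let ?l = "pmap (\<tau> M N) (Ide E ?W)"
  let ?r = "\<tau> M (N \<otimes> P) \<cdot> \<langle>P1 E ?U ?V \<cdot> P1 E ?UV ?W, \<tau> N P \<cdot> \<langle>P2 E ?U ?V \<cdot> P1 E ?UV ?W, P2 E ?UV ?W\<rangle>\<rangle>"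
  obtain h where h: "linear ((M \<otimes> N) \<otimes> P) (M \<otimes> (N \<otimes> P)) h"
    and happ: "\<And>X m n p. m \<in> el X M \<Longrightarrow> n \<in> el X N \<Longrightarrow> p \<in> el X P \<Longrightarrow>
      h \<cdot> te (M \<otimes> N) P (te M N m n) p = te M (N \<otimes> P) m (te N P n p)"
    using assoc_ex[OF M N P] by blast
  obtain g where g: "linear (M \<otimes> (N \<otimes> P)) ((M \<otimes> N) \<otimes> P) g"
    and gapp: "\<And>X m n p. m \<in> el X M \<Longrightarrow> n \<in> el X N \<Longrightarrow> p \<in> el X P \<Longrightarrow>
      g \<cdot> te M (N \<otimes> P) m (te N P n p) = te (M \<otimes> N) P (te M N m n) p"
    using assoc_inv_ex[OF M N P] by blast
  note i = ide_hom[OF o(3)]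
  note lh = pmap_hom[OF tau_hom[OF M N] i] and tl = tau_hom[OF MN P]
  note q = P1_hom[OF UV o(3)] P2_hom[OF UV o(3)]
  note pq = comp_hom[OF q(1) P1_hom[OF o(1,2)]] comp_hom[OF q(1) P2_hom[OF o(1,2)]]
  note rh = te_el[OF M NP pq(1) te_el[OF N P pq(2) q(2)]]
  have left: "(h' \<cdot> \<tau> (M \<otimes> N) P \<cdot> ?l) \<cdot> \<langle>\<langle>m, n\<rangle>, p\<rangle> = h' \<cdot> te (M \<otimes> N) P (te M N m n) p"
    if h': "linear ((M \<otimes> N) \<otimes> P) (M \<otimes> (N \<otimes> P)) h'" and m: "m \<in> el X M" and n: "n \<in> el X N" and p: "p \<in> el X P" for h' X m n p
  proof -
    note w = pair_hom[OF pair_hom[OF m n] p]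
    show ?thesis
      using comp_assoc[OF w comp_hom[OF lh tl] linear_hom[OF h']] comp_assoc[OF w lh tl]
        pmap_pair[OF tau_hom[OF M N] i pair_hom[OF m n] p] comp_ide_left[OF p] by simp
  qed
  have right: "?r \<cdot> \<langle>\<langle>m, n\<rangle>, p\<rangle> = te M (N \<otimes> P) m (te N P n p)"
    if m: "m \<in> el X M" and n: "n \<in> el X N" and p: "p \<in> el X P" for X m n p
  proof -
    note mn = pair_hom[OF m n]
    note w = pair_hom[OF mn p]
    show ?thesis
      using te_comp[OF M NP pq(1) te_el[OF N P pq(2) q(2)] w] te_comp[OF N P pq(2) q(2) w]
        comp_P1_pair[OF P1_hom[OF o(1,2)] mn p] comp_P1_pair[OF P2_hom[OF o(1,2)] mn p] P2_pair[OF mn p]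
        P1_pair[OF m n] P2_pair[OF m n] by simp
  qed
  have "assoc M N P = h"
    unfolding assoc_def Let_def
  proof (rule the_equality)
    show "linear ((M \<otimes> N) \<otimes> P) (M \<otimes> (N \<otimes> P)) h \<and> h \<cdot> \<tau> (M \<otimes> N) P \<cdot> ?l = ?r"
    proof (intro conjI h prod_arr_eqI[OF comp_hom[OF comp_hom[OF lh tl] linear_hom[OF h]] rh UV o(3)])
      fix Z w p assume w: "w \<in> Hom E Z ?UV" and p: "p \<in> el Z P"
      show "(h \<cdot> \<tau> (M \<otimes> N) P \<cdot> ?l) \<cdot> \<langle>w, p\<rangle> = ?r \<cdot> \<langle>w, p\<rangle>"
        by (rule prod_elem_cases[OF w o(1,2)]) (simp add: left[OF h _ _ p] right[OF _ _ p] happ[OF _ _ p])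
    qed
    fix h' assume h': "linear ((M \<otimes> N) \<otimes> P) (M \<otimes> (N \<otimes> P)) h' \<and> h' \<cdot> \<tau> (M \<otimes> N) P \<cdot> ?l = ?r"
    show "h' = h"
      using h' left[OF h'[THEN conjunct1]] right
      by (intro linear_tensor_eqI3[OF M N P R _ h]) (auto simp: happ)
  qed
  moreover have "g \<cdot> h = Ide E (Car ((M \<otimes> N) \<otimes> P))"
  proof (rule linear_tensor_eqI3[OF M N P L linear_comp[OF L R L h g] linear_id[OF L]])
    fix X m n p assume m: "m \<in> el X M" "n \<in> el X N" "p \<in> el X P"
    note t = te_el[OF MN P te_el[OF M N m(1,2)] m(3)]
    show "(g \<cdot> h) \<cdot> te (M \<otimes> N) P (te M N m n) p = Ide E (Car ((M \<otimes> N) \<otimes> P)) \<cdot> te (M \<otimes> N) P (te M N m n) p"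
      using linear_comp_el[OF h g t] happ[OF m] gapp[OF m] comp_ide_left[OF t] by simp
  qed
  moreover have "h \<cdot> g = Ide E (Car (M \<otimes> (N \<otimes> P)))"
  proof (rule linear_tensor_eqI3'[OF M N P R linear_comp[OF R L R g h] linear_id[OF R]])
    fix X m n p assume m: "m \<in> el X M" "n \<in> el X N" "p \<in> el X P"
    note t = te_el[OF M NP m(1) te_el[OF N P m(2,3)]]
    show "(h \<cdot> g) \<cdot> te M (N \<otimes> P) m (te N P n p) = Ide E (Car (M \<otimes> (N \<otimes> P))) \<cdot> te M (N \<otimes> P) m (te N P n p)"
      using linear_comp_el[OF g h t] happ[OF m] gapp[OF m] comp_ide_left[OF t] by simp
  qed
  ultimately have a: "assoc M N P = h" "inv_arr E (assoc M N P) = g"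
    using inv_arr_eq[OF linear_hom[OF h] linear_hom[OF g]] by auto
  show "linear ((M \<otimes> N) \<otimes> P) (M \<otimes> (N \<otimes> P)) (assoc M N P)"
    "linear (M \<otimes> (N \<otimes> P)) ((M \<otimes> N) \<otimes> P) (inv_arr E (assoc M N P))"
    "\<And>X m n p. m \<in> el X M \<Longrightarrow> n \<in> el X N \<Longrightarrow> p \<in> el X P \<Longrightarrow>
      assoc M N P \<cdot> te (M \<otimes> N) P (te M N m n) p = te M (N \<otimes> P) m (te N P n p)"
    "\<And>X m n p. m \<in> el X M \<Longrightarrow> n \<in> el X N \<Longrightarrow> p \<in> el X P \<Longrightarrow>
      inv_arr E (assoc M N P) \<cdot> te M (N \<otimes> P) m (te N P n p) = te (M \<otimes> N) P (te M N m n) p"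
    unfolding a(1) a(2)[unfolded a(1)] by (rule h g happ gapp; assumption)+
qed

lemma
  assumes H: "module H" and T: "module T" and M: "module M" and g: "linear (H \<otimes> T) M g"
  shows linear_adjunct: "linear H (ihom T M) (adjunct H T M g)"
    and adjunct_app: "\<And>X f t. f \<in> el X H \<Longrightarrow> t \<in> el X T \<Longrightarrow>
      ihom_app T M (adjunct H T M g \<cdot> f) t = g \<cdot> te H T f t"
proof -
  note I = module_ihom[OF T M] and t = tau_hom[OF H T]
  let ?b = "g \<cdot> \<tau> H T"
  have bilin: "bilinear H T M ?b" using linear_comp_bilinear[OF H T tensor_module[OF H T] M tensor_bilinear[OF H T] g] .
  have eval: "?b \<cdot> \<langle>f, x\<rangle> = g \<cdot> te H T f x" if "f \<in> el X H" "x \<in> el X T" for X f x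
    using comp_assoc[OF pair_hom[OF that] t linear_hom[OF g]] .
  have "linear_snd T M (Car H) ?b"
    unfolding linear_snd_def using bilinear_add_right[OF bilin] bilinear_act_right[OF bilin] by simp
  note * = ihom_curry_hom[OF T M module_obj[OF H] bilinear_hom[OF bilin] this, folded adjunct_def]
    ihom_curry_app[OF T M module_obj[OF H] bilinear_hom[OF bilin] this, folded adjunct_def]
  show app: "ihom_app T M (adjunct H T M g \<cdot> f) x = g \<cdot> te H T f x"
    if "f \<in> el X H" "x \<in> el X T" for X f x
    using *(2)[OF that] eval[OF that] by simp
  \<comment> \<open>A family that is constant in its parameter. Any object with an element at every
    stage could index it; the carrier of \<open>k\<close> has its zero, which is inserted
    below.\<close>
  have "lin_op (Car unit_module) H (ihom T M) (\<lambda>c f. adjunct H T M g \<cdot> f)"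
  proof (rule lin_op_ihomI[OF T M H])
    show "adjunct H T M g \<cdot> f \<in> el Y (ihom T M)" if "f \<in> el Y H" for Y f
      using comp_hom[OF that *(1)] .
    show "(adjunct H T M g \<cdot> f) \<cdot> v = adjunct H T M g \<cdot> f \<cdot> v" if "f \<in> el Y H" "v \<in> Hom E W Y" for Y f W v
      using comp_assoc[OF that(2,1) *(1)] .
    have "lin_op (Prod E (Car unit_module) (Car T)) H M (\<lambda>w f. g \<cdot> te H T f (P2 E (Car unit_module) (Car T) \<cdot> w))"
      by (rule op_rules g H T M)+
    then show "lin_op (Prod E (Car unit_module) (Car T)) H M
        (\<lambda>w f. ihom_app T M (adjunct H T M g \<cdot> f) (P2 E (Car unit_module) (Car T) \<cdot> w))"
      by (rule lin_op_cong[OF _ _ H])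
        (rule app[symmetric]; (assumption | rule comp_hom P2_hom module_obj T module_unit_module)+)
  qed
  note lin = this[THEN lin_op_add] this[THEN lin_op_act]
  show "linear H (ihom T M) (adjunct H T M g)"
  proof (rule linearI[OF H I *(1)])
    fix X c x y assume x: "x \<in> el X H"
    have z: "gzero k X \<in> el X unit_module"
      using gzero_el[OF ring_group hom_dom_obj[OF x]] by (simp add: Car_unit_module)
    show "adjunct H T M g \<cdot> gadd H x y = gadd (ihom T M) (adjunct H T M g \<cdot> x) (adjunct H T M g \<cdot> y)" if "y \<in> el X H"
      using lin(1)[OF z x that] .
    show "adjunct H T M g \<cdot> gact H c x = gact (ihom T M) c (adjunct H T M g \<cdot> x)" if "c \<in> el X k"
      using lin(2)[OF z x that] .
  qed
qed

end

section \<open>Faces and the shift of tensor powers\<close>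

context topos_with_tensor
begin

text \<open>One shape of diagram covers the associativity of \<open>\<mu>\<close>, the associativity
  of each action and the compatibility of the two actions; the six modules allow all four
  readings.\<close>

lemma assoc_law_el:
  assumes P: "module B1" "module B2" "module B3" "module Q" "module R1" "module R2"
    and f: "linear (B1 \<otimes> B2) R1 f" and g: "linear (R1 \<otimes> B3) Q g"
    and f': "linear (B2 \<otimes> B3) R2 f'" and g': "linear (B1 \<otimes> R2) Q g'"
    and law: "g \<cdot> tmap (B1 \<otimes> B2) R1 B3 B3 f (idm B3) = g' \<cdot> tmap B1 B1 (B2 \<otimes> B3) R2 (idm B1) f' \<cdot> assoc B1 B2 B3"
    and x: "x \<in> el X B1" and y: "y \<in> el X B2" and z: "z \<in> el X B3"
  shows "g \<cdot> te R1 B3 (f \<cdot> te B1 B2 x y) z = g' \<cdot> te B1 R2 x (f' \<cdot> te B2 B3 y z)"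
proof -
  note xy = te_el[OF P(1,2) x y] and yz = te_el[OF P(2,3) y z]
  note P12 = tensor_module[OF P(1,2)] and P23 = tensor_module[OF P(2,3)]
  note xyz = te_el[OF P12 P(3) xy z]
  note L = linear_tmap[OF P12 P(5) P(3,3) f linear_idm[OF P(3)]]
  note R = linear_assoc[OF P(1-3)] linear_tmap[OF P(1,1) P23 P(6) linear_idm[OF P(1)] f']
  have "(g \<cdot> tmap (B1 \<otimes> B2) R1 B3 B3 f (idm B3)) \<cdot> te (B1 \<otimes> B2) B3 (te B1 B2 x y) z =
      g \<cdot> te R1 B3 (f \<cdot> te B1 B2 x y) z"
    using linear_comp_el[OF L g xyz] tmap_te[OF P12 P(5) P(3,3) f linear_idm[OF P(3)] xy z] idm_el[OF z] by simp
  moreover have "(g' \<cdot> tmap B1 B1 (B2 \<otimes> B3) R2 (idm B1) f' \<cdot> assoc B1 B2 B3) \<cdot> te (B1 \<otimes> B2) B3 (te B1 B2 x y) z =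
      g' \<cdot> te B1 R2 x (f' \<cdot> te B2 B3 y z)"
    using linear_comp_el[OF linear_comp[OF _ _ _ R] g' xyz] linear_comp_el[OF R xyz] assoc_te[OF P(1-3) x y z]
      tmap_te[OF P(1,1) P23 P(6) linear_idm[OF P(1)] f' x yz] idm_el[OF x] P by (simp add: tensor_module)
  ultimately show ?thesis using law by simp
qed

text \<open>Elements \<open>a\<close> and \<open>b\<close> already present at stage \<open>X\<close>
  become parameters by restriction along \<open>u\<close>, and \<open>Ide E X\<close> returns them.
  As \<open>eq\<close> is demanded for all elements at all stages, such tests can be nested to split
  several factors in turn.\<close>

lemma tensor_op_eqI2:
  assumes "module M" "module N" "module P"
    and a: "a \<in> Hom E X A'" and b: "b \<in> Hom E X B'" and s: "s \<in> el X (M \<otimes> N)"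
    and F: "lin_op X (M \<otimes> N) P (\<lambda>u. F (a \<cdot> u) (b \<cdot> u))" and G: "lin_op X (M \<otimes> N) P (\<lambda>u. G (a \<cdot> u) (b \<cdot> u))"
    and eq: "\<And>Y a b x y. a \<in> Hom E Y A' \<Longrightarrow> b \<in> Hom E Y B' \<Longrightarrow> x \<in> el Y M \<Longrightarrow> y \<in> el Y N \<Longrightarrow>
      F a b (te M N x y) = G a b (te M N x y)"
  shows "F a b s = G a b s"
proof -
  have "F (a \<cdot> Ide E X) (b \<cdot> Ide E X) s = G (a \<cdot> Ide E X) (b \<cdot> Ide E X) s"
    using hom_objs[OF a] by (intro tensor_op_eqI[OF assms(1-3) F G _ ide_hom s] eq comp_hom[OF _ a] comp_hom[OF _ b]) auto
  then show ?thesis using comp_ide_right[OF a] comp_ide_right[OF b] by simp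
qed

lemma tensor_op_eqI1:
  assumes "module M" "module N" "module P" and a: "a \<in> Hom E X A'" and s: "s \<in> el X (M \<otimes> N)"
    and F: "lin_op X (M \<otimes> N) P (\<lambda>u. F (a \<cdot> u))" and G: "lin_op X (M \<otimes> N) P (\<lambda>u. G (a \<cdot> u))"
    and eq: "\<And>Y a x y. a \<in> Hom E Y A' \<Longrightarrow> x \<in> el Y M \<Longrightarrow> y \<in> el Y N \<Longrightarrow>
      F a (te M N x y) = G a (te M N x y)"
  shows "F a s = G a s"
  using tensor_op_eqI2[OF assms(1-3) a a s, of "\<lambda>a b. F a" "\<lambda>a b. G a"] F G eq by blast

lemma tensor_op_eqI0:
  assumes "module M" "module N" "module P" and s: "s \<in> el X (M \<otimes> N)"
    and F: "lin_op X (M \<otimes> N) P (\<lambda>u. F)" and G: "lin_op X (M \<otimes> N) P (\<lambda>u. G)"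
    and eq: "\<And>Y x y. x \<in> el Y M \<Longrightarrow> y \<in> el Y N \<Longrightarrow> F (te M N x y) = G (te M N x y)"
  shows "F s = G s"
  using tensor_op_eqI1[OF assms(1-3) s s, of "\<lambda>a. F" "\<lambda>a. G"] F G eq by blast

end

section \<open>Inner faces and their commutation\<close>

context k_algebra
begin

declare alg_module [simp] tensor_module [simp] module_unit_module [simp]

lemma module_tpow [simp]: "module (tpow n)"
  by (induction n) simp_all

abbreviation "mu_el a b \<equiv> \<mu> \<cdot> te A A a b"

lemma mu_el: "a \<in> el X A \<Longrightarrow> b \<in> el X A \<Longrightarrow> mu_el a b \<in> el X A"
  by (rule linear_el[OF mult_linear te_el]) simp_all

lemmas mu_assoc = assoc_law_el[OF alg_module alg_module alg_module alg_module alg_module alg_module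
    mult_linear mult_linear mult_linear mult_linear mult_assoc]

lemma
  shows linear_face_first: "linear (A \<otimes> A \<otimes> tpow n) (A \<otimes> tpow n) (face (Suc n) (Suc 0))"
    and face_first_te: "\<And>X a b t. a \<in> el X A \<Longrightarrow> b \<in> el X A \<Longrightarrow> t \<in> el X (tpow n) \<Longrightarrow>
      face (Suc n) (Suc 0) \<cdot> te A (A \<otimes> tpow n) a (te A (tpow n) b t) = te A (tpow n) (mu_el a b) t"
proof -
  have [simp]: "linear (tpow n) (tpow n) (idm (tpow n))" by (simp add: linear_idm)
  note L = linear_inv_assoc[OF alg_module alg_module module_tpow, of n]
    linear_tmap[OF _ _ _ _ mult_linear, of "tpow n" "tpow n" "idm (tpow n)"]
  show "linear (A \<otimes> A \<otimes> tpow n) (A \<otimes> tpow n) (face (Suc n) (Suc 0))"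
    using linear_comp[OF _ _ _ L] by simp
  fix X a b t assume a: "a \<in> el X A" and b: "b \<in> el X A" and t: "t \<in> el X (tpow n)"
  have ab: "te A A a b \<in> el X (A \<otimes> A)" and bt: "te A (A \<otimes> tpow n) a (te A (tpow n) b t) \<in> el X (A \<otimes> A \<otimes> tpow n)"
    using a b t by (simp_all add: te_el)
  show "face (Suc n) (Suc 0) \<cdot> te A (A \<otimes> tpow n) a (te A (tpow n) b t) = te A (tpow n) (mu_el a b) t"
    using linear_comp_el[OF L bt] inv_assoc_te[OF _ _ _ a b t] tmap_te[OF _ _ _ _ mult_linear _ ab t]
      idm_el[OF t] by simp
qed

lemma linear_face: "i < n \<Longrightarrow> linear (A \<otimes> tpow n) (tpow n) (face n (Suc i))"
proof (induction i arbitrary: n)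
  case 0
  then show ?case using linear_face_first by (cases n) auto
next
  case (Suc i)
  then obtain m where m: "n = Suc m" "i < m" by (cases n) auto
  then show ?case
    using linear_tmap[OF _ _ _ _ linear_idm Suc.IH[OF m(2)], of A] by simp
qed

lemma face_step_te:
  assumes "i < n" "a \<in> el X A" "t \<in> el X (A \<otimes> tpow n)"
  shows "face (Suc n) (Suc (Suc i)) \<cdot> te A (A \<otimes> tpow n) a t = te A (tpow n) a (face n (Suc i) \<cdot> t)"
  using tmap_te[OF _ _ _ _ linear_idm linear_face[OF assms(1)], of A a X t] assms idm_el[OF assms(2)] by simp

lemma linear_shift: "linear (A \<otimes> tpow n) (tpow n \<otimes> A) (shift n)"
proof (induction n)
  case 0
  show ?case using linear_comp[OF _ _ _ linear_runit linear_inv_lunit, of A] by simp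
next
  case (Suc n)
  show ?case
    using linear_comp[OF _ _ _ linear_tmap[OF _ _ _ _ linear_idm Suc.IH, of A] linear_inv_assoc[of A "tpow n" A]] by simp
qed

lemma shift_zero_te:
  assumes "a \<in> el X A" "c \<in> el X k"
  shows "shift 0 \<cdot> te A unit_module a c = te unit_module A (gunit k X) (gact A c a)"
proof -
  have "te A unit_module a c \<in> el X (A \<otimes> unit_module)"
    using te_el[of A unit_module a X c] assms by (simp add: Car_unit_module)
  then show ?thesis
    using linear_comp_el[OF linear_runit linear_inv_lunit, of A "te A unit_module a c" X]
      runit_te[OF alg_module assms(2,1)] inv_lunit_el[OF alg_module gact_el[OF alg_module assms(2,1)]] by simp
qed

text \<open>Only a recursion: \<open>shift n \<cdot> t\<close> need not be a pure tensor, so the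
  reassociation in front of it cannot be evaluated. Later arguments move maps past it
  instead.\<close>

lemma shift_Suc_te:
  assumes "a \<in> el X A" "t \<in> el X (A \<otimes> tpow n)"
  shows "shift (Suc n) \<cdot> te A (A \<otimes> tpow n) a t = inv_arr E (assoc A (tpow n) A) \<cdot> te A (tpow n \<otimes> A) a (shift n \<cdot> t)"
  using linear_comp_el[OF linear_tmap[OF _ _ _ _ linear_idm linear_shift, of A n] linear_inv_assoc[of A "tpow n" A]
      te_el[OF _ _ assms]] tmap_te[OF _ _ _ _ linear_idm linear_shift assms] idm_el[OF assms(1)] by simp

text \<open>The induction on \<open>i\<close> strips leading factors on which neither face acts. For
  \<open>i = 0\<close> the outer faces multiply the first two factors: if \<open>j > 0\<close>, the
  other face works behind the first factor and the formulas for single faces suffice; if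
  \<open>j = 0\<close>, the faces overlap and associativity decides.\<close>

lemma face_face:
  assumes "i \<le> j" "j < n" "t \<in> el X (A \<otimes> A \<otimes> tpow n)"
  shows "face n (Suc i) \<cdot> face (Suc n) (Suc (Suc j)) \<cdot> t = face n (Suc j) \<cdot> face (Suc n) (Suc i) \<cdot> t"
  using assms
proof (induction i arbitrary: j n t X)
  case 0
  then obtain m where n: "n = Suc m" by (cases n) auto
  let ?T = "A \<otimes> tpow m"
  note L = linear_face_first[of m] linear_face_first[of "Suc m"] linear_face[of j "Suc m"] linear_face[of "Suc j" "Suc (Suc m)"]
  let ?F = "\<lambda>t. face (Suc m) (Suc 0) \<cdot> face (Suc (Suc m)) (Suc (Suc j)) \<cdot> t"
  let ?G = "\<lambda>t. face (Suc m) (Suc j) \<cdot> face (Suc (Suc m)) (Suc 0) \<cdot> t"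
  have F: "linear (A \<otimes> ?T) ?T (face (Suc m) (Suc 0))"
    "linear (A \<otimes> A \<otimes> ?T) (A \<otimes> ?T) (face (Suc (Suc m)) (Suc (Suc j)))"
    "linear (A \<otimes> ?T) ?T (face (Suc m) (Suc j))"
    "linear (A \<otimes> A \<otimes> ?T) (A \<otimes> ?T) (face (Suc (Suc m)) (Suc 0))"
    using L 0 n by auto
  note R = op_rules alg_module module_tpow F
  have "?F t = ?G t"
  proof (rule tensor_op_eqI0[where P = "?T" and F = ?F and G = ?G])
    show "t \<in> el X (A \<otimes> A \<otimes> ?T)" using 0 n by simp
    fix Y a s assume a: "a \<in> el Y A" and s: "s \<in> el Y (A \<otimes> ?T)"
    let ?F1 = "\<lambda>a s. ?F (te A (A \<otimes> ?T) a s)" and ?G1 = "\<lambda>a s. ?G (te A (A \<otimes> ?T) a s)"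
    show "?F1 a s = ?G1 a s"
    proof (rule tensor_op_eqI1[where P = "?T" and F = ?F1 and G = ?G1, OF _ _ _ a s])
      fix Z a b u assume a: "a \<in> el Z A" and b: "b \<in> el Z A" and u: "u \<in> el Z ?T"
      let ?b = "\<lambda>b u. te A ?T b u"
      have bu: "?b b u \<in> el Z (A \<otimes> ?T)" using te_el b u by simp
      have G: "?G1 a (?b b u) = face (Suc m) (Suc j) \<cdot> ?b (mu_el a b) u"
        using face_first_te[of a Z b u "Suc m"] a b u by simp
      have Fs: "?F1 a (?b b u) = face (Suc m) (Suc 0) \<cdot> ?b a (face (Suc m) (Suc j) \<cdot> ?b b u)"
        using face_step_te[of j "Suc m" a Z "?b b u"] a bu 0 n by simp
      show "?F1 a (?b b u) = ?G1 a (?b b u)"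
      proof (cases j)
        case (Suc j')
        have u': "face m (Suc j') \<cdot> u \<in> el Z (tpow m)" using linear_el[OF linear_face u] 0 n Suc by simp
        show ?thesis
          unfolding G Fs using face_step_te[of j' m b Z u] face_step_te[of j' m "mu_el a b" Z u]
            face_first_te[OF a b u'] a b u 0 n Suc mu_el[OF a b] by simp
      next
        \<comment> \<open>The overlapping faces multiply the first three factors together, so
          \<open>u\<close> has to be split once more before \<open>mu_assoc\<close> applies.\<close>
        case j: 0
        let ?F2 = "\<lambda>a b u. face (Suc m) (Suc 0) \<cdot> ?b a (face (Suc m) (Suc 0) \<cdot> ?b b u)"
        let ?G2 = "\<lambda>a b u. face (Suc m) (Suc 0) \<cdot> ?b (mu_el a b) u"
        have "?F2 a b u = ?G2 a b u"
        proof (rule tensor_op_eqI2[where P = "?T" and F = ?F2 and G = ?G2, OF _ _ _ a b u])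
          fix W a b c v assume a: "a \<in> el W A" and b: "b \<in> el W A" and c: "c \<in> el W A" and v: "v \<in> el W (tpow m)"
          show "?F2 a b (te A (tpow m) c v) = ?G2 a b (te A (tpow m) c v)"
            using face_first_te[OF b c v] face_first_te[OF a mu_el[OF b c] v]
              face_first_te[OF mu_el[OF a b] c v] mu_assoc[OF a b c] by simp
        qed ((unfold tpow.simps)?, (rule R mult_linear a b | simp)+)
        then show ?thesis using Fs G by (simp add: j)
      qed
    qed ((unfold tpow.simps)?, (rule R a | simp)+)
  qed ((unfold tpow.simps)?, (rule R | simp)+)
  then show ?case by (simp only: n)
next
  case (Suc i)
  then obtain m j' where n: "n = Suc m" "j = Suc j'" "i \<le> j'" "j' < m" by (cases n; cases j) auto
  let ?T = "A \<otimes> tpow m"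
  have F: "linear (A \<otimes> ?T) ?T (face (Suc m) (Suc (Suc i)))"
    "linear (A \<otimes> A \<otimes> ?T) (A \<otimes> ?T) (face (Suc (Suc m)) (Suc (Suc (Suc j'))))"
    "linear (A \<otimes> ?T) ?T (face (Suc m) (Suc (Suc j')))"
    "linear (A \<otimes> A \<otimes> ?T) (A \<otimes> ?T) (face (Suc (Suc m)) (Suc (Suc i)))"
    using n linear_face[of "Suc i" "Suc m"] linear_face[of "Suc (Suc j')" "Suc (Suc m)"]
      linear_face[of "Suc j'" "Suc m"] linear_face[of "Suc i" "Suc (Suc m)"] by auto
  note R = op_rules alg_module module_tpow F
  let ?F = "\<lambda>t. face (Suc m) (Suc (Suc i)) \<cdot> face (Suc (Suc m)) (Suc (Suc (Suc j'))) \<cdot> t"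
  let ?G = "\<lambda>t. face (Suc m) (Suc (Suc j')) \<cdot> face (Suc (Suc m)) (Suc (Suc i)) \<cdot> t"
  have "?F t = ?G t"
  proof (rule tensor_op_eqI0[where P = "?T" and F = ?F and G = ?G])
    show "t \<in> el X (A \<otimes> A \<otimes> ?T)" using Suc.prems n by simp
    fix Y a s assume a: "a \<in> el Y A" and s: "s \<in> el Y (A \<otimes> ?T)"
    have s1: "face (Suc m) (Suc (Suc j')) \<cdot> s \<in> el Y ?T" "face (Suc m) (Suc i) \<cdot> s \<in> el Y ?T"
      using linear_el[OF linear_face[of "Suc j'" "Suc m"], of s Y] linear_el[OF linear_face[of i "Suc m"], of s Y] s n by auto
    show "?F (te A (A \<otimes> ?T) a s) = ?G (te A (A \<otimes> ?T) a s)"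
      using face_step_te[of "Suc j'" "Suc m" a Y s] face_step_te[of i m a Y "face (Suc m) (Suc (Suc j')) \<cdot> s"]
        face_step_te[of i "Suc m" a Y s] face_step_te[of j' m a Y "face (Suc m) (Suc i) \<cdot> s"]
        Suc.IH[of j' m s Y] a s s1 n by simp
  qed ((unfold tpow.simps)?, (rule R | simp)+)
  then show ?case by (simp only: n)
qed

section \<open>The last factor of a tensor power, split off on the right\<close>

definition last_mult :: "nat \<Rightarrow> 'a" where
  "last_mult n = tmap (tpow n) (tpow n) (A \<otimes> A) A (idm (tpow n)) \<mu> \<cdot> assoc (tpow n) A A"

lemma
  shows linear_last_mult: "linear ((tpow n \<otimes> A) \<otimes> A) (tpow n \<otimes> A) (last_mult n)"
    and last_mult_te: "\<And>X t b c. t \<in> el X (tpow n) \<Longrightarrow> b \<in> el X A \<Longrightarrow> c \<in> el X A \<Longrightarrow>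
      last_mult n \<cdot> te (tpow n \<otimes> A) A (te (tpow n) A t b) c = te (tpow n) A t (mu_el b c)"
proof -
  note L = linear_assoc[of "tpow n" A A] linear_tmap[OF _ _ _ _ linear_idm mult_linear, of "tpow n"]
  show "linear ((tpow n \<otimes> A) \<otimes> A) (tpow n \<otimes> A) (last_mult n)"
    unfolding last_mult_def using linear_comp[OF _ _ _ L] by simp
  fix X t b c assume t: "t \<in> el X (tpow n)" and b: "b \<in> el X A" and c: "c \<in> el X A"
  have bc: "te A A b c \<in> el X (A \<otimes> A)" and tbc: "te (tpow n \<otimes> A) A (te (tpow n) A t b) c \<in> el X ((tpow n \<otimes> A) \<otimes> A)"
    using t b c by (simp_all add: te_el)
  show "last_mult n \<cdot> te (tpow n \<otimes> A) A (te (tpow n) A t b) c = te (tpow n) A t (mu_el b c)"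
    unfolding last_mult_def using linear_comp_el[OF L tbc] assoc_te[OF _ _ _ t b c]
      tmap_te[OF _ _ _ _ linear_idm mult_linear t bc] idm_el[OF t] by simp
qed

text \<open>The last inner face as seen once the final factor has been split off: the last factor of
  \<open>A \<otimes> tpow n\<close> is split off as well and multiplied by the one already on the
  right.\<close>

definition shift_mult :: "nat \<Rightarrow> 'a" where
  "shift_mult n = last_mult n \<cdot> tmap (A \<otimes> tpow n) (tpow n \<otimes> A) A A (shift n) (idm A)"

lemma
  shows linear_shift_mult: "linear ((A \<otimes> tpow n) \<otimes> A) (tpow n \<otimes> A) (shift_mult n)"
    and shift_mult_te: "\<And>X t b. t \<in> el X (A \<otimes> tpow n) \<Longrightarrow> b \<in> el X A \<Longrightarrow>
      shift_mult n \<cdot> te (A \<otimes> tpow n) A t b = last_mult n \<cdot> te (tpow n \<otimes> A) A (shift n \<cdot> t) b"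
proof -
  have L: "linear ((A \<otimes> tpow n) \<otimes> A) ((tpow n \<otimes> A) \<otimes> A) (tmap (A \<otimes> tpow n) (tpow n \<otimes> A) A A (shift n) (idm A))"
    using linear_tmap[OF _ _ _ _ linear_shift linear_idm] by simp
  show "linear ((A \<otimes> tpow n) \<otimes> A) (tpow n \<otimes> A) (shift_mult n)"
    unfolding shift_mult_def using linear_comp[OF _ _ _ L linear_last_mult] by simp
  fix X t b assume t: "t \<in> el X (A \<otimes> tpow n)" and b: "b \<in> el X A"
  show "shift_mult n \<cdot> te (A \<otimes> tpow n) A t b = last_mult n \<cdot> te (tpow n \<otimes> A) A (shift n \<cdot> t) b"
    unfolding shift_mult_def using linear_comp_el[OF L linear_last_mult te_el[OF _ _ t b]]
      tmap_te[OF _ _ _ _ linear_shift linear_idm t b] idm_el[OF b] by simp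
qed

abbreviation "inv_assoc_el n a s \<equiv> inv_arr E (assoc A (tpow n) A) \<cdot> te A (tpow n \<otimes> A) a s"

lemma linear_inv_assoc_tpow: "linear (A \<otimes> tpow n \<otimes> A) ((A \<otimes> tpow n) \<otimes> A) (inv_arr E (assoc A (tpow n) A))"
  by (rule linear_inv_assoc) simp_all

lemma inv_assoc_tpow_te:
  "a \<in> el X A \<Longrightarrow> t \<in> el X (tpow n) \<Longrightarrow> b \<in> el X A \<Longrightarrow>
    inv_assoc_el n a (te (tpow n) A t b) = te (A \<otimes> tpow n) A (te A (tpow n) a t) b"
  by (rule inv_assoc_te) simp_all

abbreviation "face_id n i \<equiv> tmap (A \<otimes> tpow n) (tpow n) A A (face n i) (idm A)"

lemma linear_face_id: "i < n \<Longrightarrow> linear ((A \<otimes> tpow n) \<otimes> A) (tpow n \<otimes> A) (face_id n (Suc i))"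
  by (rule linear_tmap[OF _ _ _ _ linear_face linear_idm]) simp_all

lemma face_id_te: "i < n \<Longrightarrow> t \<in> el X (A \<otimes> tpow n) \<Longrightarrow> b \<in> el X A \<Longrightarrow>
    face_id n (Suc i) \<cdot> te (A \<otimes> tpow n) A t b = te (tpow n) A (face n (Suc i) \<cdot> t) b"
  using tmap_te[OF _ _ _ _ linear_face linear_idm, of n A i t X b] idm_el[of b X A] by simp

text \<open>Stated for an arbitrary \<open>s\<close>, because it is applied to values of
  \<open>shift\<close>, which are not given as pure tensors. The same holds for the following
  commutations with \<open>inv_assoc_el\<close>.\<close>

lemma face_id_first:
  assumes a: "a \<in> el X A" and b: "b \<in> el X A" and s: "s \<in> el X (tpow m \<otimes> A)"
  shows "face_id (Suc m) (Suc 0) \<cdot> inv_assoc_el (Suc m) a (inv_assoc_el m b s) = inv_assoc_el m (mu_el a b) s"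
proof -
  let ?T = "A \<otimes> tpow m"
  let ?F = "\<lambda>a b s. face_id (Suc m) (Suc 0) \<cdot> inv_assoc_el (Suc m) a (inv_assoc_el m b s)"
  let ?G = "\<lambda>a b s. inv_assoc_el m (mu_el a b) s"
  note R = op_rules alg_module module_tpow linear_face_id[of 0 "Suc m", unfolded tpow.simps] linear_inv_assoc_tpow[of m]
    linear_inv_assoc_tpow[of "Suc m", unfolded tpow.simps] mult_linear
  have "?F a b s = ?G a b s"
  proof (rule tensor_op_eqI2[where P = "?T \<otimes> A" and F = ?F and G = ?G, OF _ _ _ a b s])
    fix Y a b t c assume a: "a \<in> el Y A" and b: "b \<in> el Y A" and t: "t \<in> el Y (tpow m)" and c: "c \<in> el Y A"
    have bt: "te A (tpow m) b t \<in> el Y (tpow (Suc m))" using b t by (simp add: te_el)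
    have abt: "te A ?T a (te A (tpow m) b t) \<in> el Y (A \<otimes> ?T)" using a b t by (simp add: te_el)
    show "?F a b (te (tpow m) A t c) = ?G a b (te (tpow m) A t c)"
      using inv_assoc_tpow_te[OF b t c] inv_assoc_tpow_te[OF a bt c] inv_assoc_tpow_te[OF mu_el[OF a b] t c]
        face_id_te[of 0 "Suc m" "te A ?T a (te A (tpow m) b t)" Y c] abt c
        face_first_te[OF a b t] by simp
  qed ((unfold tpow.simps)?, (rule R a b | simp)+)
  then show ?thesis .
qed

lemma face_id_step:
  assumes i: "i < m" and a: "a \<in> el X A" and s: "s \<in> el X ((A \<otimes> tpow m) \<otimes> A)"
  shows "face_id (Suc m) (Suc (Suc i)) \<cdot> inv_assoc_el (Suc m) a s = inv_assoc_el m a (face_id m (Suc i) \<cdot> s)"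
proof -
  let ?T = "A \<otimes> tpow m"
  let ?F = "\<lambda>a s. face_id (Suc m) (Suc (Suc i)) \<cdot> inv_assoc_el (Suc m) a s"
  let ?G = "\<lambda>a s. inv_assoc_el m a (face_id m (Suc i) \<cdot> s)"
  have i': "Suc i < Suc m" using i by simp
  note R = op_rules alg_module module_tpow linear_face_id[OF i] linear_face_id[OF i', unfolded tpow.simps] linear_inv_assoc_tpow[of m]
    linear_inv_assoc_tpow[of "Suc m", unfolded tpow.simps]
  have "?F a s = ?G a s"
  proof (rule tensor_op_eqI1[where P = "?T \<otimes> A" and F = ?F and G = ?G, OF _ _ _ a s])
    fix Y a t c assume a: "a \<in> el Y A" and t: "t \<in> el Y ?T" and c: "c \<in> el Y A"
    have at: "te A ?T a t \<in> el Y (A \<otimes> ?T)" using a t by (simp add: te_el)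
    note ft = linear_el[OF linear_face[OF i] t]
    show "?F a (te ?T A t c) = ?G a (te ?T A t c)"
      using inv_assoc_tpow_te[of a Y t "Suc m" c] inv_assoc_tpow_te[OF a ft c] face_id_te[OF i t c]
        face_id_te[of "Suc i" "Suc m" "te A ?T a t" Y c] face_step_te[OF i a t] a t c at i by simp
  qed ((unfold tpow.simps)?, (rule R a | simp)+)
  then show ?thesis .
qed

text \<open>\<open>face (Suc n) (Suc i)\<close> with \<open>i < n\<close> does not touch the last of
  the \<open>n + 2\<close> factors, so it commutes with splitting that factor off. The induction
  strips leading factors; its base is \<open>face_id_first\<close>.\<close>

lemma shift_face:
  assumes "i < n" "t \<in> el X (A \<otimes> A \<otimes> tpow n)"
  shows "face_id n (Suc i) \<cdot> shift (Suc n) \<cdot> t = shift n \<cdot> face (Suc n) (Suc i) \<cdot> t"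
  using assms
proof (induction i arbitrary: n t X)
  case 0
  then obtain m where n: "n = Suc m" by (cases n) auto
  let ?T = "A \<otimes> tpow m"
  let ?F = "\<lambda>t. face_id (Suc m) (Suc 0) \<cdot> shift (Suc (Suc m)) \<cdot> t"
  let ?G = "\<lambda>t. shift (Suc m) \<cdot> face (Suc (Suc m)) (Suc 0) \<cdot> t"
  note R = op_rules alg_module module_tpow linear_face_id[of 0 "Suc m", unfolded tpow.simps] linear_shift[of "Suc m", unfolded tpow.simps]
    linear_shift[of "Suc (Suc m)", unfolded tpow.simps] linear_face_first[of "Suc m", unfolded tpow.simps]
  have "?F t = ?G t"
  proof (rule tensor_op_eqI0[where P = "?T \<otimes> A" and F = ?F and G = ?G])
    show "t \<in> el X (A \<otimes> A \<otimes> ?T)" using 0 n by simp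
    fix Y a s assume a: "a \<in> el Y A" and s: "s \<in> el Y (A \<otimes> ?T)"
    let ?F1 = "\<lambda>a s. ?F (te A (A \<otimes> ?T) a s)" and ?G1 = "\<lambda>a s. ?G (te A (A \<otimes> ?T) a s)"
    show "?F1 a s = ?G1 a s"
    proof (rule tensor_op_eqI1[where P = "?T \<otimes> A" and F = ?F1 and G = ?G1, OF _ _ _ a s])
      fix Z a b u assume a: "a \<in> el Z A" and b: "b \<in> el Z A" and u: "u \<in> el Z ?T"
      have bu: "te A ?T b u \<in> el Z (A \<otimes> ?T)" using te_el b u by simp
      show "?F1 a (te A ?T b u) = ?G1 a (te A ?T b u)"
        using shift_Suc_te[of a Z "te A ?T b u" "Suc m"] shift_Suc_te[OF b u]
          face_first_te[of a Z b u "Suc m"] shift_Suc_te[OF mu_el[OF a b] u]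
          face_id_first[OF a b linear_el[OF linear_shift u]] a b u bu
        by (simp del: shift.simps)
    qed ((unfold tpow.simps)?, (rule R a | simp del: shift.simps)+)
  qed ((unfold tpow.simps)?, (rule R | simp del: shift.simps)+)
  then show ?case by (simp only: n)
next
  case (Suc i)
  then obtain m where n: "n = Suc m" "i < m" by (cases n) auto
  let ?T = "A \<otimes> tpow m"
  let ?F = "\<lambda>t. face_id (Suc m) (Suc (Suc i)) \<cdot> shift (Suc (Suc m)) \<cdot> t"
  let ?G = "\<lambda>t. shift (Suc m) \<cdot> face (Suc (Suc m)) (Suc (Suc i)) \<cdot> t"
  have i': "Suc i < Suc m" "Suc i < Suc (Suc m)" using n by simp_all
  note F = linear_face_id[OF i'(1)] linear_shift[of "Suc m"] linear_shift[of "Suc (Suc m)"] linear_face[OF i'(2)]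
  note R = op_rules alg_module module_tpow F[unfolded tpow.simps]
  have "?F t = ?G t"
  proof (rule tensor_op_eqI0[where P = "?T \<otimes> A" and F = ?F and G = ?G])
    show "t \<in> el X (A \<otimes> A \<otimes> ?T)" using Suc.prems n by simp
    fix Y a s assume a: "a \<in> el Y A" and s: "s \<in> el Y (A \<otimes> ?T)"
    have e: "shift (Suc m) \<cdot> s \<in> el Y (?T \<otimes> A)" "face (Suc m) (Suc i) \<cdot> s \<in> el Y ?T"
      using linear_el[OF linear_shift[of "Suc m"], of s Y] linear_el[OF linear_face[of i "Suc m"], of s Y] s n
      by (auto simp del: shift.simps)
    show "?F (te A (A \<otimes> ?T) a s) = ?G (te A (A \<otimes> ?T) a s)"
      using shift_Suc_te[of a Y s "Suc m"] face_step_te[of i "Suc m" a Y s] face_id_step[OF n(2) a e(1)]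
        shift_Suc_te[OF a e(2)] Suc.IH[OF n(2) s] a s n by (simp del: shift.simps)
  qed ((unfold tpow.simps)?, (rule R | simp del: shift.simps)+)
  then show ?case by (simp only: n)
qed

lemma last_mult_inv_assoc:
  assumes a: "a \<in> el X A" and b: "b \<in> el X A" and s: "s \<in> el X (tpow n \<otimes> A)"
  shows "last_mult (Suc n) \<cdot> te ((A \<otimes> tpow n) \<otimes> A) A (inv_assoc_el n a s) b =
    inv_assoc_el n a (last_mult n \<cdot> te (tpow n \<otimes> A) A s b)"
proof -
  let ?F = "\<lambda>a b s. last_mult (Suc n) \<cdot> te ((A \<otimes> tpow n) \<otimes> A) A (inv_assoc_el n a s) b"
  let ?G = "\<lambda>a b s. inv_assoc_el n a (last_mult n \<cdot> te (tpow n \<otimes> A) A s b)"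
  note R = op_rules alg_module module_tpow linear_inv_assoc_tpow linear_last_mult linear_last_mult[of "Suc n", unfolded tpow.simps]
  have "?F a b s = ?G a b s"
  proof (rule tensor_op_eqI2[where P = "(A \<otimes> tpow n) \<otimes> A" and F = ?F and G = ?G, OF _ _ _ a b s])
    fix Y a b t c assume a: "a \<in> el Y A" and b: "b \<in> el Y A" and t: "t \<in> el Y (tpow n)" and c: "c \<in> el Y A"
    have at: "te A (tpow n) a t \<in> el Y (tpow (Suc n))" using a t by (simp add: te_el)
    show "?F a b (te (tpow n) A t c) = ?G a b (te (tpow n) A t c)"
      using inv_assoc_tpow_te[OF a t c] inv_assoc_tpow_te[OF a t mu_el[OF c b]] last_mult_te[OF t c b]
        last_mult_te[OF at c b] by simp
  qed ((unfold tpow.simps)?, (rule R a b | simp)+)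
  then show ?thesis .
qed

text \<open>A leading factor is inert for multiplication at the right end. This is the inductive
  step of \<open>shift_last\<close>.\<close>

lemma shift_mult_inv_assoc:
  assumes a: "a \<in> el X A" and s: "s \<in> el X ((A \<otimes> tpow n) \<otimes> A)"
  shows "shift_mult (Suc n) \<cdot> inv_assoc_el (Suc n) a s = inv_assoc_el n a (shift_mult n \<cdot> s)"
proof -
  let ?T = "A \<otimes> tpow n"
  let ?F = "\<lambda>a s. shift_mult (Suc n) \<cdot> inv_assoc_el (Suc n) a s"
  let ?G = "\<lambda>a s. inv_assoc_el n a (shift_mult n \<cdot> s)"
  note R = op_rules alg_module module_tpow linear_inv_assoc_tpow[of n] linear_inv_assoc_tpow[of "Suc n", unfolded tpow.simps]
    linear_shift_mult[of n] linear_shift_mult[of "Suc n", unfolded tpow.simps]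
  have "?F a s = ?G a s"
  proof (rule tensor_op_eqI1[where P = "?T \<otimes> A" and F = ?F and G = ?G, OF _ _ _ a s])
    fix Y a t b assume a: "a \<in> el Y A" and t: "t \<in> el Y ?T" and b: "b \<in> el Y A"
    have at: "te A ?T a t \<in> el Y (A \<otimes> ?T)" using a t by (simp add: te_el)
    show "?F a (te ?T A t b) = ?G a (te ?T A t b)"
      using inv_assoc_tpow_te[of a Y t "Suc n" b] shift_mult_te[of "te A ?T a t" Y "Suc n" b]
        shift_Suc_te[OF a t] shift_mult_te[OF t b] last_mult_inv_assoc[OF a b linear_el[OF linear_shift t]] a t b at
      by (simp del: shift.simps)
  qed ((unfold tpow.simps)?, (rule R a | simp)+)
  then show ?thesis .
qed

text \<open>Companion of \<open>shift_face\<close> for the one face that touches the last factor.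
  The induction strips leading factors until only \<open>A \<otimes> (A \<otimes> k)\<close>
  remains, and there the final scalar has to be tracked.\<close>

lemma shift_last:
  assumes "t \<in> el X (A \<otimes> A \<otimes> tpow n)"
  shows "shift_mult n \<cdot> shift (Suc n) \<cdot> t = shift n \<cdot> face (Suc n) (Suc n) \<cdot> t"
  using assms
proof (induction n arbitrary: t X)
  case 0
  let ?U = unit_module
  let ?F = "\<lambda>t. shift_mult 0 \<cdot> shift (Suc 0) \<cdot> t" and ?G = "\<lambda>t. shift 0 \<cdot> face (Suc 0) (Suc 0) \<cdot> t"
  note R = op_rules alg_module linear_shift_mult[of 0, unfolded tpow.simps] linear_shift[of 0, unfolded tpow.simps]
    linear_shift[of "Suc 0", unfolded tpow.simps] linear_face_first[of 0, unfolded tpow.simps]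
  have "?F t = ?G t"
  proof (rule tensor_op_eqI0[where P = "?U \<otimes> A" and F = ?F and G = ?G])
    show "t \<in> el X (A \<otimes> A \<otimes> ?U)" using 0 by simp
    fix Y a s assume a: "a \<in> el Y A" and s: "s \<in> el Y (A \<otimes> ?U)"
    let ?F1 = "\<lambda>a s. ?F (te A (A \<otimes> ?U) a s)" and ?G1 = "\<lambda>a s. ?G (te A (A \<otimes> ?U) a s)"
    show "?F1 a s = ?G1 a s"
    proof (rule tensor_op_eqI1[where P = "?U \<otimes> A" and F = ?F1 and G = ?G1, OF _ _ _ a s])
      fix Z a b c assume a: "a \<in> el Z A" and b: "b \<in> el Z A" and cU: "c \<in> el Z ?U"
      have c: "c \<in> el Z k" using cU by (simp add: Car_unit_module)
      have one: "gunit k Z \<in> el Z k" and oneU: "gunit k Z \<in> el Z ?U"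
        using gunit_el hom_objs[OF a] by (simp_all add: Car_unit_module)
      note cb = gact_el[OF alg_module c b]
      \<comment> \<open>\<open>shift\<close> pushes the scalar \<open>c\<close> into the last factor
        and creates a new unit on the left. The two sides differ by \<open>a (c b)\<close> against
        \<open>c (a b)\<close>, which bilinearity of the multiplication settles.\<close>
      have "shift (Suc 0) \<cdot> te A (A \<otimes> ?U) a (te A ?U b c) = te (A \<otimes> ?U) A (te A ?U a (gunit k Z)) (gact A c b)"
        using shift_Suc_te[of a Z "te A ?U b c" 0] shift_zero_te[OF b c] te_el[OF alg_module module_unit_module b cU]
          inv_assoc_tpow_te[of a Z "gunit k Z" 0 "gact A c b"] a oneU cb by (simp del: shift.simps)
      moreover have "shift_mult 0 \<cdot> te (A \<otimes> ?U) A (te A ?U a (gunit k Z)) (gact A c b) =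
          te ?U A (gunit k Z) (mu_el a (gact A c b))"
        using shift_mult_te[of "te A ?U a (gunit k Z)" Z 0 "gact A c b"] shift_zero_te[OF a one]
          gact_unit[OF alg_module one a] last_mult_te[of "gunit k Z" Z 0 a "gact A c b"] oneU a cb
          te_el[OF alg_module module_unit_module a oneU] by (simp del: shift.simps)
      moreover have "mu_el a (gact A c b) = gact A c (mu_el a b)"
        using bilinear_act_right[OF tensor_bilinear[OF alg_module alg_module] a b c]
          linear_act[OF _ mult_linear c te_el[OF alg_module alg_module a b]] by simp
      ultimately show "?F1 a (te A ?U b c) = ?G1 a (te A ?U b c)"
        using face_first_te[of a Z b c 0] shift_zero_te[OF mu_el[OF a b] c] a b cU by (simp del: shift.simps)
    qed ((unfold tpow.simps)?, (rule R a | simp del: shift.simps)+)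
  qed ((unfold tpow.simps)?, (rule R | simp del: shift.simps)+)
  then show ?case .
next
  case (Suc n)
  let ?F = "\<lambda>t. shift_mult (Suc n) \<cdot> shift (Suc (Suc n)) \<cdot> t"
  let ?G = "\<lambda>t. shift (Suc n) \<cdot> face (Suc (Suc n)) (Suc (Suc n)) \<cdot> t"
  note F = linear_shift_mult[of "Suc n"] linear_shift[of "Suc n"] linear_shift[of "Suc (Suc n)"]
    linear_face[of "Suc n" "Suc (Suc n)"]
  note R = op_rules alg_module module_tpow F[unfolded tpow.simps]
  have "?F t = ?G t"
  proof (rule tensor_op_eqI0[where P = "(A \<otimes> tpow n) \<otimes> A" and F = ?F and G = ?G])
    show "t \<in> el X (A \<otimes> A \<otimes> A \<otimes> tpow n)" using Suc.prems by simp
    fix Y a s assume a: "a \<in> el Y A" and s: "s \<in> el Y (A \<otimes> A \<otimes> tpow n)"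
    have e: "shift (Suc n) \<cdot> s \<in> el Y ((A \<otimes> tpow n) \<otimes> A)" "face (Suc n) (Suc n) \<cdot> s \<in> el Y (A \<otimes> tpow n)"
      using linear_el[OF linear_shift[of "Suc n"], of s Y] linear_el[OF linear_face[of n "Suc n"], of s Y] s
      by (auto simp del: shift.simps)
    show "?F (te A (A \<otimes> A \<otimes> tpow n) a s) = ?G (te A (A \<otimes> A \<otimes> tpow n) a s)"
      using shift_Suc_te[of a Y s "Suc n"] face_step_te[of n "Suc n" a Y s] shift_mult_inv_assoc[OF a e(1)]
        shift_Suc_te[OF a e(2)] Suc.IH[OF s] a s by (simp del: shift.simps)
  qed ((unfold tpow.simps)?, (rule R | simp del: shift.simps)+)
  then show ?case .
qed

end

section \<open>The cosimplicial identities\<close>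

context bimodule
begin

declare bimod_module [simp] module_ihom [simp]

abbreviation "lact a m \<equiv> l \<cdot> te A M a m"
abbreviation "ract m a \<equiv> r \<cdot> te M A m a"

lemmas lact_lact = assoc_law_el[OF alg_module alg_module bimod_module bimod_module alg_module bimod_module
    mult_linear left_linear left_linear left_linear left_assoc]
  and ract_ract = assoc_law_el[OF bimod_module alg_module alg_module bimod_module bimod_module alg_module
    right_linear right_linear mult_linear right_linear right_assoc]
  and ract_lact = assoc_law_el[OF alg_module bimod_module alg_module bimod_module bimod_module bimod_module
    left_linear right_linear right_linear left_linear left_right]

lemma
  assumes T: "module T" and N: "module N"
  shows linear_hom_ev: "linear (ihom T N \<otimes> T) N (hom_ev T N)"
    and hom_ev_te: "\<And>X f t. f \<in> el X (ihom T N) \<Longrightarrow> t \<in> el X T \<Longrightarrow> hom_ev T N \<cdot> te (ihom T N) T f t = ihom_app T N f t"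
proof -
  note I = module_ihom[OF T N]
  note p = P1_hom[OF module_obj[OF I] module_obj[OF T]] P2_hom[OF module_obj[OF I] module_obj[OF T]]
  have F: "lin_op (Car (ihom T N)) T N (ihom_app T N)" "lin_op (Car T) (ihom T N) N (\<lambda>t f. ihom_app T N f t)"
    by (rule op_rules T N)+
  have eq: "\<forall>X. \<forall>f \<in> el X (ihom T N). \<forall>t \<in> el X T.
      ihom_app T N (P1 E (Car (ihom T N)) (Car T)) (P2 E (Car (ihom T N)) (Car T)) \<cdot> \<langle>f, t\<rangle> = ihom_app T N f t"
    using ihom_app_comp[OF T N p pair_hom] P1_pair P2_pair by metis
  note * = tlift_op[where B = "ihom_app T N", OF I T N F ihom_app_el[OF T N p] eq]
  show "linear (ihom T N \<otimes> T) N (hom_ev T N)"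
    "\<And>X f t. f \<in> el X (ihom T N) \<Longrightarrow> t \<in> el X T \<Longrightarrow> hom_ev T N \<cdot> te (ihom T N) T f t = ihom_app T N f t"
    unfolding hom_ev_def Let_def using * by blast+
qed

text \<open>\<open>ihom_pre\<close> is recognized as the adjunct of \<open>hom_ev\<close> after
  \<open>id \<otimes> g\<close>, so its linearity and its values come from the general facts on
  adjuncts.\<close>

lemma
  assumes P: "module P" "module P'" and N: "module N" and g: "linear P' P g"
  shows linear_ihom_pre: "linear (ihom P N) (ihom P' N) (ihom_pre P' P N g)"
    and ihom_pre_app: "\<And>X f t. f \<in> el X (ihom P N) \<Longrightarrow> t \<in> el X P' \<Longrightarrow>
      ihom_app P' N (ihom_pre P' P N g \<cdot> f) t = ihom_app P N f (g \<cdot> t)"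
proof -
  let ?H = "ihom P N"
  note H = module_ihom[OF P(1) N]
  note o = module_obj[OF H] module_obj[OF P(2)]
  let ?g = "hom_ev P N \<cdot> tmap ?H ?H P' P (idm ?H) g"
  note L = linear_tmap[OF H H P(2,1) linear_idm[OF H] g] linear_hom_ev[OF P(1) N]
  have lin: "linear (?H \<otimes> P') N ?g"
    using linear_comp[OF tensor_module[OF H P(2)] tensor_module[OF H P(1)] N L] .
  have eval: "?g \<cdot> te ?H P' f t = ihom_app P N f (g \<cdot> t)" if "f \<in> el X ?H" "t \<in> el X P'" for X f t
    using linear_comp_el[OF L te_el[OF H P(2) that]] tmap_te[OF H H P(2,1) linear_idm[OF H] g that]
      idm_el[OF that(1)] hom_ev_te[OF P(1) N that(1) linear_el[OF g that(2)]] by simp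
  have "?g \<cdot> \<tau> ?H P' = ihom_app P N (P1 E (Car ?H) (Car P')) (g \<cdot> P2 E (Car ?H) (Car P'))"
  proof (rule prod_arr_eqI[OF comp_hom[OF tau_hom[OF H P(2)] linear_hom[OF lin]]
        ihom_app_el[OF P(1) N P1_hom[OF o] linear_el[OF g P2_hom[OF o]]] o])
    fix Z f t assume f: "f \<in> el Z ?H" and t: "t \<in> el Z P'"
    show "(?g \<cdot> \<tau> ?H P') \<cdot> \<langle>f, t\<rangle> = ihom_app P N (P1 E (Car ?H) (Car P')) (g \<cdot> P2 E (Car ?H) (Car P')) \<cdot> \<langle>f, t\<rangle>"
      using comp_assoc[OF pair_hom[OF f t] tau_hom[OF H P(2)] linear_hom[OF lin]] eval[OF f t]
        ihom_app_comp[OF P(1) N P1_hom[OF o] linear_el[OF g P2_hom[OF o]] pair_hom[OF f t]]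
        P1_pair[OF f t] comp_P2_pair[OF linear_hom[OF g] f t] by simp
  qed
  then have "ihom_pre P' P N g = adjunct ?H P' N ?g"
    by (simp add: ihom_pre_def adjunct_def Let_def)
  then show "linear (ihom P N) (ihom P' N) (ihom_pre P' P N g)"
    "\<And>X f t. f \<in> el X (ihom P N) \<Longrightarrow> t \<in> el X P' \<Longrightarrow>
      ihom_app P' N (ihom_pre P' P N g \<cdot> f) t = ihom_app P N f (g \<cdot> t)"
    using linear_adjunct[OF H P(2) N lin] adjunct_app[OF H P(2) N lin] eval by simp_all
qed

section \<open>Values of the cofaces\<close>

lemma module_cochain [simp]: "module (cochain n)"
  by (simp add: cochain_def)

abbreviation "app n f t \<equiv> ihom_app (tpow n) M f t"

lemma app_el: "f \<in> el X (cochain n) \<Longrightarrow> t \<in> el X (tpow n) \<Longrightarrow> app n f t \<in> el X M"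
  unfolding cochain_def by (rule ihom_app_el) simp_all

lemma linear_ev: "linear (cochain n \<otimes> tpow n) M (hom_ev (tpow n) M)"
  unfolding cochain_def by (rule linear_hom_ev) simp_all

lemma ev_te:
  "f \<in> el X (cochain n) \<Longrightarrow> t \<in> el X (tpow n) \<Longrightarrow> hom_ev (tpow n) M \<cdot> te (cochain n) (tpow n) f t = app n f t"
  unfolding cochain_def by (rule hom_ev_te) simp_all

text \<open>What remains of the last coface after \<open>shift\<close>. It is isolated because it
  must be applied to elements of \<open>tpow n \<otimes> A\<close> that are not given as pure
  tensors.\<close>

definition ev_right :: "nat \<Rightarrow> 'a" where
  "ev_right n = r \<cdot> tmap (cochain n \<otimes> tpow n) M A A (hom_ev (tpow n) M) (idm A) \<cdot>
     inv_arr E (assoc (cochain n) (tpow n) A)"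

lemma
  shows linear_ev_right: "linear (cochain n \<otimes> tpow n \<otimes> A) M (ev_right n)"
    and ev_right_te: "\<And>X f t b. f \<in> el X (cochain n) \<Longrightarrow> t \<in> el X (tpow n) \<Longrightarrow> b \<in> el X A \<Longrightarrow>
      ev_right n \<cdot> te (cochain n) (tpow n \<otimes> A) f (te (tpow n) A t b) = ract (app n f t) b"
proof -
  let ?H = "cochain n" and ?T = "tpow n"
  note ev = linear_ev[of n]
  have L: "linear (?H \<otimes> ?T \<otimes> A) ((?H \<otimes> ?T) \<otimes> A) (inv_arr E (assoc ?H ?T A))"
    "linear ((?H \<otimes> ?T) \<otimes> A) (M \<otimes> A) (tmap (?H \<otimes> ?T) M A A (hom_ev ?T M) (idm A))"
    using linear_inv_assoc[of ?H ?T A] linear_tmap[OF _ _ _ _ ev linear_idm] by simp_all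
  note C = linear_comp[OF _ _ _ L]
  show "linear (?H \<otimes> ?T \<otimes> A) M (ev_right n)"
    unfolding ev_right_def using linear_comp[OF _ _ _ C right_linear] by simp
  fix X f t b assume f: "f \<in> el X ?H" and t: "t \<in> el X ?T" and b: "b \<in> el X A"
  have ft: "te ?H ?T f t \<in> el X (?H \<otimes> ?T)" and x: "te ?H (?T \<otimes> A) f (te ?T A t b) \<in> el X (?H \<otimes> ?T \<otimes> A)"
    using f t b by (simp_all add: te_el)
  show "ev_right n \<cdot> te ?H (?T \<otimes> A) f (te ?T A t b) = ract (app n f t) b"
    unfolding ev_right_def
    using linear_comp_el[OF C right_linear x] linear_comp_el[OF L x] inv_assoc_te[OF _ _ _ f t b]
      tmap_te[OF _ _ _ _ ev linear_idm ft b] idm_el[OF b] ev_te[OF f t] by simp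
qed

lemma
  shows linear_coface_first: "linear (cochain n) (cochain (Suc n)) (coface n 0)"
    and coface_first_app: "\<And>X f a t. f \<in> el X (cochain n) \<Longrightarrow> a \<in> el X A \<Longrightarrow> t \<in> el X (tpow n) \<Longrightarrow>
      app (Suc n) (coface n 0 \<cdot> f) (te A (tpow n) a t) = lact a (app n f t)"
proof -
  let ?H = "cochain n" and ?T = "tpow n"
  let ?l1 = "inv_arr E (assoc ?H A ?T)" and ?l2 = "tmap (?H \<otimes> A) (A \<otimes> ?H) ?T ?T (braid ?H A) (idm ?T)"
    and ?l3 = "assoc A ?H ?T" and ?l4 = "tmap A A (?H \<otimes> ?T) M (idm A) (hom_ev ?T M)"
  note ev = linear_ev[of n]
  have L: "linear (?H \<otimes> A \<otimes> ?T) ((?H \<otimes> A) \<otimes> ?T) ?l1" "linear ((?H \<otimes> A) \<otimes> ?T) ((A \<otimes> ?H) \<otimes> ?T) ?l2"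
    "linear ((A \<otimes> ?H) \<otimes> ?T) (A \<otimes> ?H \<otimes> ?T) ?l3" "linear (A \<otimes> ?H \<otimes> ?T) (A \<otimes> M) ?l4"
    using linear_inv_assoc[of ?H A ?T] linear_tmap[OF _ _ _ _ linear_braid linear_idm, of ?H A ?T]
      linear_assoc[of A ?H ?T] linear_tmap[OF _ _ _ _ linear_idm ev, of A] by simp_all
  have L2: "linear (?H \<otimes> A \<otimes> ?T) ((A \<otimes> ?H) \<otimes> ?T) (?l2 \<cdot> ?l1)" using linear_comp[OF _ _ _ L(1,2)] by simp
  have L3: "linear (?H \<otimes> A \<otimes> ?T) (A \<otimes> ?H \<otimes> ?T) (?l3 \<cdot> ?l2 \<cdot> ?l1)" using linear_comp[OF _ _ _ L2 L(3)] by simp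
  have L4: "linear (?H \<otimes> A \<otimes> ?T) (A \<otimes> M) (?l4 \<cdot> ?l3 \<cdot> ?l2 \<cdot> ?l1)" using linear_comp[OF _ _ _ L3 L(4)] by simp
  have L5: "linear (?H \<otimes> A \<otimes> ?T) M (l \<cdot> ?l4 \<cdot> ?l3 \<cdot> ?l2 \<cdot> ?l1)" using linear_comp[OF _ _ _ L4 left_linear] by simp
  have D: "coface n 0 = adjunct ?H (A \<otimes> ?T) M (l \<cdot> ?l4 \<cdot> ?l3 \<cdot> ?l2 \<cdot> ?l1)"
    by (simp add: coface_def Let_def)
  show "linear ?H (cochain (Suc n)) (coface n 0)"
    unfolding D cochain_def[of "Suc n"] tpow.simps using linear_adjunct[OF _ _ _ L5] by simp
  fix X f a t assume f: "f \<in> el X ?H" and a: "a \<in> el X A" and t: "t \<in> el X ?T"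
  have els: "te A ?T a t \<in> el X (A \<otimes> ?T)" "te ?H A f a \<in> el X (?H \<otimes> A)" "te ?H ?T f t \<in> el X (?H \<otimes> ?T)"
    and x: "te ?H (A \<otimes> ?T) f (te A ?T a t) \<in> el X (?H \<otimes> A \<otimes> ?T)"
    using f a t by (simp_all add: te_el)
  have "app (Suc n) (coface n 0 \<cdot> f) (te A ?T a t) =
      (l \<cdot> ?l4 \<cdot> ?l3 \<cdot> ?l2 \<cdot> ?l1) \<cdot> te ?H (A \<otimes> ?T) f (te A ?T a t)"
    unfolding D tpow.simps using adjunct_app[OF _ _ _ L5 f els(1)] by simp
  also have "\<dots> = l \<cdot> ?l4 \<cdot> ?l3 \<cdot> ?l2 \<cdot> ?l1 \<cdot> te ?H (A \<otimes> ?T) f (te A ?T a t)"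
    using linear_comp_el[OF L4 left_linear x] linear_comp_el[OF L3 L(4) x] linear_comp_el[OF L2 L(3) x]
      linear_comp_el[OF L(1,2) x] by simp
  also have "\<dots> = lact a (app n f t)"
    using inv_assoc_te[OF _ _ _ f a t] tmap_te[OF _ _ _ _ linear_braid linear_idm els(2) t] braid_te[OF _ _ f a]
      idm_el[OF t] assoc_te[OF _ _ _ a f t] tmap_te[OF _ _ _ _ linear_idm ev a els(3)] idm_el[OF a]
      ev_te[OF f t] by simp
  finally show "app (Suc n) (coface n 0 \<cdot> f) (te A ?T a t) = lact a (app n f t)" .
qed

lemma
  assumes i: "i < n"
  shows linear_coface_middle: "linear (cochain n) (cochain (Suc n)) (coface n (Suc i))"
    and coface_middle_app: "\<And>X f t. f \<in> el X (cochain n) \<Longrightarrow> t \<in> el X (A \<otimes> tpow n) \<Longrightarrow>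
      app (Suc n) (coface n (Suc i) \<cdot> f) t = app n f (face n (Suc i) \<cdot> t)"
  using linear_ihom_pre[OF _ _ _ linear_face[OF i], of M] ihom_pre_app[OF _ _ _ linear_face[OF i], of M] i
  by (simp_all add: coface_def Let_def cochain_def)

text \<open>The formula is stated for every \<open>t\<close>, with \<open>shift n \<cdot> t\<close>
  left unevaluated; splitting \<open>t\<close> as \<open>a \<otimes> t'\<close> would not expose its
  last factor.\<close>

lemma
  shows linear_coface_last: "linear (cochain n) (cochain (Suc n)) (coface n (Suc n))"
    and coface_last_app: "\<And>X f t. f \<in> el X (cochain n) \<Longrightarrow> t \<in> el X (A \<otimes> tpow n) \<Longrightarrow>
      app (Suc n) (coface n (Suc n) \<cdot> f) t = ev_right n \<cdot> te (cochain n) (tpow n \<otimes> A) f (shift n \<cdot> t)"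
proof -
  let ?H = "cochain n" and ?T = "tpow n"
  let ?s = "tmap ?H ?H (A \<otimes> ?T) (?T \<otimes> A) (idm ?H) (shift n)"
  let ?t = "tmap (?H \<otimes> ?T) M A A (hom_ev ?T M) (idm A)" and ?i = "inv_arr E (assoc ?H ?T A)"
  note ev = linear_ev[of n]
  have L: "linear (?H \<otimes> ?T \<otimes> A) ((?H \<otimes> ?T) \<otimes> A) ?i" "linear ((?H \<otimes> ?T) \<otimes> A) (M \<otimes> A) ?t"
    and S: "linear (?H \<otimes> A \<otimes> ?T) (?H \<otimes> ?T \<otimes> A) ?s"
    using linear_inv_assoc[of ?H ?T A] linear_tmap[OF _ _ _ _ ev linear_idm]
      linear_tmap[OF _ _ _ _ linear_idm linear_shift] by simp_all
  have L2: "linear (?H \<otimes> ?T \<otimes> A) (M \<otimes> A) (?t \<cdot> ?i)" using linear_comp[OF _ _ _ L] by simp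
  have "ev_right n \<cdot> ?s = r \<cdot> ?t \<cdot> ?i \<cdot> ?s"
    unfolding ev_right_def
    using comp_assoc[OF linear_hom[OF S] linear_hom[OF L2] linear_hom[OF right_linear]]
      comp_assoc[OF linear_hom[OF S] linear_hom[OF L(1)] linear_hom[OF L(2)]] by simp
  then have D: "coface n (Suc n) = adjunct ?H (A \<otimes> ?T) M (ev_right n \<cdot> ?s)"
    by (simp add: coface_def Let_def)
  have lin: "linear (?H \<otimes> A \<otimes> ?T) M (ev_right n \<cdot> ?s)"
    using linear_comp[OF _ _ _ S linear_ev_right] by simp
  show "linear ?H (cochain (Suc n)) (coface n (Suc n))"
    unfolding D cochain_def[of "Suc n"] tpow.simps using linear_adjunct[OF _ _ _ lin] by simp
  fix X f t assume f: "f \<in> el X ?H" and t: "t \<in> el X (A \<otimes> ?T)"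
  have x: "te ?H (A \<otimes> ?T) f t \<in> el X (?H \<otimes> A \<otimes> ?T)" using f t by (simp add: te_el)
  show "app (Suc n) (coface n (Suc n) \<cdot> f) t = ev_right n \<cdot> te ?H (?T \<otimes> A) f (shift n \<cdot> t)"
    unfolding D tpow.simps using adjunct_app[OF _ _ _ lin f t] linear_comp_el[OF S linear_ev_right x]
      tmap_te[OF _ _ _ _ linear_idm linear_shift f t] idm_el[OF f] by simp
qed

lemma linear_coface:
  assumes "i \<le> Suc n"
  shows "linear (cochain n) (cochain (Suc n)) (coface n i)"
proof (cases i)
  case (Suc i')
  then show ?thesis using assms linear_coface_middle[of i' n] linear_coface_last[of n] by (cases "i' < n") auto
qed (simp add: linear_coface_first)

abbreviation "ev_right_el n f s \<equiv> ev_right n \<cdot> te (cochain n) (tpow n \<otimes> A) f s"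

text \<open>Extensionality in the internal hom combined with the parametrized test on pure tensors;
  the cochain itself is the parameter.\<close>

lemma cochain_arr_eqI:
  assumes f: "linear (cochain m) (cochain (Suc n)) f" and g: "linear (cochain m) (cochain (Suc n)) g"
    and eq: "\<And>X h a t. h \<in> el X (cochain m) \<Longrightarrow> a \<in> el X A \<Longrightarrow> t \<in> el X (tpow n) \<Longrightarrow>
      app (Suc n) (f \<cdot> h) (te A (tpow n) a t) = app (Suc n) (g \<cdot> h) (te A (tpow n) a t)"
  shows "f = g"
proof -
  let ?T = "A \<otimes> tpow n"
  let ?H = "cochain m"
  have H: "Car ?H \<in> Obj E" by (simp add: module_obj)
  have T: "module ?T" by simp
  have hom: "f \<in> el (Car ?H) (ihom ?T M)" "g \<in> el (Car ?H) (ihom ?T M)"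
    using linear_hom[OF f] linear_hom[OF g] by (simp_all add: cochain_def)
  show ?thesis
  proof (rule ihom_eqI[OF T bimod_module hom])
    fix Y u s assume u: "u \<in> Hom E Y (Car ?H)" and s: "s \<in> el Y ?T"
    let ?F = "\<lambda>q u. ihom_app ?T M (q \<cdot> u)"
    show "?F f u s = ?F g u s"
    proof (rule tensor_op_eqI[OF alg_module module_tpow bimod_module _ _ _ u s])
      show "lin_op (Car ?H) ?T M (?F f)" "lin_op (Car ?H) ?T M (?F g)"
        by (rule op_rules alg_module module_tpow bimod_module hom)+
    qed (use eq in simp)
  qed
qed

text \<open>On pure tensors this is \<open>(a m) b = a (m b)\<close>, the compatibility of the two
  actions. It is the core of the identity between the outermost cofaces.\<close>

lemma ev_right_coface_first:
  assumes f: "f \<in> el X (cochain n)" and a: "a \<in> el X A" and s: "s \<in> el X (tpow n \<otimes> A)"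
  shows "ev_right (Suc n) \<cdot> te (cochain (Suc n)) ((A \<otimes> tpow n) \<otimes> A) (coface n 0 \<cdot> f) (inv_assoc_el n a s) =
    lact a (ev_right_el n f s)"
proof -
  let ?F = "\<lambda>f a s. ev_right (Suc n) \<cdot> te (cochain (Suc n)) ((A \<otimes> tpow n) \<otimes> A) (coface n 0 \<cdot> f) (inv_assoc_el n a s)"
  let ?G = "\<lambda>f a s. lact a (ev_right_el n f s)"
  note R = op_rules alg_module module_tpow bimod_module module_cochain linear_inv_assoc_tpow linear_coface_first left_linear
    linear_ev_right[of n] linear_ev_right[of "Suc n", unfolded tpow.simps]
  have "?F f a s = ?G f a s"
  proof (rule tensor_op_eqI2[where P = M and F = ?F and G = ?G, OF _ _ _ f a s])
    fix Y f a t b assume f: "f \<in> el Y (cochain n)" and a: "a \<in> el Y A" and t: "t \<in> el Y (tpow n)" and b: "b \<in> el Y A"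
    note D = linear_el[OF linear_coface_first f] and at = te_el[OF alg_module module_tpow a t]
    note app = app_el[OF f t]
    show "?F f a (te (tpow n) A t b) = ?G f a (te (tpow n) A t b)"
      using inv_assoc_tpow_te[OF a t b] ev_right_te[OF f t b] ev_right_te[of "coface n 0 \<cdot> f" Y "Suc n" "te A (tpow n) a t" b]
        coface_first_app[OF f a t] ract_lact[OF a app b] D at b by simp
  qed ((unfold tpow.simps)?, (rule R f a | simp)+)
  then show ?thesis .
qed

text \<open>An inner coface contributes a face beside an idle last factor; \<open>shift_face\<close>
  then carries this face across \<open>shift\<close>.\<close>

lemma ev_right_coface_middle:
  assumes i: "i < n" and f: "f \<in> el X (cochain n)" and s: "s \<in> el X ((A \<otimes> tpow n) \<otimes> A)"
  shows "ev_right (Suc n) \<cdot> te (cochain (Suc n)) ((A \<otimes> tpow n) \<otimes> A) (coface n (Suc i) \<cdot> f) s =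
    ev_right_el n f (face_id n (Suc i) \<cdot> s)"
proof -
  let ?T = "A \<otimes> tpow n"
  let ?F = "\<lambda>f s. ev_right (Suc n) \<cdot> te (cochain (Suc n)) (?T \<otimes> A) (coface n (Suc i) \<cdot> f) s"
  let ?G = "\<lambda>f s. ev_right_el n f (face_id n (Suc i) \<cdot> s)"
  note R = op_rules alg_module module_tpow bimod_module module_cochain linear_face_id[OF i] linear_coface_middle[OF i]
    linear_ev_right[of n] linear_ev_right[of "Suc n", unfolded tpow.simps]
  have "?F f s = ?G f s"
  proof (rule tensor_op_eqI1[where P = M and F = ?F and G = ?G, OF _ _ _ f s])
    fix Y f t b assume f: "f \<in> el Y (cochain n)" and t: "t \<in> el Y ?T" and b: "b \<in> el Y A"
    note D = linear_el[OF linear_coface_middle[OF i] f]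
    show "?F f (te ?T A t b) = ?G f (te ?T A t b)"
      using face_id_te[OF i t b] ev_right_te[OF f linear_el[OF linear_face[OF i] t] b]
        ev_right_te[of "coface n (Suc i) \<cdot> f" Y "Suc n" t b] coface_middle_app[OF i f t] D t b by simp
  qed ((unfold tpow.simps)?, (rule R f | simp)+)
  then show ?thesis .
qed

text \<open>On pure tensors this is \<open>(m c) b = m (c b)\<close>, the associativity of the right
  action.\<close>

lemma ev_right_last_mult:
  assumes f: "f \<in> el X (cochain n)" and b: "b \<in> el X A" and s: "s \<in> el X (tpow n \<otimes> A)"
  shows "ract (ev_right_el n f s) b =
    ev_right_el n f (last_mult n \<cdot> te (tpow n \<otimes> A) A s b)"
proof -
  let ?F = "\<lambda>f b s. ract (ev_right_el n f s) b"
  let ?G = "\<lambda>f b s. ev_right_el n f (last_mult n \<cdot> te (tpow n \<otimes> A) A s b)"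
  note R = op_rules alg_module module_tpow bimod_module module_cochain linear_last_mult right_linear linear_ev_right[of n]
  have "?F f b s = ?G f b s"
  proof (rule tensor_op_eqI2[where P = M and F = ?F and G = ?G, OF _ _ _ f b s])
    fix Y f b t c assume f: "f \<in> el Y (cochain n)" and b: "b \<in> el Y A" and t: "t \<in> el Y (tpow n)" and c: "c \<in> el Y A"
    note app = app_el[OF f t]
    show "?F f b (te (tpow n) A t c) = ?G f b (te (tpow n) A t c)"
      using last_mult_te[OF t c b] ev_right_te[OF f t c] ev_right_te[OF f t mu_el[OF c b]] ract_ract[OF app c b] by simp
  qed (rule R f b | simp)+
  then show ?thesis .
qed

text \<open>Two last cofaces act from the right one after the other;
  \<open>ev_right_last_mult\<close> merges the two actions into one multiplication at the right end,
  which \<open>shift_last\<close> identifies with the last inner face.\<close>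

lemma ev_right_coface_last:
  assumes f: "f \<in> el X (cochain n)" and s: "s \<in> el X ((A \<otimes> tpow n) \<otimes> A)"
  shows "ev_right (Suc n) \<cdot> te (cochain (Suc n)) ((A \<otimes> tpow n) \<otimes> A) (coface n (Suc n) \<cdot> f) s =
    ev_right_el n f (shift_mult n \<cdot> s)"
proof -
  let ?T = "A \<otimes> tpow n"
  let ?F = "\<lambda>f s. ev_right (Suc n) \<cdot> te (cochain (Suc n)) (?T \<otimes> A) (coface n (Suc n) \<cdot> f) s"
  let ?G = "\<lambda>f s. ev_right_el n f (shift_mult n \<cdot> s)"
  note R = op_rules alg_module module_tpow bimod_module module_cochain linear_shift_mult linear_coface_last
    linear_ev_right[of n] linear_ev_right[of "Suc n", unfolded tpow.simps]
  have "?F f s = ?G f s"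
  proof (rule tensor_op_eqI1[where P = M and F = ?F and G = ?G, OF _ _ _ f s])
    fix Y f t b assume f: "f \<in> el Y (cochain n)" and t: "t \<in> el Y ?T" and b: "b \<in> el Y A"
    note D = linear_el[OF linear_coface_last f]
    show "?F f (te ?T A t b) = ?G f (te ?T A t b)"
      using shift_mult_te[OF t b] ev_right_last_mult[OF f b linear_el[OF linear_shift t]]
        ev_right_te[of "coface n (Suc n) \<cdot> f" Y "Suc n" t b] coface_last_app[OF f t] D t b by simp
  qed ((unfold tpow.simps)?, (rule R f | simp)+)
  then show ?thesis .
qed

text \<open>Each position of \<open>i < j\<close> has its own reason. With \<open>i = 0\<close>:
  associativity of the left action if \<open>j = 1\<close>, the defining formulas if
  \<open>j\<close> is a later inner index, compatibility of the actions if \<open>j\<close> is last.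
  With \<open>i > 0\<close>: \<open>face_face\<close> if both are inner, \<open>shift_face\<close>
  if only \<open>j\<close> is last, \<open>shift_last\<close> if both are last in their
  degree.\<close>

lemma coface_coface_app:
  assumes ij: "i < j" "j \<le> Suc (Suc n)"
    and f: "f \<in> el X (cochain n)" and a: "a \<in> el X A" and t: "t \<in> el X (A \<otimes> tpow n)"
  shows "app (Suc (Suc n)) (coface (Suc n) j \<cdot> coface n i \<cdot> f) (te A (A \<otimes> tpow n) a t) =
    app (Suc (Suc n)) (coface (Suc n) i \<cdot> coface n (j - 1) \<cdot> f) (te A (A \<otimes> tpow n) a t)"
proof -
  let ?T = "A \<otimes> tpow n"
  let ?at = "te A ?T a t"
  have D: "coface n p \<cdot> f \<in> el X (cochain (Suc n))" if "p \<le> Suc n" for p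
    using linear_el[OF linear_coface[OF that] f] .
  have at: "?at \<in> el X (A \<otimes> tpow (Suc n))" using a t by (simp add: te_el)
  have first: "app (Suc (Suc n)) (coface (Suc n) 0 \<cdot> coface n p \<cdot> f) (?at) =
      lact a (app (Suc n) (coface n p \<cdot> f) t)" if "p \<le> Suc n" for p
    using coface_first_app[OF D[OF that] a, of t] t by simp
  have middle: "app (Suc (Suc n)) (coface (Suc n) (Suc q) \<cdot> coface n p \<cdot> f) (?at) =
      app (Suc n) (coface n p \<cdot> f) (face (Suc n) (Suc q) \<cdot> ?at)" if "p \<le> Suc n" "q < Suc n" for p q
    using coface_middle_app[OF that(2) D[OF that(1)] at] .
  have last: "app (Suc (Suc n)) (coface (Suc n) (Suc (Suc n)) \<cdot> coface n p \<cdot> f) (?at) =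
      ev_right (Suc n) \<cdot> te (cochain (Suc n)) (?T \<otimes> A) (coface n p \<cdot> f)
        (shift (Suc n) \<cdot> ?at)" if "p \<le> Suc n" for p
    using coface_last_app[OF D[OF that] at] by (simp del: shift.simps)
  have face_el: "face (Suc n) (Suc q) \<cdot> ?at \<in> el X ?T" if "q < Suc n" for q
    using linear_el[OF linear_face[OF that] at] by simp
  have shift_el: "shift (Suc n) \<cdot> ?at \<in> el X (?T \<otimes> A)"
    using linear_el[OF linear_shift at] by (simp del: shift.simps)
  show ?thesis
  proof (cases i)
    case i: 0
    consider "j = 1" | j' where "j = Suc (Suc j')" "j' < n" | "j = Suc (Suc n)"
      using ij i by (cases j; cases "j - 1") (auto simp: le_less)
    then show ?thesis
    proof cases
      case 1
      \<comment> \<open>\<open>coface n 0 \<cdot> f\<close> has a formula only on pure tensors, so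
        \<open>t\<close> is split as well; what remains is \<open>(a b) m = a (b m)\<close>.\<close>
      let ?F = "\<lambda>f a t. app (Suc n) (coface n 0 \<cdot> f) (face (Suc n) (Suc 0) \<cdot> te A ?T a t)"
      let ?G = "\<lambda>f a t. lact a (app (Suc n) (coface n 0 \<cdot> f) t)"
      have coch: "cochain (Suc n) = ihom ?T M" by (simp add: cochain_def)
      note R = op_rules alg_module module_tpow bimod_module module_cochain left_linear linear_face_first
        linear_coface_first[of n, unfolded coch]
      have "?F f a t = ?G f a t"
      proof (rule tensor_op_eqI2[where P = M and F = ?F and G = ?G, OF _ _ _ f a t])
        fix Y f a b u assume f: "f \<in> el Y (cochain n)" and a: "a \<in> el Y A" and b: "b \<in> el Y A" and u: "u \<in> el Y (tpow n)"
        note app = app_el[OF f u]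
        show "?F f a (te A (tpow n) b u) = ?G f a (te A (tpow n) b u)"
          using face_first_te[OF a b u] coface_first_app[OF f mu_el[OF a b] u] coface_first_app[OF f b u]
            lact_lact[OF a b app] by simp
      qed ((unfold tpow.simps)?, (rule R f a | simp)+)
      then show ?thesis using middle[of 0 0] first[of 0] 1 i by simp
    next
      case 2
      have ft: "face n (Suc j') \<cdot> t \<in> el X (tpow n)" using linear_el[OF linear_face[OF 2(2)] t] .
      show ?thesis
        using middle[of 0 "Suc j'"] first[of "Suc j'"] face_step_te[OF 2(2) a t] coface_first_app[OF f a ft]
          coface_middle_app[OF 2(2) f t] 2 i by simp
    next
      case 3
      show ?thesis
        using last[of 0] first[of "Suc n"] shift_Suc_te[OF a t] ev_right_coface_first[OF f a linear_el[OF linear_shift t]]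
          coface_last_app[OF f t] 3 i by (simp del: shift.simps)
    qed
  next
    case i: (Suc i')
    consider j' where "j = Suc (Suc j')" "j' < n" "i' \<le> j'" | "j = Suc (Suc n)" "i' < n" | "j = Suc (Suc n)" "i' = n"
      using ij i by (cases j; cases "j - 1") (auto simp: le_less less_Suc_eq)
    then show ?thesis
    proof cases
      case 1
      then have i'n: "i' < n" by simp
      show ?thesis
        using middle[of "Suc i'" "Suc j'"] middle[of "Suc j'" i'] coface_middle_app[OF i'n f face_el[of "Suc j'"]]
          coface_middle_app[OF 1(2) f face_el[of i']] face_face[OF 1(3,2), of "?at" X] at 1 i i'n
        by simp
    next
      case 2
      show ?thesis
        using last[of "Suc i'"] middle[of "Suc n" i'] ev_right_coface_middle[OF 2(2) f shift_el]
          shift_face[OF 2(2), of "?at" X] coface_last_app[OF f face_el[of i']] at 2 i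
        by (simp del: shift.simps)
    next
      case 3
      show ?thesis
        using last[of "Suc n"] middle[of "Suc n" n] ev_right_coface_last[OF f shift_el]
          shift_last[of "?at" X n] coface_last_app[OF f face_el[of n]] at 3 i
        by (simp del: shift.simps)
    qed
  qed
qed

lemma coface_coface:
  assumes ij: "i < j" "j \<le> Suc (Suc n)"
  shows "coface (Suc n) j \<cdot> coface n i = coface (Suc n) i \<cdot> coface n (j - 1)"
proof (rule cochain_arr_eqI)
  have L: "linear (cochain n) (cochain (Suc n)) (coface n p)" "q \<le> Suc (Suc n) \<Longrightarrow> linear (cochain (Suc n)) (cochain (Suc (Suc n))) (coface (Suc n) q)"
    if "p \<le> Suc n" for p q
    using linear_coface that by auto
  have p: "i \<le> Suc n" "j - 1 \<le> Suc n" "i \<le> Suc (Suc n)" using ij by auto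
  note L' = L(1)[OF p(1)] L(2)[OF p(1) ij(2)] L(1)[OF p(2)] L(2)[OF p(1) p(3)]
  show "linear (cochain n) (cochain (Suc (Suc n))) (coface (Suc n) j \<cdot> coface n i)"
    "linear (cochain n) (cochain (Suc (Suc n))) (coface (Suc n) i \<cdot> coface n (j - 1))"
    by (rule linear_comp[OF module_cochain module_cochain module_cochain L'(1,2)]
        linear_comp[OF module_cochain module_cochain module_cochain L'(3,4)])+
  fix X h a t assume h: "h \<in> el X (cochain n)" and a: "a \<in> el X A" and t: "t \<in> el X (tpow (Suc n))"
  then show "app (Suc (Suc n)) ((coface (Suc n) j \<cdot> coface n i) \<cdot> h) (te A (tpow (Suc n)) a t) =
      app (Suc (Suc n)) ((coface (Suc n) i \<cdot> coface n (j - 1)) \<cdot> h) (te A (tpow (Suc n)) a t)"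
    using coface_coface_app[OF ij h a, of t] linear_comp_el[OF L'(1,2) h] linear_comp_el[OF L'(3,4) h] by simp
qed

section \<open>Alternating sums and the cancellation in pairs\<close>

definition sgn_el :: "('o, 'a) modobj \<Rightarrow> nat \<Rightarrow> 'a \<Rightarrow> 'a" where
  "sgn_el G i x = (if even i then x else gneg G x)"

lemma alt_sum_Suc: "alt_sum G X f (Suc m) = gadd G (alt_sum G X f m) (sgn_el G m (f m))"
  by (simp add: sgn_el_def)

declare alt_sum.simps(2) [simp del] alt_sum_Suc [simp]

lemma alt_sum_cong: "(\<And>i. i < m \<Longrightarrow> f i = g i) \<Longrightarrow> alt_sum G X f m = alt_sum G X g m"
  by (induction m) simp_all

context
  fixes G :: "('o, 'a) modobj" and X assumes G: "ab_group_object G" and X: "X \<in> Obj E"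
begin

lemma sgn_el_el: "x \<in> el X G \<Longrightarrow> sgn_el G i x \<in> el X G"
  using gneg_el[OF G] by (simp add: sgn_el_def)

lemma sgn_el_add: "x \<in> el X G \<Longrightarrow> y \<in> el X G \<Longrightarrow> sgn_el G i (gadd G x y) = gadd G (sgn_el G i x) (sgn_el G i y)"
  using gneg_add[OF G] by (simp add: sgn_el_def)

lemma sgn_el_commute: "sgn_el G i (sgn_el G j x) = sgn_el G j (sgn_el G i x)"
  by (simp add: sgn_el_def)

lemma sgn_el_cancel: "x \<in> el X G \<Longrightarrow> gadd G (sgn_el G i x) (sgn_el G (Suc i) x) = gzero G X"
  using gadd_neg_left[OF G] gadd_neg_right[OF G] by (simp add: sgn_el_def)

lemma alt_sum_el: "(\<And>i. i < m \<Longrightarrow> f i \<in> el X G) \<Longrightarrow> alt_sum G X f m \<in> el X G"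
  by (induction m) (simp_all add: gzero_el[OF G X] gadd_el[OF G] sgn_el_el)

lemma alt_sum_add:
  assumes "\<And>i. i < m \<Longrightarrow> f i \<in> el X G" "\<And>i. i < m \<Longrightarrow> g i \<in> el X G"
  shows "alt_sum G X (\<lambda>i. gadd G (f i) (g i)) m = gadd G (alt_sum G X f m) (alt_sum G X g m)"
  using assms
proof (induction m)
  case 0
  show ?case using gadd_zero_left[OF G gzero_el[OF G X]] by simp
next
  case (Suc m)
  have els: "alt_sum G X f m \<in> el X G" "alt_sum G X g m \<in> el X G" "sgn_el G m (f m) \<in> el X G" "sgn_el G m (g m) \<in> el X G"
    using Suc.prems alt_sum_el sgn_el_el by simp_all
  show ?case
    using Suc els gadd_assoc[OF G els(1,2) gadd_el[OF G els(3,4)]] gadd_assoc[OF G els(1,3) gadd_el[OF G els(2,4)]]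
      gadd_left_commute[OF G els(2,3,4)] by (simp add: sgn_el_add)
qed

lemma alt_sum_sgn_el:
  assumes "\<And>i. i < m \<Longrightarrow> f i \<in> el X G"
  shows "alt_sum G X (\<lambda>i. sgn_el G p (f i)) m = sgn_el G p (alt_sum G X f m)"
  using assms
proof (induction m)
  case 0
  show ?case using gneg_zero[OF G X] by (simp add: sgn_el_def)
next
  case (Suc m)
  then show ?case
    by (simp add: sgn_el_add alt_sum_el sgn_el_el sgn_el_commute[of p m])
qed

text \<open>Enlarging the square \<open>{..<p} \<times> {..p}\<close> to \<open>{..p} \<times> {..p + 1}\<close> adds one row and one column; under the
  hypothesis the column \<open>j = p + 1\<close> repeats the row \<open>i = p\<close> with the opposite sign.\<close>

lemma alt_sum_alt_sum_zero:
  assumes "\<And>i j. i < p \<Longrightarrow> j < Suc p \<Longrightarrow> x i j \<in> el X G"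
    and "\<And>i j. i < j \<Longrightarrow> j \<le> p \<Longrightarrow> x i j = x (j - 1) i"
  shows "alt_sum G X (\<lambda>j. alt_sum G X (\<lambda>i. x i j) p) (Suc p) = gzero G X"
  using assms
proof (induction p)
  case 0
  show ?case
    using gadd_zero_left[OF G gzero_el[OF G X]] by (simp add: sgn_el_def)
next
  case (Suc p)
  let ?c = "\<lambda>j. alt_sum G X (\<lambda>i. x i j) p"
  let ?S = "alt_sum G X (x p) p" and ?s = "sgn_el G"
  have xel: "x i j \<in> el X G" if "i < Suc p" "j < Suc (Suc p)" for i j using Suc.prems(1) that .
  have cel: "?c j \<in> el X G" if "j < Suc (Suc p)" for j using xel that by (intro alt_sum_el) simp
  have Sel: "?S \<in> el X G" using xel by (intro alt_sum_el) simp
  \<comment> \<open>The corner: in the new row \<open>i = p\<close> the entries at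
    \<open>j = p\<close> and \<open>j = p + 1\<close> coincide and carry opposite signs, so the row
    reduces to its first \<open>p\<close> entries, the sum \<open>?S\<close>.\<close>
  have xp: "x p p \<in> el X G" "x p (Suc p) = x p p" using xel Suc.prems(2)[of p "Suc p"] by simp_all
  have "alt_sum G X (\<lambda>j. alt_sum G X (\<lambda>i. x i j) (Suc p)) (Suc (Suc p)) =
      gadd G (alt_sum G X ?c (Suc (Suc p))) (alt_sum G X (\<lambda>j. ?s p (x p j)) (Suc (Suc p)))"
    unfolding alt_sum_Suc[of G X "\<lambda>i. x i _" p] using cel xel sgn_el_el by (intro alt_sum_add) simp_all
  also have "alt_sum G X ?c (Suc (Suc p)) = ?s (Suc p) ?S"
  proof -
    have "alt_sum G X ?c (Suc p) = gzero G X" using Suc by (intro Suc.IH) simp_all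
    moreover have "?c (Suc p) = ?S" using Suc.prems(2)[of _ "Suc p"] by (intro alt_sum_cong) simp
    ultimately show ?thesis
      using gadd_zero_left[OF G sgn_el_el[OF Sel]] by (simp only: alt_sum_Suc[of G X ?c "Suc p"])
  qed
  also have "alt_sum G X (\<lambda>j. ?s p (x p j)) (Suc (Suc p)) = ?s p ?S"
  proof -
    have "alt_sum G X (\<lambda>j. ?s p (x p j)) p = ?s p ?S" using xel by (intro alt_sum_sgn_el) simp
    moreover have "gadd G (?s p (?s p (x p p))) (?s (Suc p) (?s p (x p p))) = gzero G X"
      using sgn_el_cancel[OF sgn_el_el[OF xp(1)]] .
    moreover have "gadd G (gadd G (?s p ?S) (?s p (?s p (x p p)))) (?s (Suc p) (?s p (x p p))) =
        gadd G (?s p ?S) (gadd G (?s p (?s p (x p p))) (?s (Suc p) (?s p (x p p))))"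
      using Sel xp(1) sgn_el_el by (intro gadd_assoc[OF G]) blast+
    ultimately show ?thesis
      using xp(2) gadd_zero_right[OF G sgn_el_el[OF Sel]] by simp
  qed
  also have "gadd G (?s (Suc p) ?S) (?s p ?S) = gzero G X"
    using sgn_el_cancel[OF Sel, of p] gadd_commute[OF G sgn_el_el[OF Sel] sgn_el_el[OF Sel]] by simp
  finally show ?case .
qed

end

lemma linear_alt_sum:
  assumes M: "module P" and N: "module Q" and h: "linear P Q h" and X: "X \<in> Obj E"
    and f: "\<And>i. i < m \<Longrightarrow> f i \<in> el X P"
  shows "h \<cdot> alt_sum P X f m = alt_sum Q X (\<lambda>i. h \<cdot> f i) m"
  using f
proof (induction m)
  case 0
  show ?case using linear_zero[OF M N h X] by simp
next
  case (Suc m)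
  have s: "h \<cdot> sgn_el P m (f m) = sgn_el Q m (h \<cdot> f m)"
    using linear_neg[OF M N h Suc.prems[of m]] by (simp add: sgn_el_def)
  have els: "alt_sum P X f m \<in> el X P" "sgn_el P m (f m) \<in> el X P"
    using Suc.prems alt_sum_el[OF module_group[OF M] X] sgn_el_el[OF module_group[OF M] X] by simp_all
  show ?case using linear_add[OF M h els N] Suc s by simp
qed

lemma alt_sum_comp:
  assumes G: "ab_group_object G" and u: "u \<in> Hom E Y X" and f: "\<And>i. i < m \<Longrightarrow> f i \<in> el X G"
  shows "alt_sum G X f m \<cdot> u = alt_sum G Y (\<lambda>i. f i \<cdot> u) m"
  using f
proof (induction m)
  case 0
  show ?case using gzero_comp[OF G u] by simp
next
  case (Suc m)
  have X: "X \<in> Obj E" using hom_objs[OF u] by blast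
  have s: "sgn_el G m (f m) \<cdot> u = sgn_el G m (f m \<cdot> u)"
    using gneg_comp[OF G Suc.prems[of m] u] by (simp add: sgn_el_def)
  have els: "alt_sum G X f m \<in> el X G" "sgn_el G m (f m) \<in> el X G"
    using Suc.prems alt_sum_el[OF G X] sgn_el_el[OF G X] by simp_all
  show ?case using gadd_comp[OF G els u] Suc s by simp
qed

text \<open>Composition distributes over both sums: precomposition respects pointwise sums in
  general, and postcomposition does so because every coface is linear. The result is a double
  alternating sum to which the cosimplicial identities apply.\<close>

lemma differential_differential:
  "differential (Suc n) \<cdot> differential n = gzero (cochain (n + 2)) (Car (cochain n))"
proof -
  let ?X = "Car (cochain n)" and ?H' = "cochain (Suc n)" and ?H'' = "cochain (Suc (Suc n))"
  note mods = module_cochain[of n] module_cochain[of "Suc n"] module_cochain[of "Suc (Suc n)"]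
  note G = module_group[OF mods(2)] module_group[OF mods(3)] and X = module_obj[OF mods(1)]
  have c: "coface n i \<in> el ?X ?H'" if "i < Suc (Suc n)" for i
    using linear_hom[OF linear_coface] that by simp
  have L: "linear ?H' ?H'' (coface (Suc n) j)" if "j < Suc (Suc (Suc n))" for j
    using linear_coface that by simp
  have d: "differential n \<in> el ?X ?H'"
    unfolding differential_def using c by (intro alt_sum_el[OF G(1) X]) simp
  have "differential (Suc n) \<cdot> differential n =
      alt_sum ?H'' ?X (\<lambda>j. coface (Suc n) j \<cdot> differential n) (Suc n + 2)"
    unfolding differential_def[of "Suc n"] using linear_hom[OF L] by (intro alt_sum_comp[OF G(2) d]) simp
  also have "\<dots> = alt_sum ?H'' ?X (\<lambda>j. alt_sum ?H'' ?X (\<lambda>i. coface (Suc n) j \<cdot> coface n i) (Suc (Suc n))) (Suc n + 2)"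
    by (rule alt_sum_cong) (use c in \<open>simp add: differential_def linear_alt_sum[OF mods(2,3) L X] del: alt_sum_Suc\<close>)
  \<comment> \<open>Here \<open>p = n + 2\<close>: there are \<open>n + 2\<close> cofaces out of
    degree \<open>n\<close> and one more out of degree \<open>n + 1\<close>, and
    \<open>coface_coface\<close> is the required symmetry of the terms.\<close>
  also have "\<dots> = gzero ?H'' ?X"
    using alt_sum_alt_sum_zero[OF G(2) X, of "Suc (Suc n)" "\<lambda>i j. coface (Suc n) j \<cdot> coface n i"]
      linear_el[OF L c] coface_coface by simp
  finally show ?thesis by simp
qed

end

theorem proposition3p2:
  fixes E :: "('o, 'a) topos_data"
    and k :: "('o, 'a) ringobj"
    and tensor :: "('o, 'a) modobj \<Rightarrow> ('o, 'a) modobj \<Rightarrow> ('o, 'a) modobj"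
    and \<tau> :: "('o, 'a) modobj \<Rightarrow> ('o, 'a) modobj \<Rightarrow> 'a"
    and A M :: "('o, 'a) modobj"
    and \<mu> \<eta> l r :: 'a
  assumes "topos E"
    and "has_set_of_cogenerators TYPE('u) (pre_topos.Ab E)"
    and "pre_topos.comm_ring_object E k"
    and "topos_with_tensor E k tensor \<tau>"
    and "k_algebra E k tensor \<tau> A \<mu> \<eta>"
    and "bimodule E k tensor \<tau> A \<mu> \<eta> M l r"
  shows "\<forall>n. Comp E (bimodule.differential E k tensor \<tau> A \<mu> M l r (Suc n))
                  (bimodule.differential E k tensor \<tau> A \<mu> M l r n) =
             pre_topos.gzero E (bimodule.cochain E k tensor A M (n + 2))
               (Car (bimodule.cochain E k tensor A M n))"
  using bimodule.differential_differential[OF assms(6)] by blast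

end
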